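(* The language of $\mathbf{C}^2$ (the two-variable fragment with counting quantifiers) extended by a linear order axiom is domain-liftable. That is: for every sentence $\phi = \psi \wedge Linear(\leq)$, where $\psi$ is a $\mathbf{C}^2$ sentence and $\leq$ is one of the binary predicates of its language, and for every pair of weightings $(w,\overline{w})$ with $w(\leq)=\overline{w}(\leq)=1$, there is an algorithm which on input $n$ computes $\mathsf{WFOMC}(\phi, n, w, \overline{w})$ in time polynomial in the domain size $n$.
   Context: Logic. Function-free first-order logic over a finite set $\mathcal{P}$ of predicates; sentences are constant-free. Herbrand semantics over the finite domain $\Delta=\{1,\dots,n\}$: the Herbrand base $\mathsf{HB}$ is the set of all ground atoms $P(t_1,\dots,t_k)$ with $P/k\in\mathcal{P}$, $t_i\in\Delta$; a possible world is a subset $\omega\subseteq\mathsf{HB}$ (the set of true atoms). $\omega[P]$ denotes the restriction of $\omega$ to atoms with predicate $P$. $\mathbf{FO}^2$ is the set of sentences using at most two logical variables. $\mathbf{C}^2$ extends $\mathbf{FO}^2$ by counting quantifiers $\exists^{=k}x$, $\exists^{\leq k}x$, $\exists^{\geq k}x$ ($k\in\mathbb{N}$), where e.g. $\exists^{=k}x:\psi(x)$ holds in $\omega$ iff there are exactly $k$ elements $A\in\Delta$ with $\omega\models\psi(A)$ (similarly for $\le,\ge$). Linear order axiom. A possible world $\omega$ is a model of $\psi\wedge Linear(\leq)$ iff $\omega\models\psi$ and $\omega[\leq]$ is a linear (total, reflexive, antisymmetric, transitive) order on $\Delta$. WFOMC. Given $w,\overline{w}:\mathcal{P}\to\mathbb{R}$,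 and $\mathsf{pred}(l)$ the predicate of a ground atom $l$, $$\mathsf{WFOMC}(\phi,n,w,\overline{w})=\sum_{\omega\subseteq\mathsf{HB}:\,\omega\models\phi}\ \prod_{l\in\omega}w(\mathsf{pred}(l))\prod_{l\in\mathsf{HB}\setminus\omega}\overline{w}(\mathsf{pred}(l)).$$ Domain-liftable means: for each fixed sentence $\phi$ of the language and fixed weightings, $\mathsf{WFOMC}(\phi,n,w,\overline{w})$ can be computed in time polynomial in $n$. Time is measured with arithmetic operations on real numbers at unit cost. *)

theory Defs
  imports Complex_Main "HOL-Computational_Algebra.Polynomial"
begin

section \<open>First-order logic with counting quantifiers\<close>

text \<open>
  Terms are variables only (no function symbols, no constants); variables are natural numbers.
  The fragment is two-variable if at most two distinct variables occur, free or bound; they may be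
  requantified. Predicates may have any arity, including 0 and arities above 2.
\<close>

datatype 'p fm =
    Atom 'p "nat list"
  | Equal nat nat
  | Neg "'p fm"
  | Conj "'p fm" "'p fm"
  | Disj "'p fm" "'p fm"
  | Imp "'p fm" "'p fm"
  | Iff "'p fm" "'p fm"
  | Forall nat "'p fm"
  | Exists nat "'p fm"
  | ExistsEq nat nat "'p fm"  \<comment> \<open>in these three: the bound \<open>k\<close>, then the variable\<close>
  | ExistsLe nat nat "'p fm"
  | ExistsGe nat nat "'p fm"

fun vars :: "'p fm \<Rightarrow> nat set" where
  "vars (Atom p xs) = set xs"
| "vars (Equal x y) = {x, y}"
| "vars (Neg f) = vars f"
| "vars (Conj f g) = vars f \<union> vars g"
| "vars (Disj f g) = vars f \<union> vars g"
| "vars (Imp f g) = vars f \<union> vars g"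
| "vars (Iff f g) = vars f \<union> vars g"
| "vars (Forall x f) = insert x (vars f)"
| "vars (Exists x f) = insert x (vars f)"
| "vars (ExistsEq k x f) = insert x (vars f)"
| "vars (ExistsLe k x f) = insert x (vars f)"
| "vars (ExistsGe k x f) = insert x (vars f)"

fun free_vars :: "'p fm \<Rightarrow> nat set" where
  "free_vars (Atom p xs) = set xs"
| "free_vars (Equal x y) = {x, y}"
| "free_vars (Neg f) = free_vars f"
| "free_vars (Conj f g) = free_vars f \<union> free_vars g"
| "free_vars (Disj f g) = free_vars f \<union> free_vars g"
| "free_vars (Imp f g) = free_vars f \<union> free_vars g"
| "free_vars (Iff f g) = free_vars f \<union> free_vars g"
| "free_vars (Forall x f) = free_vars f - {x}"
| "free_vars (Exists x f) = free_vars f - {x}"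
| "free_vars (ExistsEq k x f) = free_vars f - {x}"
| "free_vars (ExistsLe k x f) = free_vars f - {x}"
| "free_vars (ExistsGe k x f) = free_vars f - {x}"

fun well_formed :: "'p set \<Rightarrow> ('p \<Rightarrow> nat) \<Rightarrow> 'p fm \<Rightarrow> bool" where
  "well_formed P ar (Atom p xs) \<longleftrightarrow> p \<in> P \<and> length xs = ar p"
| "well_formed P ar (Equal x y) \<longleftrightarrow> True"
| "well_formed P ar (Neg f) \<longleftrightarrow> well_formed P ar f"
| "well_formed P ar (Conj f g) \<longleftrightarrow> well_formed P ar f \<and> well_formed P ar g"
| "well_formed P ar (Disj f g) \<longleftrightarrow> well_formed P ar f \<and> well_formed P ar g"
| "well_formed P ar (Imp f g) \<longleftrightarrow> well_formed P ar f \<and> well_formed P ar g"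
| "well_formed P ar (Iff f g) \<longleftrightarrow> well_formed P ar f \<and> well_formed P ar g"
| "well_formed P ar (Forall x f) \<longleftrightarrow> well_formed P ar f"
| "well_formed P ar (Exists x f) \<longleftrightarrow> well_formed P ar f"
| "well_formed P ar (ExistsEq k x f) \<longleftrightarrow> well_formed P ar f"
| "well_formed P ar (ExistsLe k x f) \<longleftrightarrow> well_formed P ar f"
| "well_formed P ar (ExistsGe k x f) \<longleftrightarrow> well_formed P ar f"

definition C2_sentence :: "'p set \<Rightarrow> ('p \<Rightarrow> nat) \<Rightarrow> 'p fm \<Rightarrow> bool" where
  "C2_sentence P ar f \<longleftrightarrow> well_formed P ar f \<and> free_vars f = {} \<and> card (vars f) \<le> 2"


section \<open>Herbrand semantics over the domain {1, ..., n}\<close>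

type_synonym 'p ground_atom = "'p \<times> nat list"
type_synonym 'p world = "'p ground_atom set"

definition herbrand_base :: "'p set \<Rightarrow> ('p \<Rightarrow> nat) \<Rightarrow> nat \<Rightarrow> 'p ground_atom set" where
  "herbrand_base P ar n = {(p, ts). p \<in> P \<and> length ts = ar p \<and> set ts \<subseteq> {1..n}}"

fun sat :: "nat \<Rightarrow> 'p world \<Rightarrow> (nat \<Rightarrow> nat) \<Rightarrow> 'p fm \<Rightarrow> bool" where
  "sat n \<omega> \<sigma> (Atom p xs) \<longleftrightarrow> (p, map \<sigma> xs) \<in> \<omega>"
| "sat n \<omega> \<sigma> (Equal x y) \<longleftrightarrow> \<sigma> x = \<sigma> y"
| "sat n \<omega> \<sigma> (Neg f) \<longleftrightarrow> \<not> sat n \<omega> \<sigma> f"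
| "sat n \<omega> \<sigma> (Conj f g) \<longleftrightarrow> sat n \<omega> \<sigma> f \<and> sat n \<omega> \<sigma> g"
| "sat n \<omega> \<sigma> (Disj f g) \<longleftrightarrow> sat n \<omega> \<sigma> f \<or> sat n \<omega> \<sigma> g"
| "sat n \<omega> \<sigma> (Imp f g) \<longleftrightarrow> (sat n \<omega> \<sigma> f \<longrightarrow> sat n \<omega> \<sigma> g)"
| "sat n \<omega> \<sigma> (Iff f g) \<longleftrightarrow> (sat n \<omega> \<sigma> f \<longleftrightarrow> sat n \<omega> \<sigma> g)"
| "sat n \<omega> \<sigma> (Forall x f) \<longleftrightarrow> (\<forall>a\<in>{1..n}. sat n \<omega> (\<sigma>(x := a)) f)"
| "sat n \<omega> \<sigma> (Exists x f) \<longleftrightarrow> (\<exists>a\<in>{1..n}. sat n \<omega> (\<sigma>(x := a)) f)"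
| "sat n \<omega> \<sigma> (ExistsEq k x f) \<longleftrightarrow> card {a \<in> {1..n}. sat n \<omega> (\<sigma>(x := a)) f} = k"
| "sat n \<omega> \<sigma> (ExistsLe k x f) \<longleftrightarrow> card {a \<in> {1..n}. sat n \<omega> (\<sigma>(x := a)) f} \<le> k"
| "sat n \<omega> \<sigma> (ExistsGe k x f) \<longleftrightarrow> card {a \<in> {1..n}. sat n \<omega> (\<sigma>(x := a)) f} \<ge> k"

text \<open>
  A sentence has no free variables, so its truth value does not depend on the assignment.
\<close>

definition models :: "'p fm \<Rightarrow> nat \<Rightarrow> 'p world \<Rightarrow> bool" where
  "models f n \<omega> \<longleftrightarrow> (\<forall>\<sigma>. sat n \<omega> \<sigma> f)"

definition with_linear_order :: "'p fm \<Rightarrow> 'p \<Rightarrow> nat \<Rightarrow> 'p world \<Rightarrow> bool" where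
  "with_linear_order \<psi> le n \<omega> \<longleftrightarrow>
     models \<psi> n \<omega> \<and> linear_order_on {1..n} {(a, b). (le, [a, b]) \<in> \<omega>}"

text \<open>
  The sentence argument \<open>\<phi>\<close> is given by its satisfaction relation (domain size, world), since the
  linear order axiom is a semantic condition on worlds.
\<close>

definition WFOMC ::
  "'p set \<Rightarrow> ('p \<Rightarrow> nat) \<Rightarrow> (nat \<Rightarrow> 'p world \<Rightarrow> bool) \<Rightarrow> nat \<Rightarrow> ('p \<Rightarrow> real) \<Rightarrow> ('p \<Rightarrow> real) \<Rightarrow> real"
where
  "WFOMC P ar \<phi> n w wbar =
     (\<Sum>\<omega> \<in> {\<omega>. \<omega> \<subseteq> herbrand_base P ar n \<and> \<phi> n \<omega>}.
        (\<Prod>l\<in>\<omega>. w (fst l)) * (\<Prod>l\<in>herbrand_base P ar n - \<omega>. wbar (fst l)))"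


section \<open>Real random access machine with unit-cost arithmetic\<close>

text \<open>
  A while language over finitely many arrays of natural numbers and finitely many arrays of reals
  (those mentioned in the program), with indirect addressing. Natural numbers serve for counting
  and addressing and support only addition and truncated subtraction, so their bit length grows at
  most linearly with time; real numbers support the field operations and comparison.
  There is no rounding and no conversion from reals to natural numbers.
\<close>

datatype iexp =
    ILit nat
  | IGet nat iexp  \<comment> \<open>array name, position\<close>
  | IAdd iexp iexp
  | ISub iexp iexp

datatype rexp =
    RLit real
  | RGet nat iexp
  | RAdd rexp rexp
  | RSub rexp rexp
  | RMul rexp rexp
  | RDiv rexp rexp

datatype bexp =
    ILe iexp iexp
  | RLe rexp rexp
  | BNot bexp
  | BAnd bexp bexp

datatype com =
    Skip
  | ISet nat iexp iexp  \<comment> \<open>array name, position, new value\<close>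
  | RSet nat iexp rexp
  | Seq com com
  | If bexp com com
  | While bexp com

type_synonym istore = "nat \<Rightarrow> nat \<Rightarrow> nat"
type_synonym rstore = "nat \<Rightarrow> nat \<Rightarrow> real"
type_synonym state = "istore \<times> rstore"

fun ival :: "iexp \<Rightarrow> istore \<Rightarrow> nat" where
  "ival (ILit k) I = k"
| "ival (IGet a e) I = I a (ival e I)"
| "ival (IAdd e f) I = ival e I + ival f I"
| "ival (ISub e f) I = ival e I - ival f I"

fun rval :: "rexp \<Rightarrow> state \<Rightarrow> real" where
  "rval (RLit c) s = c"
| "rval (RGet a e) s = snd s a (ival e (fst s))"
| "rval (RAdd e f) s = rval e s + rval f s"
| "rval (RSub e f) s = rval e s - rval f s"
| "rval (RMul e f) s = rval e s * rval f s"
| "rval (RDiv e f) s = rval e s / rval f s"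

fun bval :: "bexp \<Rightarrow> state \<Rightarrow> bool" where
  "bval (ILe e f) s \<longleftrightarrow> ival e (fst s) \<le> ival f (fst s)"
| "bval (RLe e f) s \<longleftrightarrow> rval e s \<le> rval f s"
| "bval (BNot b) s \<longleftrightarrow> \<not> bval b s"
| "bval (BAnd b c) s \<longleftrightarrow> bval b s \<and> bval c s"

text \<open>Every literal, memory access, arithmetic operation, comparison and connective costs 1.\<close>

fun icost :: "iexp \<Rightarrow> nat" where
  "icost (ILit k) = 1"
| "icost (IGet a e) = 1 + icost e"
| "icost (IAdd e f) = 1 + icost e + icost f"
| "icost (ISub e f) = 1 + icost e + icost f"

fun rcost :: "rexp \<Rightarrow> nat" where
  "rcost (RLit c) = 1"
| "rcost (RGet a e) = 1 + icost e"
| "rcost (RAdd e f) = 1 + rcost e + rcost f"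
| "rcost (RSub e f) = 1 + rcost e + rcost f"
| "rcost (RMul e f) = 1 + rcost e + rcost f"
| "rcost (RDiv e f) = 1 + rcost e + rcost f"

fun bcost :: "bexp \<Rightarrow> nat" where
  "bcost (ILe e f) = 1 + icost e + icost f"
| "bcost (RLe e f) = 1 + rcost e + rcost f"
| "bcost (BNot b) = 1 + bcost b"
| "bcost (BAnd b c) = 1 + bcost b + bcost c"

fun array_update :: "(nat \<Rightarrow> nat \<Rightarrow> 'v) \<Rightarrow> nat \<Rightarrow> nat \<Rightarrow> 'v \<Rightarrow> nat \<Rightarrow> nat \<Rightarrow> 'v" where
  "array_update M a i v = M(a := (M a)(i := v))"

text \<open>\<open>exec c s t s'\<close>: started in \<open>s\<close>, the command \<open>c\<close> halts in \<open>s'\<close> after \<open>t\<close> time units.\<close>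

inductive exec :: "com \<Rightarrow> state \<Rightarrow> nat \<Rightarrow> state \<Rightarrow> bool" where
  Skip: "exec Skip s 1 s"
| ISet: "exec (ISet a e f) (I, R) (1 + icost e + icost f)
           (array_update I a (ival e I) (ival f I), R)"
| RSet: "exec (RSet a e f) (I, R) (1 + icost e + rcost f)
           (I, array_update R a (ival e I) (rval f (I, R)))"
| Seq: "exec c s t s' \<Longrightarrow> exec d s' t' s'' \<Longrightarrow> exec (Seq c d) s (t + t') s''"
| IfTrue: "bval b s \<Longrightarrow> exec c s t s' \<Longrightarrow> exec (If b c d) s (1 + bcost b + t) s'"
| IfFalse: "\<not> bval b s \<Longrightarrow> exec d s t s' \<Longrightarrow> exec (If b c d) s (1 + bcost b + t) s'"
| WhileFalse: "\<not> bval b s \<Longrightarrow> exec (While b c) s (1 + bcost b) s"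
| WhileTrue: "bval b s \<Longrightarrow> exec c s t s' \<Longrightarrow> exec (While b c) s' t' s'' \<Longrightarrow>
     exec (While b c) s (1 + bcost b + t + t') s''"

text \<open>The real constants written in a program.\<close>

fun rexp_lits :: "rexp \<Rightarrow> real set" where
  "rexp_lits (RLit c) = {c}"
| "rexp_lits (RGet a e) = {}"
| "rexp_lits (RAdd e f) = rexp_lits e \<union> rexp_lits f"
| "rexp_lits (RSub e f) = rexp_lits e \<union> rexp_lits f"
| "rexp_lits (RMul e f) = rexp_lits e \<union> rexp_lits f"
| "rexp_lits (RDiv e f) = rexp_lits e \<union> rexp_lits f"

fun bexp_lits :: "bexp \<Rightarrow> real set" where
  "bexp_lits (ILe e f) = {}"
| "bexp_lits (RLe e f) = rexp_lits e \<union> rexp_lits f"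
| "bexp_lits (BNot b) = bexp_lits b"
| "bexp_lits (BAnd b c) = bexp_lits b \<union> bexp_lits c"

fun com_lits :: "com \<Rightarrow> real set" where
  "com_lits Skip = {}"
| "com_lits (ISet a e f) = {}"
| "com_lits (RSet a e f) = rexp_lits f"
| "com_lits (Seq c d) = com_lits c \<union> com_lits d"
| "com_lits (If b c d) = bexp_lits b \<union> com_lits c \<union> com_lits d"
| "com_lits (While b c) = bexp_lits b \<union> com_lits c"

text \<open>
  The input is cell 0 of natural-number array 0, the output cell 0 of real array 0; all other cells
  are initially 0. Besides rationals a program may mention only the real numbers in \<open>K\<close>, the real
  data of the problem. This restriction matters: with arbitrary real constants one could store the
  answers for all \<open>n\<close> in the digits of a single constant.
\<close>

definition init_state :: "nat \<Rightarrow> state" where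
  "init_state n = (array_update (\<lambda>_ _. 0) 0 0 n, \<lambda>_ _. 0)"

definition polytime_computable :: "real set \<Rightarrow> (nat \<Rightarrow> real) \<Rightarrow> bool" where
  "polytime_computable K f \<longleftrightarrow>
     (\<exists>c (q :: nat poly). com_lits c \<subseteq> \<rat> \<union> K \<and>
        (\<forall>n. \<exists>t s. exec c (init_state n) t s \<and> snd s 0 0 = f n \<and> t \<le> poly q n))"

end

(*
  A sentence with two variables is a condition on elements and pairs of elements. Guess, for every
  element and every quantified subformula, whether the subformula holds of the element. Given the
  guesses, each matrix is decided by the guesses and atoms of a single pair, so that a guess can be
  checked by counting, for each element, the partners satisfying the matrix, where counts beyond
  the bounds of the quantifiers need not be distinguished. An element is thus described by its
  1-type, its guesses and its capped counters: one of finitely many states.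

  By symmetry all n! linear orders contribute the same amount, so one may insert the elements in
  increasing order. Inserting an element means choosing its 1-type and guesses and then a 2-table
  with each old element, which updates both counters. The weight of all completions depends only on
  the multiset of states, which takes polynomially many values; tabulating it amounts to evaluating
  a weighted multiset rewriting system whose rules test only which states are present. Atoms with
  three or more distinct arguments are unconstrained and contribute powers whose exponents are
  combinations of binomial coefficients.
*)
theory Submission
  imports Defs "HOL-Library.Multiset" "HOL-Library.FuncSet" "HOL-Combinatorics.Permutations"
begin

section \<open>Running programs\<close>

text \<open>The machine shapes the argument. Naturals can only be added and subtracted, and there is
  no conversion between naturals and reals; so the multiset is kept as a numeral whose digits are
  counted up along with the table pointer, and a successor is addressed by subtracting and adding
  powers of the base. A rule that tests occupancy of fixed cells costs constant time, but it does
  not weigh a step by the multiplicity of a state. Each phase therefore always handles the least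
  occupied cell, and one has to know that the order in which the new element meets the old ones is
  irrelevant; this is what \<open>commuting\<close> expresses.

  Guessing does not distort the count, because each world admits exactly one consistent guess. The
  order enters through weights: its atoms get weight 0 or 1 according to the tuple. Such weights are
  invariant under increasing renamings only, hence an inserted element has to be larger than all
  before. The empty domain is set apart, since a sentence cannot be tested there by evaluating it at
  elements.\<close>

definition runs :: "com \<Rightarrow> state \<Rightarrow> nat \<Rightarrow> state \<Rightarrow> bool" where
  "runs c s T s' \<longleftrightarrow> (\<exists>t\<le>T. exec c s t s')"

lemma runs_mono: "runs c s T s' \<Longrightarrow> T \<le> T' \<Longrightarrow> runs c s T' s'"
  unfolding runs_def by (meson le_trans)

lemma runs_Skip: "runs Skip s 1 s"
  unfolding runs_def by (blast intro: exec.Skip)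

lemma runs_ISet:
  "runs (ISet a e f) (I, R) (1 + icost e + icost f) (array_update I a (ival e I) (ival f I), R)"
  unfolding runs_def by (blast intro: exec.ISet)

lemma runs_RSet:
  "runs (RSet a e f) (I, R) (1 + icost e + rcost f) (I, array_update R a (ival e I) (rval f (I, R)))"
  unfolding runs_def by (blast intro: exec.RSet)

lemma runs_ISetI:
  "I' = array_update I a (ival e I) (ival f I) \<Longrightarrow> 1 + icost e + icost f \<le> T \<Longrightarrow>
    runs (ISet a e f) (I, R) T (I', R)"
  using runs_ISet runs_mono by blast

lemma runs_RSetI:
  "R' = array_update R a (ival e I) (rval f (I, R)) \<Longrightarrow> 1 + icost e + rcost f \<le> T \<Longrightarrow>
    runs (RSet a e f) (I, R) T (I, R')"
  using runs_RSet runs_mono by blast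

lemma runs_Seq: "runs c s T s' \<Longrightarrow> runs d s' T' s'' \<Longrightarrow> runs (Seq c d) s (T + T') s''"
  unfolding runs_def by (blast intro: exec.Seq add_mono)

lemma runs_If:
  assumes "bval b s \<Longrightarrow> runs c s T s'" "\<not> bval b s \<Longrightarrow> runs d s T s'"
  shows "runs (com.If b c d) s (1 + bcost b + T) s'"
  using assms unfolding runs_def by (cases "bval b s") (blast intro: exec.IfTrue exec.IfFalse add_left_mono)+

text \<open>\<open>Inv\<close> is indexed by the number of finished rounds, so that it also acts as
  the variant. The factor \<open>Suc N\<close> charges the final failing test like a full
  round.\<close>

lemma runs_While:
  assumes step: "\<And>i s. i < N \<Longrightarrow> Inv i s \<Longrightarrow> bval b s \<and> (\<exists>s'. runs c s T s' \<and> Inv (Suc i) s')"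
    and exit: "\<And>s. Inv N s \<Longrightarrow> \<not> bval b s"
    and init: "Inv 0 s"
  shows "\<exists>s'. runs (While b c) s (Suc N * (1 + bcost b + T)) s' \<and> Inv N s'"
proof -
  have "Inv i s \<Longrightarrow> i \<le> N \<Longrightarrow>
      \<exists>s'. runs (While b c) s (Suc (N - i) * (1 + bcost b + T)) s' \<and> Inv N s'" for i s
  proof (induction "N - i" arbitrary: i s)
    case 0
    then have "i = N" by simp
    then have "exec (While b c) s (1 + bcost b) s" using exit 0 by (blast intro: exec.WhileFalse)
    then have "runs (While b c) s (1 + bcost b) s" unfolding runs_def by blast
    then have "runs (While b c) s (Suc (N - i) * (1 + bcost b + T)) s" by (rule runs_mono) simp
    then show ?case using \<open>i = N\<close> 0 by blast
  next
    case (Suc m)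
    then obtain s' where s': "bval b s" "runs c s T s'" "Inv (Suc i) s'"
      using step[of i s] by (metis less_Suc_eq_le zero_less_Suc zero_less_diff)
    obtain s'' where s'': "runs (While b c) s' (Suc (N - Suc i) * (1 + bcost b + T)) s''" "Inv N s''"
      using Suc.hyps(1)[of "Suc i" s'] Suc.hyps(2) s'(3) Suc.prems by (metis Suc_leI diff_Suc_eq_diff_pred
          diff_Suc_1 diff_diff_left plus_1_eq_Suc add.commute zero_less_Suc zero_less_diff)
    obtain t t' where t: "t \<le> T" "exec c s t s'" "t' \<le> Suc (N - Suc i) * (1 + bcost b + T)"
      "exec (While b c) s' t' s''"
      using s'(2) s''(1) unfolding runs_def by blast
    have "exec (While b c) s (1 + bcost b + t + t') s''"
      using exec.WhileTrue s'(1) t(2,4) by blast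
    moreover have "1 + bcost b + t + t' \<le> Suc (N - i) * (1 + bcost b + T)"
    proof -
      have "N - i = Suc (N - Suc i)" using Suc.hyps(2) by simp
      then show ?thesis using t(1,3) by simp
    qed
    ultimately show ?case using s''(2) unfolding runs_def by blast
  qed
  from this[of 0 s] init show ?thesis by simp
qed

section \<open>Closure properties of polynomial-time computability\<close>

lemma polytime_computable_iff:
  "polytime_computable K f \<longleftrightarrow> (\<exists>c q. com_lits c \<subseteq> \<rat> \<union> K \<and>
     (\<forall>n. \<exists>s. runs c (init_state n) (poly q n) s \<and> snd s 0 0 = f n))"
  unfolding polytime_computable_def runs_def by (metis (no_types, lifting))

lemma polytime_computableI:
  assumes "com_lits c \<subseteq> \<rat> \<union> K"
    and "\<And>n. \<exists>s. runs c (init_state n) (a * (n + 1) ^ e) s \<and> snd s 0 0 = f n"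
  shows "polytime_computable K f"
  unfolding polytime_computable_iff
  using assms by (intro exI[of _ c] exI[of _ "[:a:] * [:1, 1:] ^ e"]) (simp add: add.commute)

section \<open>Renaming the arrays of a program, so that two programs can run in disjoint
  memory\<close>

fun ren_iexp :: "(nat \<Rightarrow> nat) \<Rightarrow> iexp \<Rightarrow> iexp" where
  "ren_iexp h (ILit k) = ILit k"
| "ren_iexp h (IGet a e) = IGet (h a) (ren_iexp h e)"
| "ren_iexp h (IAdd e f) = IAdd (ren_iexp h e) (ren_iexp h f)"
| "ren_iexp h (ISub e f) = ISub (ren_iexp h e) (ren_iexp h f)"

fun ren_rexp :: "(nat \<Rightarrow> nat) \<Rightarrow> rexp \<Rightarrow> rexp" where
  "ren_rexp h (RLit c) = RLit c"
| "ren_rexp h (RGet a e) = RGet (h a) (ren_iexp h e)"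
| "ren_rexp h (RAdd e f) = RAdd (ren_rexp h e) (ren_rexp h f)"
| "ren_rexp h (RSub e f) = RSub (ren_rexp h e) (ren_rexp h f)"
| "ren_rexp h (RMul e f) = RMul (ren_rexp h e) (ren_rexp h f)"
| "ren_rexp h (RDiv e f) = RDiv (ren_rexp h e) (ren_rexp h f)"

fun ren_bexp :: "(nat \<Rightarrow> nat) \<Rightarrow> bexp \<Rightarrow> bexp" where
  "ren_bexp h (ILe e f) = ILe (ren_iexp h e) (ren_iexp h f)"
| "ren_bexp h (RLe e f) = RLe (ren_rexp h e) (ren_rexp h f)"
| "ren_bexp h (BNot b) = BNot (ren_bexp h b)"
| "ren_bexp h (BAnd b c) = BAnd (ren_bexp h b) (ren_bexp h c)"

fun ren_com :: "(nat \<Rightarrow> nat) \<Rightarrow> com \<Rightarrow> com" where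
  "ren_com h Skip = Skip"
| "ren_com h (ISet a e f) = ISet (h a) (ren_iexp h e) (ren_iexp h f)"
| "ren_com h (RSet a e f) = RSet (h a) (ren_iexp h e) (ren_rexp h f)"
| "ren_com h (Seq c d) = Seq (ren_com h c) (ren_com h d)"
| "ren_com h (com.If b c d) = com.If (ren_bexp h b) (ren_com h c) (ren_com h d)"
| "ren_com h (While b c) = While (ren_bexp h b) (ren_com h c)"

definition view :: "(nat \<Rightarrow> nat) \<Rightarrow> state \<Rightarrow> state" where
  "view h s = (fst s \<circ> h, snd s \<circ> h)"

lemma ival_ren [simp]: "ival (ren_iexp h e) I = ival e (I \<circ> h)"
  by (induction e) auto

lemma rval_ren [simp]: "rval (ren_rexp h e) s = rval e (view h s)"
  by (induction e) (auto simp: view_def)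

lemma bval_ren [simp]: "bval (ren_bexp h b) s = bval b (view h s)"
  by (induction b) (auto, auto simp: view_def)

lemma icost_ren [simp]: "icost (ren_iexp h e) = icost e"
  by (induction e) auto

lemma rcost_ren [simp]: "rcost (ren_rexp h e) = rcost e"
  by (induction e) auto

lemma bcost_ren [simp]: "bcost (ren_bexp h b) = bcost b"
  by (induction b) auto

lemma rexp_lits_ren [simp]: "rexp_lits (ren_rexp h e) = rexp_lits e"
  by (induction e) auto

lemma bexp_lits_ren [simp]: "bexp_lits (ren_bexp h b) = bexp_lits b"
  by (induction b) auto

lemma com_lits_ren [simp]: "com_lits (ren_com h c) = com_lits c"
  by (induction c) auto

definition same_outside :: "(nat \<Rightarrow> nat) \<Rightarrow> state \<Rightarrow> state \<Rightarrow> bool" where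
  "same_outside h s s' \<longleftrightarrow> (\<forall>a. a \<notin> range h \<longrightarrow> fst s' a = fst s a \<and> snd s' a = snd s a)"

lemma same_outside_refl: "same_outside h s s"
  by (simp add: same_outside_def)

lemma same_outside_trans: "same_outside h s s' \<Longrightarrow> same_outside h s' s'' \<Longrightarrow> same_outside h s s''"
  by (simp add: same_outside_def)

text \<open>A program only sees the arrays it names, so the renamed one simulates it inside the
  range of \<open>h\<close> and at the same cost, whatever the other arrays contain. Injectivity of
  \<open>h\<close> ensures that a write to one array leaves the views of the others alone.\<close>

lemma exec_ren:
  assumes "exec c s t s'" "inj h" "view h S = s"
  shows "\<exists>S'. exec (ren_com h c) S t S' \<and> view h S' = s' \<and> same_outside h S S'"
  using assms(1,3)
proof (induction arbitrary: S rule: exec.induct)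
  case (Skip s)
  have "exec (ren_com h Skip) S 1 S" using exec.Skip[of S] by simp
  then show ?case using Skip same_outside_refl by blast
next
  case (ISet a e f I R)
  obtain I' R' where S: "S = (I', R')" by (cases S)
  have [simp]: "I = I' \<circ> h" "R = R' \<circ> h" using ISet S by (auto simp: view_def)
  have "exec (ren_com h (ISet a e f)) S (1 + icost e + icost f)
     (array_update I' (h a) (ival e I) (ival f I), R')"
    using exec.ISet[of "h a" "ren_iexp h e" "ren_iexp h f" I' R'] S by simp
  moreover have "view h (array_update I' (h a) (ival e I) (ival f I), R') =
      (array_update I a (ival e I) (ival f I), R)"
    using \<open>inj h\<close> by (auto simp: view_def fun_eq_iff inj_def)
  ultimately show ?case using S by (fastforce simp: same_outside_def)
next
  case (RSet a e f I R)
  obtain I' R' where S: "S = (I', R')" by (cases S)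
  have [simp]: "I = I' \<circ> h" "R = R' \<circ> h" using RSet S by (auto simp: view_def)
  have "exec (ren_com h (RSet a e f)) S (1 + icost e + rcost f)
     (I', array_update R' (h a) (ival e I) (rval f (I, R)))"
    using exec.RSet[of "h a" "ren_iexp h e" "ren_rexp h f" I' R'] S by (simp add: view_def)
  moreover have "view h (I', array_update R' (h a) (ival e I) (rval f (I, R))) =
      (I, array_update R a (ival e I) (rval f (I, R)))"
    using \<open>inj h\<close> by (auto simp: view_def fun_eq_iff inj_def)
  ultimately show ?case using S by (fastforce simp: same_outside_def)
next
  case (Seq c s t s' d t' s'')
  obtain S' where S': "exec (ren_com h c) S t S'" "view h S' = s'" "same_outside h S S'"
    using Seq.IH(1)[OF Seq.prems] by blast
  obtain S'' where S'': "exec (ren_com h d) S' t' S''" "view h S'' = s''" "same_outside h S' S''"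
    using Seq.IH(2)[OF S'(2)] by blast
  have "exec (ren_com h (Seq c d)) S (t + t') S''"
    using exec.Seq[OF S'(1) S''(1)] by simp
  then show ?case using S''(2) same_outside_trans[OF S'(3) S''(3)] by blast
next
  case (IfTrue b s c t s' d)
  obtain S' where S': "exec (ren_com h c) S t S'" "view h S' = s'" "same_outside h S S'"
    using IfTrue.IH[OF IfTrue.prems] by blast
  have "exec (ren_com h (com.If b c d)) S (1 + bcost b + t) S'"
    using exec.IfTrue[of "ren_bexp h b", OF _ S'(1)] IfTrue by simp
  then show ?case using S'(2,3) by blast
next
  case (IfFalse b s d t s' c)
  obtain S' where S': "exec (ren_com h d) S t S'" "view h S' = s'" "same_outside h S S'"
    using IfFalse.IH[OF IfFalse.prems] by blast
  have "exec (ren_com h (com.If b c d)) S (1 + bcost b + t) S'"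
    using exec.IfFalse[of "ren_bexp h b", OF _ S'(1)] IfFalse by simp
  then show ?case using S'(2,3) by blast
next
  case (WhileFalse b s c)
  have "exec (ren_com h (While b c)) S (1 + bcost b) S"
    using exec.WhileFalse[of "ren_bexp h b" S] WhileFalse by simp
  then show ?case using WhileFalse.prems same_outside_refl by blast
next
  case (WhileTrue b s c t s' t' s'')
  obtain S' where S': "exec (ren_com h c) S t S'" "view h S' = s'" "same_outside h S S'"
    using WhileTrue.IH(1)[OF WhileTrue.prems] by blast
  obtain S'' where S'': "exec (ren_com h (While b c)) S' t' S''" "view h S'' = s''" "same_outside h S' S''"
    using WhileTrue.IH(2)[OF S'(2)] by blast
  have "exec (ren_com h (While b c)) S (1 + bcost b + t + t') S''"
    using exec.WhileTrue[of "ren_bexp h b" S, OF _ S'(1)] S''(1) WhileTrue by simp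
  then show ?case using S''(2) same_outside_trans[OF S'(3) S''(3)] by blast
qed

lemma runs_ren:
  assumes "runs c s T s'" "inj h" "view h S = s"
  shows "\<exists>S'. runs (ren_com h c) S T S' \<and> view h S' = s' \<and> same_outside h S S'"
  using assms exec_ren unfolding runs_def by blast

text \<open>Both programs expect the input in array 0 and an otherwise zero memory, which the second
  would not find after the first; hence the renaming into disjoint memories. \<open>val\<close> and
  \<open>lits\<close> abstract from the choice of the arithmetic constructor
  \<open>E\<close>.\<close>

lemma polytime_computable_binop:
  assumes f: "polytime_computable K f" and g: "polytime_computable K g"
    and val: "\<And>a b s. rval (E a b) s = F (rval a s) (rval b s)"
    and lits: "\<And>a b. rexp_lits (E a b) = rexp_lits a \<union> rexp_lits b"
  shows "polytime_computable K (\<lambda>n. F (f n) (g n))"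
proof -
  obtain c p where c: "com_lits c \<subseteq> \<rat> \<union> K"
    and c': "\<And>n. \<exists>s. runs c (init_state n) (poly p n) s \<and> snd s 0 0 = f n"
    using f unfolding polytime_computable_iff by blast
  obtain d q where d: "com_lits d \<subseteq> \<rat> \<union> K"
    and d': "\<And>n. \<exists>s. runs d (init_state n) (poly q n) s \<and> snd s 0 0 = g n"
    using g unfolding polytime_computable_iff by blast
  \<comment> \<open>Odd arrays for one program, positive even ones for the other. Array 0 lies in
    neither range: as a natural-number array it keeps the input for the copies in
    \<open>h1 0 = 1\<close> and \<open>h2 0 = 2\<close>, and as a real array it is free for the
    output.\<close>
  define h1 h2 :: "nat \<Rightarrow> nat" where "h1 = (\<lambda>a. 2 * a + 1)" and "h2 = (\<lambda>a. 2 * a + 2)"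
  have inj: "inj h1" "inj h2" by (auto simp: h1_def h2_def inj_def)
  have disj: "h1 a \<notin> range h2" "h2 a \<notin> range h1" "0 \<notin> range h1" "0 \<notin> range h2" for a
    unfolding h1_def h2_def by (auto; presburger)+
  define z where "z = IGet 0 (ILit 0)"
  define out where "out = RSet 0 (ILit 0) (E (RGet 1 (ILit 0)) (RGet 2 (ILit 0)))"
  define prog where "prog = Seq (ISet 1 (ILit 0) z) (Seq (ISet 2 (ILit 0) z)
     (Seq (ren_com h1 c) (Seq (ren_com h2 d) out)))"
  define r where "r = [:8 + 2 + rcost (E (RGet 1 (ILit 0)) (RGet 2 (ILit 0))):] + p + q"
  have "\<exists>s. runs prog (init_state n) (poly r n) s \<and> snd s 0 0 = F (f n) (g n)" for n
  proof -
    obtain s1 where s1: "runs c (init_state n) (poly p n) s1" "snd s1 0 0 = f n"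
      using c' by blast
    obtain s2 where s2: "runs d (init_state n) (poly q n) s2" "snd s2 0 0 = g n"
      using d' by blast
    define I0 R0 where "I0 = fst (init_state n)" and "R0 = snd (init_state n)"
    define I1 where "I1 = array_update I0 1 0 n"
    define I2 where "I2 = array_update I1 2 0 n"
    have s0: "init_state n = (I0, R0)" by (simp add: I0_def R0_def)
    have a: "runs (ISet 1 (ILit 0) z) (init_state n) 4 (I1, R0)"
      unfolding s0 by (rule runs_ISetI) (simp_all add: z_def I1_def I0_def init_state_def)
    have b: "runs (ISet 2 (ILit 0) z) (I1, R0) 4 (I2, R0)"
      by (rule runs_ISetI) (simp_all add: z_def I2_def I1_def I0_def init_state_def)
    have v1: "view h1 (I2, R0) = init_state n"
      by (auto simp: view_def I2_def I1_def I0_def R0_def init_state_def h1_def fun_eq_iff; presburger)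
    obtain S1 where S1: "runs (ren_com h1 c) (I2, R0) (poly p n) S1" "view h1 S1 = s1"
      "same_outside h1 (I2, R0) S1"
      using runs_ren[OF s1(1) inj(1) v1] by blast
    have "view h2 S1 = view h2 (I2, R0)"
      using S1(3) disj(2) by (auto simp: view_def same_outside_def fun_eq_iff)
    also have "\<dots> = init_state n"
      by (auto simp: view_def I2_def I1_def I0_def R0_def init_state_def h2_def fun_eq_iff)
    finally have v2: "view h2 S1 = init_state n" .
    obtain S2 where S2: "runs (ren_com h2 d) S1 (poly q n) S2" "view h2 S2 = s2"
      "same_outside h2 S1 S2"
      using runs_ren[OF s2(1) inj(2) v2] by blast
    have "snd S2 (h1 0) 0 = snd S1 (h1 0) 0"
      using S2(3) disj(1) by (auto simp: same_outside_def)
    then have v: "snd S2 1 0 = f n" "snd S2 2 0 = g n"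
      using S1(2) s1(2) S2(2) s2(2) by (auto simp: view_def h1_def h2_def eval_nat_numeral)
    have o: "runs out S2 (2 + rcost (E (RGet 1 (ILit 0)) (RGet 2 (ILit 0))))
       (fst S2, array_update (snd S2) 0 0 (F (f n) (g n)))"
      unfolding out_def by (subst surjective_pairing[of S2]) (rule runs_RSetI; simp add: v[unfolded One_nat_def] val)
    have "runs prog (init_state n) (4 + (4 + (poly p n + (poly q n + (2 + rcost (E (RGet 1 (ILit 0)) (RGet 2 (ILit 0))))))))
       (fst S2, array_update (snd S2) 0 0 (F (f n) (g n)))"
      unfolding prog_def by (rule runs_Seq[OF a runs_Seq[OF b runs_Seq[OF S1(1) runs_Seq[OF S2(1) o]]]])
    then have "runs prog (init_state n) (poly r n) (fst S2, array_update (snd S2) 0 0 (F (f n) (g n)))"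
      by (rule runs_mono) (simp add: r_def)
    then show ?thesis by fastforce
  qed
  moreover have "com_lits prog \<subseteq> \<rat> \<union> K"
    using c d by (auto simp: prog_def out_def lits)
  ultimately show ?thesis unfolding polytime_computable_iff by blast
qed

lemma polytime_computable_add:
  "polytime_computable K f \<Longrightarrow> polytime_computable K g \<Longrightarrow> polytime_computable K (\<lambda>n. f n + g n)"
  by (rule polytime_computable_binop[where E = RAdd]) auto

lemma polytime_computable_mult:
  "polytime_computable K f \<Longrightarrow> polytime_computable K g \<Longrightarrow> polytime_computable K (\<lambda>n. f n * g n)"
  by (rule polytime_computable_binop[where E = RMul]) auto

text \<open>Sums and products of weights need not be admissible literals, but an expression built
  from admissible literals computes them anew in constant time. Independence of the memory is
  expressed by having the same value in every state.\<close>

definition constants :: "real set \<Rightarrow> real set" where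
  "constants K = {r. \<exists>e. rexp_lits e \<subseteq> \<rat> \<union> K \<and> (\<forall>s. rval e s = r)}"

lemma constants_base: "r \<in> \<rat> \<union> K \<Longrightarrow> r \<in> constants K"
  unfolding constants_def by (auto intro!: exI[of _ "RLit r"])

lemma constants_add: "a \<in> constants K \<Longrightarrow> b \<in> constants K \<Longrightarrow> a + b \<in> constants K"
  unfolding constants_def by clarsimp (metis Un_least rexp_lits.simps(3) rval.simps(3))

lemma constants_mult: "a \<in> constants K \<Longrightarrow> b \<in> constants K \<Longrightarrow> a * b \<in> constants K"
  unfolding constants_def by clarsimp (metis Un_least rexp_lits.simps(5) rval.simps(5))

lemma constants_sum: "(\<And>x. x \<in> A \<Longrightarrow> f x \<in> constants K) \<Longrightarrow> sum f A \<in> constants K"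
  by (induction A rule: infinite_finite_induct) (auto intro: constants_add constants_base)

lemma constants_prod: "(\<And>x. x \<in> A \<Longrightarrow> f x \<in> constants K) \<Longrightarrow> prod f A \<in> constants K"
  by (induction A rule: infinite_finite_induct) (auto intro: constants_mult constants_base)

lemma constants_power: "a \<in> constants K \<Longrightarrow> a ^ k \<in> constants K"
  by (induction k) (auto intro: constants_mult constants_base)

lemma polytime_computable_const:
  assumes "r \<in> constants K"
  shows "polytime_computable K (\<lambda>_. r)"
proof -
  obtain e where e: "rexp_lits e \<subseteq> \<rat> \<union> K" "\<And>s. rval e s = r"
    using assms unfolding constants_def by blast
  show ?thesis
  proof (rule polytime_computableI)
    show "com_lits (RSet 0 (ILit 0) e) \<subseteq> \<rat> \<union> K" using e by simp
    show "\<exists>s. runs (RSet 0 (ILit 0) e) (init_state n) ((2 + rcost e) * (n + 1) ^ 0) s \<and> snd s 0 0 = r" for n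
      using runs_RSet[of 0 "ILit 0" e "fst (init_state n)" "snd (init_state n)"] e(2) by fastforce
  qed
qed

lemma polytime_computable_sum:
  "finite A \<Longrightarrow> (\<And>x. x \<in> A \<Longrightarrow> polytime_computable K (f x)) \<Longrightarrow>
    polytime_computable K (\<lambda>n. \<Sum>x\<in>A. f x n)"
  by (induction A rule: finite_induct)
    (simp_all add: polytime_computable_add polytime_computable_const constants_base)

lemma polytime_computable_prod:
  "finite A \<Longrightarrow> (\<And>x. x \<in> A \<Longrightarrow> polytime_computable K (f x)) \<Longrightarrow>
    polytime_computable K (\<lambda>n. \<Prod>x\<in>A. f x n)"
  by (induction A rule: finite_induct)
    (simp_all add: polytime_computable_mult polytime_computable_const constants_base)

lemma polytime_computable_at_0:
  assumes f: "polytime_computable K f" and r: "r \<in> constants K"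
  shows "polytime_computable K (\<lambda>n. if n = 0 then r else f n)"
proof -
  obtain e where e: "rexp_lits e \<subseteq> \<rat> \<union> K" "\<And>s. rval e s = r"
    using r unfolding constants_def by blast
  obtain c p where c: "com_lits c \<subseteq> \<rat> \<union> K"
    and c': "\<And>n. \<exists>s. runs c (init_state n) (poly p n) s \<and> snd s 0 0 = f n"
    using f unfolding polytime_computable_iff by blast
  define b where "b = ILe (IGet 0 (ILit 0)) (ILit 0)"
  define prog where "prog = com.If b (RSet 0 (ILit 0) e) c"
  have b: "bval b (init_state n) \<longleftrightarrow> n = 0" "bcost b = 4" for n
    by (auto simp: b_def init_state_def)
  have "\<exists>s. runs prog (init_state n) (poly ([:7 + rcost e:] + p) n) s \<and> snd s 0 0 = (if n = 0 then r else f n)" for n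
  proof -
    obtain I R where s: "init_state n = (I, R)" by (cases "init_state n")
    obtain s' where s': "runs c (I, R) (poly p n) s'" "snd s' 0 0 = f n" using c' s by metis
    define s'' where "s'' = (if n = 0 then (I, array_update R 0 0 r) else s')"
    have "runs prog (I, R) (1 + bcost b + (2 + rcost e + poly p n)) s''"
      unfolding prog_def using s' b(1)[of n] e(2) unfolding s
      by (intro runs_If) (auto simp: s''_def intro: runs_RSetI runs_mono)
    then have "runs prog (I, R) (poly ([:7 + rcost e:] + p) n) s''" by (rule runs_mono) (simp add: b(2))
    moreover have "snd s'' 0 0 = (if n = 0 then r else f n)" using s'(2) by (simp add: s''_def)
    ultimately show ?thesis unfolding s by blast
  qed
  moreover have "com_lits prog \<subseteq> \<rat> \<union> K"
    using c e by (auto simp: prog_def b_def)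
  ultimately show ?thesis unfolding polytime_computable_iff by blast
qed

text \<open>\<open>ini\<close> and \<open>body\<close> leave the natural-number store alone, so cell
  0 can count down from \<open>n\<close>; all data of the iteration live in the real store. The
  result may sit in any fixed cell \<open>j\<close> and is copied to the output cell at the
  end.\<close>

lemma polytime_computable_iterate:
  assumes ini: "\<And>I R. runs ini (I, R) Ti (I, G R)" "com_lits ini \<subseteq> \<rat> \<union> K"
    and body: "\<And>I R. runs body (I, R) Tb (I, F R)" "com_lits body \<subseteq> \<rat> \<union> K"
  shows "polytime_computable K (\<lambda>n. (F ^^ n) (G (\<lambda>_ _. 0)) 0 j)"
proof -
  define b where "b = ILe (ILit 1) (IGet 0 (ILit 0))"
  define dec where "dec = ISet 0 (ILit 0) (ISub (IGet 0 (ILit 0)) (ILit 1))"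
  define out where "out = RSet 0 (ILit 0) (RGet 0 (ILit j))"
  define prog where "prog = Seq ini (Seq (While b (Seq body dec)) out)"
  define Z where "Z = (\<lambda>(_ :: nat) (_ :: nat). 0 :: real)"
  show ?thesis
  proof (rule polytime_computableI)
    show "com_lits prog \<subseteq> \<rat> \<union> K"
      using ini(2) body(2) by (auto simp: prog_def b_def dec_def out_def)
    fix n
    define Inv where "Inv i s \<longleftrightarrow> fst s 0 0 = n - i \<and> snd s = (F ^^ i) (G Z)" for i and s :: state
    have init: "Inv 0 (fst (init_state n), G Z)" by (simp add: Inv_def init_state_def)
    have step: "bval b s \<and> (\<exists>s'. runs (Seq body dec) s (Tb + 6) s' \<and> Inv (Suc i) s')"
      if "i < n" "Inv i s" for i s
    proof -
      obtain I R where s: "s = (I, R)" by (cases s)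
      have "bval b s" using that by (auto simp: Inv_def b_def s)
      moreover have "runs dec (I, F R) 6 (array_update I 0 0 (I 0 0 - 1), F R)"
        unfolding dec_def by (rule runs_ISetI) simp_all
      then have "runs (Seq body dec) (I, R) (Tb + 6) (array_update I 0 0 (I 0 0 - 1), F R)"
        by (rule runs_Seq[OF body(1)])
      moreover have "Inv (Suc i) (array_update I 0 0 (I 0 0 - 1), F R)"
        using that by (auto simp: Inv_def s)
      ultimately show ?thesis using s by blast
    qed
    have exit: "\<not> bval b s" if "Inv n s" for s
      using that by (auto simp: Inv_def b_def)
    obtain s where s: "runs (While b (Seq body dec)) (fst (init_state n), G Z) (Suc n * (1 + bcost b + (Tb + 6))) s" "Inv n s"
      using runs_While[of n Inv b "Seq body dec" "Tb + 6", OF step exit init] by blast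
    have o: "runs out s 4 (fst s, array_update (snd s) 0 0 (snd s 0 j))"
      unfolding out_def by (subst surjective_pairing[of s]) (rule runs_RSetI; simp)
    have i: "runs ini (init_state n) Ti (fst (init_state n), G Z)"
      using ini(1)[of "fst (init_state n)" Z] by (simp add: init_state_def Z_def)
    have "runs prog (init_state n) (Ti + (Suc n * (1 + bcost b + (Tb + 6)) + 4))
        (fst s, array_update (snd s) 0 0 (snd s 0 j))"
      unfolding prog_def by (rule runs_Seq[OF i runs_Seq[OF s(1) o]])
    then have "runs prog (init_state n) ((Ti + 4 + (1 + bcost b + (Tb + 6))) * (n + 1) ^ 1)
        (fst s, array_update (snd s) 0 0 (snd s 0 j))"
      by (rule runs_mono) (simp add: algebra_simps)
    moreover have "snd (fst s, array_update (snd s) 0 0 (snd s 0 j)) 0 0 = (F ^^ n) (G (\<lambda>_ _. 0)) 0 j"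
      using s(2) by (simp add: Inv_def Z_def)
    ultimately show "\<exists>s. runs prog (init_state n) ((Ti + 4 + (1 + bcost b + (Tb + 6))) * (n + 1) ^ 1) s \<and>
        snd s 0 0 = (F ^^ n) (G (\<lambda>_ _. 0)) 0 j" by blast
  qed
qed

text \<open>Cell 1 carries the factorial and cell 0 the next factor, both as reals, since naturals
  cannot be multiplied.\<close>

lemma polytime_computable_fact: "polytime_computable K (\<lambda>n. fact n)"
proof -
  define ini where "ini = Seq (RSet 0 (ILit 0) (RLit 1)) (RSet 0 (ILit 1) (RLit 1))"
  define body where "body = Seq (RSet 0 (ILit 1) (RMul (RGet 0 (ILit 1)) (RGet 0 (ILit 0))))
    (RSet 0 (ILit 0) (RAdd (RGet 0 (ILit 0)) (RLit 1)))"
  define G where "G R = array_update (array_update R 0 0 1) 0 1 1" for R :: rstore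
  define F where "F R = array_update (array_update R 0 1 (R 0 1 * R 0 0)) 0 0 (R 0 0 + 1)" for R :: rstore
  have "runs ini (I, R) (3 + 3) (I, G R)" for I R
    unfolding ini_def by (rule runs_Seq[OF runs_RSetI[OF refl] runs_RSetI]) (simp_all add: G_def)
  moreover have "runs body (I, R) (7 + 6) (I, F R)" for I R
    unfolding body_def by (rule runs_Seq[OF runs_RSetI[OF refl] runs_RSetI]) (simp_all add: F_def)
  moreover have "com_lits ini \<subseteq> \<rat> \<union> K" "com_lits body \<subseteq> \<rat> \<union> K"
    by (auto simp: ini_def body_def)
  ultimately have "polytime_computable K (\<lambda>n. (F ^^ n) (G (\<lambda>_ _. 0)) 0 1)"
    using polytime_computable_iterate by blast
  moreover have "(F ^^ n) (G (\<lambda>_ _. 0)) 0 1 = fact n \<and> (F ^^ n) (G (\<lambda>_ _. 0)) 0 0 = n + 1" for n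
    by (induction n) (auto simp: F_def G_def)
  ultimately show ?thesis by simp
qed

fun pascal_init :: "rexp \<Rightarrow> nat \<Rightarrow> com" where
  "pascal_init e 0 = RSet 0 (ILit 0) e"
| "pascal_init e (Suc j) = Seq (RSet 0 (ILit (Suc j)) (RLit 1)) (pascal_init e j)"

text \<open>Cells are updated from the highest down, so that cell \<open>j\<close> still holds its
  old value when cell \<open>Suc j\<close> is multiplied by it.\<close>

fun pascal_step :: "nat \<Rightarrow> com" where
  "pascal_step 0 = Skip"
| "pascal_step (Suc j) =
    Seq (RSet 0 (ILit (Suc j)) (RMul (RGet 0 (ILit (Suc j))) (RGet 0 (ILit j)))) (pascal_step j)"

text \<open>Pascal's rule in the exponent: \<open>c ^ (Suc n choose Suc i)\<close> is the product of
  \<open>c ^ (n choose i)\<close> and \<open>c ^ (n choose Suc i)\<close>. A row of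
  \<open>j + 1\<close> such powers is updated \<open>n\<close> times; the exponents themselves are
  never computed.\<close>

lemma polytime_computable_power_choose:
  assumes "c \<in> constants K"
  shows "polytime_computable K (\<lambda>n. c ^ (n choose j))"
proof -
  obtain e where e: "rexp_lits e \<subseteq> \<rat> \<union> K" "\<And>s. rval e s = c"
    using assms unfolding constants_def by blast
  define G where "G j R = R(0 := (\<lambda>i. if i = 0 then c else if i \<le> j then 1 else R 0 i))"
    for j and R :: rstore
  define F where "F j R = R(0 := (\<lambda>i. if i = 0 \<or> i > j then R 0 i else R 0 i * R 0 (i - 1)))"
    for j and R :: rstore
  have G: "runs (pascal_init e j) (I, R) (2 + rcost e + 3 * j) (I, G j R)" for j I R
  proof (induction j arbitrary: R)
    case 0
    have "array_update R 0 0 c = G 0 R" by (auto simp: G_def fun_eq_iff)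
    then show ?case using runs_RSet[of 0 "ILit 0" e I R] by (simp add: e(2) del: array_update.simps)
  next
    case (Suc j)
    have "runs (RSet 0 (ILit (Suc j)) (RLit 1)) (I, R) 3 (I, array_update R 0 (Suc j) 1)"
      by (rule runs_RSetI) simp_all
    from runs_Seq[OF this Suc] have
      "runs (pascal_init e (Suc j)) (I, R) (3 + (2 + rcost e + 3 * j)) (I, G j (array_update R 0 (Suc j) 1))"
      by (simp del: array_update.simps)
    moreover have "G j (array_update R 0 (Suc j) 1) = G (Suc j) R"
      by (auto simp: G_def fun_eq_iff)
    ultimately show ?case by (auto intro: runs_mono)
  qed
  have F: "runs (pascal_step j) (I, R) (1 + 7 * j) (I, F j R)" for j I R
  proof (induction j arbitrary: R)
    case 0
    have "F 0 R = R" by (auto simp: F_def fun_eq_iff)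
    then show ?case using runs_Skip by simp
  next
    case (Suc j)
    have "runs (RSet 0 (ILit (Suc j)) (RMul (RGet 0 (ILit (Suc j))) (RGet 0 (ILit j)))) (I, R) 7
        (I, array_update R 0 (Suc j) (R 0 (Suc j) * R 0 j))"
      by (rule runs_RSetI) simp_all
    from runs_Seq[OF this Suc] have
      "runs (pascal_step (Suc j)) (I, R) (7 + (1 + 7 * j)) (I, F j (array_update R 0 (Suc j) (R 0 (Suc j) * R 0 j)))"
      by (simp del: array_update.simps)
    moreover have "F j (array_update R 0 (Suc j) (R 0 (Suc j) * R 0 j)) = F (Suc j) R"
      by (auto simp: F_def fun_eq_iff not_less le_Suc_eq)
    ultimately show ?case by (auto intro: runs_mono)
  qed
  have "com_lits (pascal_init e j) \<subseteq> \<rat> \<union> K" "com_lits (pascal_step j) \<subseteq> \<rat> \<union> K" for j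
    using e(1) by (induction j) auto
  then have "polytime_computable K (\<lambda>n. (F j ^^ n) (G j (\<lambda>_ _. 0)) 0 j)"
    by (intro polytime_computable_iterate[of "pascal_init e j", OF G _ F])
  moreover have "i \<le> j \<Longrightarrow> (F j ^^ n) (G j (\<lambda>_ _. 0)) 0 i = c ^ (n choose i)" for n i
  proof (induction n arbitrary: i)
    case 0
    then show ?case by (auto simp: G_def binomial_eq_0)
  next
    case (Suc n)
    then show ?case by (cases i) (auto simp: F_def power_add mult.commute)
  qed
  ultimately show ?thesis by simp
qed

section \<open>Weighted multiset rewriting\<close>

text \<open>A natural number is a cell, and a multiset says how many tokens lie in each cell.
  \<open>step\<close> is \<open>None\<close> for a rule that halts the run, and
  \<open>Some (xs, ys)\<close> for one that replaces the tokens \<open>xs\<close> by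
  \<open>ys\<close>.\<close>

datatype rule =
  Rule (present: "nat list") (absent: "nat list") (weight: real) (step: "(nat list \<times> nat list) option")

definition enabled :: "rule \<Rightarrow> nat multiset \<Rightarrow> bool" where
  "enabled \<rho> C \<longleftrightarrow> set (present \<rho>) \<subseteq> set_mset C \<and> set (absent \<rho>) \<inter> set_mset C = {}"

text \<open>Total weight of the runs that halt within the given number of rule applications; a run
  that is cut off contributes 0. This fuel later serves as the level of the table in which the
  values are stored.\<close>

primrec run_weight :: "rule list \<Rightarrow> nat \<Rightarrow> nat multiset \<Rightarrow> real" where
  "run_weight rs 0 C = 0"
| "run_weight rs (Suc k) C = (\<Sum>\<rho>\<leftarrow>rs. if enabled \<rho> C then weight \<rho> *
     (case step \<rho> of None \<Rightarrow> 1 | Some (xs, ys) \<Rightarrow> run_weight rs k (C - mset xs + mset ys)) else 0)"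

definition contribution :: "rule list \<Rightarrow> nat \<Rightarrow> nat multiset \<Rightarrow> rule \<Rightarrow> real" where
  "contribution rs k C \<rho> = (if enabled \<rho> C then weight \<rho> *
     (case step \<rho> of None \<Rightarrow> 1 | Some (xs, ys) \<Rightarrow> run_weight rs k (C - mset xs + mset ys)) else 0)"

lemma run_weight_Suc: "run_weight rs (Suc k) C = (\<Sum>\<rho>\<leftarrow>rs. contribution rs k C \<rho>)"
  by (simp add: contribution_def)

declare run_weight.simps(2) [simp del]

text \<open>Distinctness together with \<open>set xs \<subseteq> set (present \<rho>)\<close>
  guarantees that the removed tokens exist, although presence ignores multiplicity. Equal lengths
  preserve the size of the multiset, so that counts stay below the base
  \<open>n + 1\<close>.\<close>

definition rule_ok :: "nat \<Rightarrow> real set \<Rightarrow> rule \<Rightarrow> bool" where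
  "rule_ok D K \<rho> \<longleftrightarrow> set (present \<rho>) \<union> set (absent \<rho>) \<subseteq> {..<D} \<and> weight \<rho> \<in> constants K \<and>
     (case step \<rho> of None \<Rightarrow> True | Some (xs, ys) \<Rightarrow>
        distinct xs \<and> set xs \<subseteq> set (present \<rho>) \<and> set ys \<subseteq> {..<D} \<and> length ys = length xs)"

section \<open>Multisets as numerals in base n + 1\<close>

definition code :: "nat \<Rightarrow> nat multiset \<Rightarrow> nat" where
  "code B C = (\<Sum>x\<in>#C. B ^ x)"

lemma code_eq_sum:
  "set_mset C \<subseteq> {..<D} \<Longrightarrow> code B C = (\<Sum>q<D. count C q * B ^ q)"
proof (induction C)
  case empty
  then show ?case by (simp add: code_def)
next
  case (add x C)
  have "(\<Sum>q<D. count (add_mset x C) q * B ^ q) = (\<Sum>q<D. count C q * B ^ q + (if x = q then B ^ x else 0))"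
    by (intro sum.cong) auto
  also have "\<dots> = (\<Sum>q<D. count C q * B ^ q) + B ^ x"
    using add.prems by (simp add: sum.distrib)
  finally show ?case using add by (simp add: code_def)
qed

lemma digits_less:
  fixes B :: nat
  shows "(\<And>q. q < D \<Longrightarrow> c q < B) \<Longrightarrow> (\<Sum>q<D. c q * B ^ q) < B ^ D"
proof (induction D)
  case (Suc D)
  have "(\<Sum>q<D. c q * B ^ q) + c D * B ^ D < B ^ D + c D * B ^ D"
    using Suc by simp
  also have "\<dots> = (1 + c D) * B ^ D" by simp
  also have "\<dots> \<le> B * B ^ D" using Suc.prems[of D] by (intro mult_right_mono) auto
  finally show ?case by simp
qed simp

text \<open>The leading part \<open>k * B ^ D\<close> is present because the table pointer carries
  the fuel above the \<open>D\<close> digits of the multiset.\<close>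

lemma digit_eq:
  fixes B :: nat
  assumes "\<And>q. q < D \<Longrightarrow> c q < B" "q < D"
  shows "(k * B ^ D + (\<Sum>q<D. c q * B ^ q)) div B ^ q mod B = c q"
  using assms
proof (induction D arbitrary: k)
  case (Suc D)
  have eq: "k * B ^ Suc D + (\<Sum>q<Suc D. c q * B ^ q) = (k * B + c D) * B ^ D + (\<Sum>q<D. c q * B ^ q)"
    by (simp add: algebra_simps)
  show ?case
  proof (cases "q = D")
    case True
    have "(\<Sum>q<D. c q * B ^ q) < B ^ D" using Suc.prems by (intro digits_less) auto
    moreover have "B > 0" using Suc.prems(1)[of D] by simp
    ultimately have "(k * B ^ Suc D + (\<Sum>q<Suc D. c q * B ^ q)) div B ^ D = k * B + c D"
      unfolding eq by (subst div_mult_self3) auto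
    then show ?thesis using Suc.prems(1)[of D] True by simp
  next
    case False
    then show ?thesis unfolding eq using Suc.prems by (intro Suc.IH) auto
  qed
qed simp

lemma count_less: "size C = n \<Longrightarrow> count C q < n + 1"
  using count_le_size[of C q] by simp

lemma code_less:
  assumes "set_mset C \<subseteq> {..<D}" "size C = n"
  shows "code (n + 1) C < (n + 1) ^ D"
  unfolding code_eq_sum[OF assms(1)] by (intro digits_less count_less assms)

lemma code_digit:
  assumes "set_mset C \<subseteq> {..<D}" "size C = n" "q < D"
  shows "(k * (n + 1) ^ D + code (n + 1) C) div (n + 1) ^ q mod (n + 1) = count C q"
  unfolding code_eq_sum[OF assms(1)] using assms by (intro digit_eq count_less)

section \<open>Powers of the base and digits without multiplication or division\<close>

fun power_table :: "nat \<Rightarrow> com" where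
  "power_table 0 = ISet 1 (ILit 0) (ILit 1)"
| "power_table (Suc q) = Seq (power_table q) (Seq (ISet 1 (ILit (Suc q)) (ILit 0))
     (Seq (ISet 4 (ILit 0) (ILit 0))
        (While (ILe (IGet 4 (ILit 0)) (IGet 0 (ILit 0)))
           (Seq (ISet 1 (ILit (Suc q)) (IAdd (IGet 1 (ILit (Suc q))) (IGet 1 (ILit q))))
             (ISet 4 (ILit 0) (IAdd (IGet 4 (ILit 0)) (ILit 1)))))))"

text \<open>The next power is the sum of \<open>n + 1\<close> copies of the previous one, added up
  by a loop whose counter passes through 0 to \<open>n\<close>.\<close>

lemma runs_power_table:
  assumes "I 0 0 = n"
  shows "\<exists>I'. runs (power_table q) (I, R) (3 + q * (44 * (n + 1))) (I', R) \<and>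
    (\<forall>j\<le>q. I' 1 j = (n + 1) ^ j) \<and> (\<forall>a. a \<noteq> 1 \<and> a \<noteq> 4 \<longrightarrow> I' a = I a)"
proof (induction q)
  case 0
  define I' where "I' = array_update I 1 0 1"
  have "runs (power_table 0) (I, R) 3 (I', R)"
    unfolding power_table.simps by (rule runs_ISetI) (simp_all add: I'_def)
  moreover have "(\<forall>j\<le>0. I' 1 j = (n + 1) ^ j) \<and> (\<forall>a. a \<noteq> 1 \<and> a \<noteq> 4 \<longrightarrow> I' a = I a)"
    by (simp add: I'_def)
  ultimately show ?case by (metis add_0_right mult_0)
next
  case (Suc q)
  then obtain I1 where I1: "runs (power_table q) (I, R) (3 + q * (44 * (n + 1))) (I1, R)"
    "\<forall>j\<le>q. I1 1 j = (n + 1) ^ j" "\<forall>a. a \<noteq> 1 \<and> a \<noteq> 4 \<longrightarrow> I1 a = I a" by blast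
  define b where "b = ILe (IGet 4 (ILit 0)) (IGet 0 (ILit 0))"
  define c1 where "c1 = ISet 1 (ILit (Suc q)) (IAdd (IGet 1 (ILit (Suc q))) (IGet 1 (ILit q)))"
  define c2 where "c2 = ISet 4 (ILit 0) (IAdd (IGet 4 (ILit 0)) (ILit 1))"
  define I2 where "I2 = array_update I1 1 (Suc q) 0"
  define I3 where "I3 = array_update I2 4 0 0"
  have s2: "runs (ISet 1 (ILit (Suc q)) (ILit 0)) (I1, R) 3 (I2, R)"
    by (rule runs_ISetI) (simp_all add: I2_def)
  have s3: "runs (ISet 4 (ILit 0) (ILit 0)) (I2, R) 3 (I3, R)"
    by (rule runs_ISetI) (simp_all add: I3_def)
  define Inv where "Inv i s \<longleftrightarrow> snd s = R \<and> fst s 4 0 = i \<and> fst s 1 (Suc q) = i * (n + 1) ^ q \<and>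
      (\<forall>j\<le>q. fst s 1 j = (n + 1) ^ j) \<and> (\<forall>a. a \<noteq> 1 \<and> a \<noteq> 4 \<longrightarrow> fst s a = I a)" for i and s :: state
  have init: "Inv 0 (I3, R)" using I1 by (auto simp: Inv_def I3_def I2_def)
  have step: "bval b s \<and> (\<exists>s'. runs (Seq c1 c2) s 13 s' \<and> Inv (Suc i) s')" if "i < n + 1" "Inv i s" for i s
  proof -
    obtain J where s: "s = (J, R)" using \<open>Inv i s\<close> by (cases s) (auto simp: Inv_def)
    define J1 where "J1 = array_update J 1 (Suc q) (J 1 (Suc q) + J 1 q)"
    define J2 where "J2 = array_update J1 4 0 (Suc (J 4 0))"
    have "runs c1 (J, R) 7 (J1, R)"
      unfolding c1_def by (rule runs_ISetI) (simp_all add: J1_def)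
    moreover have "runs c2 (J1, R) 6 (J2, R)"
      unfolding c2_def by (rule runs_ISetI) (simp_all add: J2_def J1_def)
    ultimately have "runs (Seq c1 c2) s 13 (J2, R)" unfolding s using runs_Seq by fastforce
    moreover have "Inv (Suc i) (J2, R)" using that(2) unfolding s by (auto simp: Inv_def J2_def J1_def)
    moreover have "bval b s" using that assms unfolding s by (auto simp: Inv_def b_def)
    ultimately show ?thesis by blast
  qed
  have exit: "\<not> bval b s" if "Inv (n + 1) s" for s
    using that assms by (auto simp: Inv_def b_def)
  obtain s' where s': "runs (While b (Seq c1 c2)) (I3, R) (Suc (n + 1) * (1 + bcost b + 13)) s'" "Inv (n + 1) s'"
    using runs_While[of "n + 1" Inv b "Seq c1 c2" 13, OF step exit init] by blast
  obtain I' where I': "s' = (I', R)" using s'(2) by (cases s') (auto simp: Inv_def)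
  have "runs (power_table (Suc q)) (I, R) (3 + q * (44 * (n + 1)) + (3 + (3 + Suc (n + 1) * (1 + bcost b + 13)))) (I', R)"
    using runs_Seq[OF I1(1) runs_Seq[OF s2 runs_Seq[OF s3 s'(1)]]] by (simp add: I' b_def c1_def c2_def)
  \<comment> \<open>One further power costs 6 + 19 * (n + 2), which is at most 44 * (n + 1), with
    equality for n = 0.\<close>
  then have "runs (power_table (Suc q)) (I, R) (3 + Suc q * (44 * (n + 1))) (I', R)"
    by (rule runs_mono) (simp add: b_def)
  moreover have "(\<forall>j\<le>Suc q. I' 1 j = (n + 1) ^ j) \<and> (\<forall>a. a \<noteq> 1 \<and> a \<noteq> 4 \<longrightarrow> I' a = I a)"
    using s'(2) unfolding I' by (auto simp: Inv_def le_Suc_eq)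
  ultimately show ?case by blast
qed

fun odometer :: "nat \<Rightarrow> nat \<Rightarrow> com" where
  "odometer 0 q = Skip"
| "odometer (Suc d) q = com.If (ILe (IAdd (IGet 2 (ILit q)) (ILit 1)) (IGet 0 (ILit 0)))
     (ISet 2 (ILit q) (IAdd (IGet 2 (ILit q)) (ILit 1)))
     (Seq (ISet 2 (ILit q) (ILit 0)) (odometer d (Suc q)))"

text \<open>The hypotheses describe a carry that has arrived at digit \<open>q\<close>: the digits
  below already belong to \<open>Suc i\<close>, the others still to \<open>i\<close>, and
  divisibility says that all lower digits have wrapped around to 0. A carry out of the last digit is
  dropped.\<close>

lemma runs_odometer:
  assumes "I 0 0 = n" "\<And>r. r < q \<Longrightarrow> I 2 r = Suc i div (n + 1) ^ r mod (n + 1)"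
    and "\<And>r. q \<le> r \<Longrightarrow> r < q + d \<Longrightarrow> I 2 r = i div (n + 1) ^ r mod (n + 1)"
    and "(n + 1) ^ q dvd Suc i"
  shows "\<exists>I'. runs (odometer d q) (I, R) (1 + 16 * d) (I', R) \<and>
    (\<forall>r<q + d. I' 2 r = Suc i div (n + 1) ^ r mod (n + 1)) \<and> (\<forall>a. a \<noteq> 2 \<longrightarrow> I' a = I a)"
  using assms
proof (induction d arbitrary: q I)
  case 0
  then show ?case using runs_Skip by auto
next
  case (Suc d)
  define B where "B = n + 1"
  define x where "x = i div B ^ q"
  have "B > 0" by (simp add: B_def)
  have Sx: "Suc i div B ^ q = Suc x"
    using Suc.prems(4) \<open>B > 0\<close> unfolding x_def B_def[symmetric]
    by (metis div_Suc mod_0_imp_dvd dvd_imp_mod_0)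
  have Iq: "I 2 q = x mod B" using Suc.prems(3)[of q] by (simp add: x_def B_def)
  define b where "b = ILe (IAdd (IGet 2 (ILit q)) (ILit 1)) (IGet 0 (ILit 0))"
  have b: "bval b (I, R) \<longleftrightarrow> Suc (x mod B) < B"
    using Suc.prems(1) Iq by (simp add: b_def B_def less_Suc_eq_le)
  show ?case
  proof (cases "Suc (x mod B) < B")
    case True
    define I' where "I' = array_update I 2 q (Suc (I 2 q))"
    have "runs (ISet 2 (ILit q) (IAdd (IGet 2 (ILit q)) (ILit 1))) (I, R) 6 (I', R)"
      by (rule runs_ISetI) (simp_all add: I'_def)
    then have "runs (odometer (Suc d) q) (I, R) (1 + bcost b + 6) (I', R)"
      unfolding odometer.simps b_def[symmetric] using b True by (intro runs_If) auto
    then have "runs (odometer (Suc d) q) (I, R) (1 + 16 * Suc d) (I', R)"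
      by (rule runs_mono) (simp add: b_def)
    moreover have "I' 2 r = Suc i div B ^ r mod B" if "r < q + Suc d" for r
    proof -
      consider "r < q" | "r = q" | "q < r" by linarith
      then show ?thesis
      proof cases
        case 1
        then show ?thesis using Suc.prems(2)[of r] by (simp add: I'_def B_def)
      next
        case 2
        then show ?thesis using True by (simp add: I'_def Iq Sx mod_Suc)
      next
        case 3
        then obtain e where r: "r = q + Suc e" using less_iff_Suc_add by auto
        have "Suc x div B = x div B" using True by (simp add: div_Suc mod_Suc)
        moreover have "j div B ^ r = j div B ^ q div B div B ^ e" for j
          by (simp only: r power_add power_Suc div_mult2_eq)
        ultimately have "Suc i div B ^ r = i div B ^ r"
          using Sx by (simp add: x_def)
        then show ?thesis using Suc.prems(3)[of r] 3 that by (simp add: I'_def B_def)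
      qed
    qed
    moreover have "\<forall>a. a \<noteq> 2 \<longrightarrow> I' a = I a" by (simp add: I'_def)
    ultimately show ?thesis unfolding B_def by blast
  next
    case False
    then have full: "Suc (x mod B) = B" using \<open>B > 0\<close> by (meson Suc_lessI mod_less_divisor)
    define I1 where "I1 = array_update I 2 q 0"
    have s1: "runs (ISet 2 (ILit q) (ILit 0)) (I, R) 3 (I1, R)"
      by (rule runs_ISetI) (simp_all add: I1_def)
    have "Suc x mod B = 0" using full by (simp add: mod_Suc)
    then have dv: "B ^ Suc q dvd Suc i"
      using Suc.prems(4) Sx unfolding B_def[symmetric]
      by (metis dvd_div_mult_self dvd_triv_right mod_0_imp_dvd mult.commute mult_dvd_mono dvd_refl power_Suc)
    have "I1 2 r = Suc i div B ^ r mod B" if "r < Suc q" for r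
    proof (cases "r = q")
      case True
      then show ?thesis using \<open>Suc x mod B = 0\<close> by (simp add: I1_def Sx)
    next
      case False
      then show ?thesis using that Suc.prems(2)[of r] by (simp add: I1_def B_def)
    qed
    moreover have "I1 2 r = i div B ^ r mod B" if "Suc q \<le> r" "r < Suc q + d" for r
      using that Suc.prems(3)[of r] by (simp add: I1_def B_def)
    moreover have "I1 0 0 = n" using Suc.prems(1) by (simp add: I1_def)
    ultimately obtain I' where I': "runs (odometer d (Suc q)) (I1, R) (1 + 16 * d) (I', R)"
      "\<forall>r<Suc q + d. I' 2 r = Suc i div B ^ r mod B" "\<forall>a. a \<noteq> 2 \<longrightarrow> I' a = I1 a"
      using Suc.IH[of I1 "Suc q"] dv unfolding B_def by blast
    have "runs (odometer (Suc d) q) (I, R) (1 + bcost b + (3 + (1 + 16 * d))) (I', R)"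
      unfolding odometer.simps b_def[symmetric] using b False runs_Seq[OF s1 I'(1)]
      by (intro runs_If) auto
    then have "runs (odometer (Suc d) q) (I, R) (1 + 16 * Suc d) (I', R)"
      by (rule runs_mono) (simp add: b_def)
    moreover have "\<forall>a. a \<noteq> 2 \<longrightarrow> I' a = I a" using I'(3) by (simp add: I1_def)
    ultimately show ?thesis using I'(2) unfolding B_def by auto
  qed
qed

definition const_exp :: "real set \<Rightarrow> real \<Rightarrow> rexp" where
  "const_exp K r = (SOME e. rexp_lits e \<subseteq> \<rat> \<union> K \<and> (\<forall>s. rval e s = r))"

lemma const_exp:
  assumes "r \<in> constants K"
  shows "rexp_lits (const_exp K r) \<subseteq> \<rat> \<union> K" "rval (const_exp K r) s = r"
proof -
  have "rexp_lits (const_exp K r) \<subseteq> \<rat> \<union> K \<and> (\<forall>s. rval (const_exp K r) s = r)"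
    using assms someI_ex[of "\<lambda>e. rexp_lits e \<subseteq> \<rat> \<union> K \<and> (\<forall>s. rval e s = r)"]
    unfolding constants_def const_exp_def by blast
  then show "rexp_lits (const_exp K r) \<subseteq> \<rat> \<union> K" "rval (const_exp K r) s = r" by blast+
qed

definition guard :: "rule \<Rightarrow> bexp" where
  "guard \<rho> = foldr BAnd (map (\<lambda>x. ILe (ILit 1) (IGet 2 (ILit x))) (present \<rho>) @
     map (\<lambda>x. ILe (IGet 2 (ILit x)) (ILit 0)) (absent \<rho>)) (ILe (ILit 0) (ILit 0))"

lemma bval_guard:
  "bval (guard \<rho>) s \<longleftrightarrow> (\<forall>x\<in>set (present \<rho>). fst s 2 x > 0) \<and> (\<forall>x\<in>set (absent \<rho>). fst s 2 x = 0)"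
proof -
  have "bval (foldr BAnd bs (ILe (ILit 0) (ILit 0))) s \<longleftrightarrow> (\<forall>b\<in>set bs. bval b s)" for bs
    by (induction bs) auto
  then show ?thesis unfolding guard_def by (auto simp: ball_Un Suc_le_eq simp del: foldr_append)
qed

lemma bexp_lits_guard: "bexp_lits (guard \<rho>) = {}"
proof -
  have "(\<forall>b\<in>set bs. bexp_lits b = {}) \<Longrightarrow> bexp_lits (foldr BAnd bs (ILe (ILit 0) (ILit 0))) = {}" for bs
    by (induction bs) auto
  then show ?thesis unfolding guard_def by (auto simp: ball_Un simp del: foldr_append)
qed

text \<open>Address of the successor multiset one level below: subtracting \<open>B ^ D\<close>
  lowers the fuel by one, and exchanging tokens exchanges powers of the base. Subtraction is
  truncated, so the result is right only because the tokens \<open>xs\<close> are present and are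
  taken off first.\<close>

definition source :: "nat \<Rightarrow> nat list \<Rightarrow> nat list \<Rightarrow> iexp" where
  "source D xs ys = foldl (\<lambda>e y. IAdd e (IGet 1 (ILit y)))
     (foldl (\<lambda>e x. ISub e (IGet 1 (ILit x))) (ISub (IGet 3 (ILit 0)) (IGet 1 (ILit D))) xs) ys"

lemma ival_source:
  "ival (source D xs ys) I = I 3 0 - I 1 D - (\<Sum>x\<leftarrow>xs. I 1 x) + (\<Sum>y\<leftarrow>ys. I 1 y)"
proof -
  have "ival (foldl (\<lambda>e x. ISub e (IGet 1 (ILit x))) e xs) I = ival e I - (\<Sum>x\<leftarrow>xs. I 1 x)" for e
    by (induction xs arbitrary: e) auto
  moreover have "ival (foldl (\<lambda>e y. IAdd e (IGet 1 (ILit y))) e ys) I = ival e I + (\<Sum>y\<leftarrow>ys. I 1 y)" for e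
    by (induction ys arbitrary: e) auto
  ultimately show ?thesis unfolding source_def by simp
qed

definition summand :: "nat \<Rightarrow> istore \<Rightarrow> (nat \<Rightarrow> real) \<Rightarrow> rule \<Rightarrow> real" where
  "summand D I V \<rho> = (if bval (guard \<rho>) (I, \<lambda>_ _. 0) then weight \<rho> *
     (case step \<rho> of None \<Rightarrow> 1 | Some (xs, ys) \<Rightarrow> V (ival (source D xs ys) I)) else 0)"

definition rule_com :: "real set \<Rightarrow> nat \<Rightarrow> rule \<Rightarrow> com" where
  "rule_com K D \<rho> = com.If (guard \<rho>)
     (RSet 2 (ILit 0) (RAdd (RGet 2 (ILit 0)) (RMul (const_exp K (weight \<rho>))
        (case step \<rho> of None \<Rightarrow> RLit 1 | Some (xs, ys) \<Rightarrow> RGet 1 (source D xs ys))))) Skip"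

text \<open>The time bound depends on the rule alone and is uniform in the state; this keeps the
  work per table entry constant.\<close>

lemma runs_rule_com:
  assumes "weight \<rho> \<in> constants K"
  shows "\<exists>T. \<forall>I R. runs (rule_com K D \<rho>) (I, R) T (I, array_update R 2 0 (R 2 0 + summand D I (R 1) \<rho>))"
proof -
  define E where "E = RAdd (RGet 2 (ILit 0)) (RMul (const_exp K (weight \<rho>))
        (case step \<rho> of None \<Rightarrow> RLit 1 | Some (xs, ys) \<Rightarrow> RGet 1 (source D xs ys)))"
  have g: "bval (guard \<rho>) (I, R) = bval (guard \<rho>) (I, \<lambda>_ _. 0)" for I R
    by (simp add: bval_guard)
  have "runs (rule_com K D \<rho>) (I, R) (1 + bcost (guard \<rho>) + (2 + rcost E))
    (I, array_update R 2 0 (R 2 0 + summand D I (R 1) \<rho>))" for I R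
    unfolding rule_com_def E_def[symmetric]
  proof (rule runs_If)
    assume "bval (guard \<rho>) (I, R)"
    then have "rval E (I, R) = R 2 0 + summand D I (R 1) \<rho>"
      using g[of I R] by (simp add: E_def summand_def const_exp[OF assms] split: option.split)
    then show "runs (RSet 2 (ILit 0) E) (I, R) (2 + rcost E)
       (I, array_update R 2 0 (R 2 0 + summand D I (R 1) \<rho>))"
      using runs_RSet[of 2 "ILit 0" E I R] by simp
  next
    assume "\<not> bval (guard \<rho>) (I, R)"
    then have "array_update R 2 0 (R 2 0 + summand D I (R 1) \<rho>) = R"
      using g[of I R] by (auto simp: summand_def fun_eq_iff)
    moreover have "runs Skip (I, R) (2 + rcost E) (I, R)"
      using runs_Skip by (rule runs_mono) simp
    ultimately show "runs Skip (I, R) (2 + rcost E) (I, array_update R 2 0 (R 2 0 + summand D I (R 1) \<rho>))"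
      by simp
  qed
  then show ?thesis by blast
qed

definition rules_com :: "real set \<Rightarrow> nat \<Rightarrow> rule list \<Rightarrow> com" where
  "rules_com K D rs = foldr (\<lambda>\<rho>. Seq (rule_com K D \<rho>)) rs Skip"

lemma runs_rules_com:
  assumes "\<And>\<rho>. \<rho> \<in> set rs \<Longrightarrow> weight \<rho> \<in> constants K"
  shows "\<exists>T. \<forall>I R. runs (rules_com K D rs) (I, R) T
    (I, array_update R 2 0 (R 2 0 + (\<Sum>\<rho>\<leftarrow>rs. summand D I (R 1) \<rho>)))"
  using assms
proof (induction rs)
  case Nil
  have "array_update R 2 0 (R 2 0) = R" for R :: rstore by (auto simp: fun_eq_iff)
  then have "\<forall>I R. runs Skip (I, R) 1 (I, array_update R 2 0 (R 2 0))"
    using runs_Skip by (simp only: simp_thms)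
  then show ?case unfolding rules_com_def by auto
next
  case (Cons \<rho> rs)
  obtain T where T: "\<And>I R. runs (rule_com K D \<rho>) (I, R) T (I, array_update R 2 0 (R 2 0 + summand D I (R 1) \<rho>))"
    using runs_rule_com Cons.prems by (metis list.set_intros(1))
  obtain T' where T': "\<And>I R. runs (rules_com K D rs) (I, R) T'
    (I, array_update R 2 0 (R 2 0 + (\<Sum>\<rho>\<leftarrow>rs. summand D I (R 1) \<rho>)))"
    using Cons by (metis list.set_intros(2))
  have "runs (rules_com K D (\<rho> # rs)) (I, R) (T + T')
    (I, array_update R 2 0 (R 2 0 + (\<Sum>\<rho>\<leftarrow>\<rho> # rs. summand D I (R 1) \<rho>)))" for I R
    using runs_Seq[OF T[of I R] T'[of I "array_update R 2 0 (R 2 0 + summand D I (R 1) \<rho>)"]]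
    by (simp add: rules_com_def add.assoc)
  then show ?case by blast
qed

lemma com_lits_rules_com:
  assumes "\<And>\<rho>. \<rho> \<in> set rs \<Longrightarrow> weight \<rho> \<in> constants K"
  shows "com_lits (rules_com K D rs) \<subseteq> \<rat> \<union> K"
proof -
  have "com_lits (rule_com K D \<rho>) \<subseteq> \<rat> \<union> K" if "\<rho> \<in> set rs" for \<rho>
    using const_exp(1)[OF assms[OF that]]
    by (auto simp: rule_com_def bexp_lits_guard split: option.split)
  then show ?thesis unfolding rules_com_def by (induction rs) auto
qed

text \<open>Links memory to semantics: the digits decide the guard, and the pointer leads to the
  entry of the successor, which lies one level lower and is correct by the hypothesis on
  \<open>V\<close>.\<close>

lemma summand_eq:
  assumes ok: "rule_ok D K \<rho>" and C: "set_mset C \<subseteq> {..<D}" "size C = n"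
    and pow: "\<And>j. j \<le> D \<Longrightarrow> I 1 j = (n + 1) ^ j"
    and dig: "\<And>q. q < D \<Longrightarrow> I 2 q = count C q"
    and ptr: "I 3 0 = Suc k * (n + 1) ^ D + code (n + 1) C"
    and V: "\<And>C'. set_mset C' \<subseteq> {..<D} \<Longrightarrow> size C' = n \<Longrightarrow>
      V (k * (n + 1) ^ D + code (n + 1) C') = run_weight rs k C'"
  shows "summand D I V \<rho> = contribution rs k C \<rho>"
proof -
  have lt: "x < D" if "x \<in> set (present \<rho>) \<union> set (absent \<rho>)" for x
    using ok that by (auto simp: rule_ok_def)
  have "bval (guard \<rho>) (I, \<lambda>_ _. 0) \<longleftrightarrow> enabled \<rho> C"
    using lt dig by (auto simp: bval_guard enabled_def subset_iff disjoint_iff not_in_iff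
        simp flip: count_greater_zero_iff)
  moreover have "V (ival (source D xs ys) I) = run_weight rs k (C - mset xs + mset ys)"
    if st: "step \<rho> = Some (xs, ys)" and en: "enabled \<rho> C" for xs ys
  proof -
    have xs: "distinct xs" "set xs \<subseteq> set_mset C" "set xs \<subseteq> {..<D}" and ys: "set ys \<subseteq> {..<D}" "length ys = length xs"
      using ok st en by (auto simp: rule_ok_def enabled_def)
    \<comment> \<open>Each cell of \<open>xs\<close> occurs only once in \<open>xs\<close>, hence
      presence in \<open>C\<close> is enough for inclusion as multisets.\<close>
    have sub: "mset xs \<subseteq># C"
      using xs(1,2) by (auto intro!: mset_subset_eqI simp: distinct_count_atmost_1 Suc_le_eq)
    then obtain C0 where C0: "C = mset xs + C0" by (auto simp: mset_subset_eq_exists_conv)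
    have "(\<Sum>x\<leftarrow>zs. I 1 x) = code (n + 1) (mset zs)" if "set zs \<subseteq> {..<D}" for zs
      using that by (induction zs) (auto simp: code_def pow[unfolded One_nat_def])
    then have "ival (source D xs ys) I = k * (n + 1) ^ D + code (n + 1) (C - mset xs + mset ys)"
      using xs(3) ys(1) pow[of D] ptr by (simp add: ival_source C0 code_def)
    then show ?thesis
      using C ys C0 by (subst V[symmetric]) auto
  qed
  ultimately show ?thesis
    by (auto simp: summand_def contribution_def split: option.split)
qed

text \<open>
  Memory layout, with \<open>B = n + 1\<close>: natural-number array 1 holds the powers of \<open>B\<close>, array 2 the
  base-\<open>B\<close> digits (counts of the cells) of the current multiset, array 3 the table pointer, array 4 a
  loop counter. Real array 1 is the table, with \<open>run_weight rs k C\<close> at \<open>k * B ^ D + code B C\<close>, so that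
  level 0 is correct initially; real array 2 is the accumulator. Codes of multisets of other sizes
  are processed as well but their entries are never used.
\<close>

theorem polytime_computable_run_weight:
  assumes ok: "\<And>\<rho>. \<rho> \<in> set rs \<Longrightarrow> rule_ok D K \<rho>" and "D > 0"
  shows "polytime_computable K (\<lambda>n. run_weight rs ((n + 1) ^ 3 - 1) (replicate_mset n 0))"
proof -
  have wt: "weight \<rho> \<in> constants K" if "\<rho> \<in> set rs" for \<rho>
    using ok[OF that] by (simp add: rule_ok_def)
  define ptr where "ptr = IGet 3 (ILit 0)"
  define b where "b = ILe (IAdd ptr (ILit 1)) (IGet 1 (ILit (D + 3)))"
  define body where "body = Seq (RSet 2 (ILit 0) (RLit 0)) (Seq (rules_com K D rs)
     (Seq (RSet 1 ptr (RGet 2 (ILit 0))) (Seq (ISet 3 (ILit 0) (IAdd ptr (ILit 1))) (odometer D 0))))"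
  \<comment> \<open>The answer stands at level \<open>B ^ 3 - 1\<close> with all \<open>n\<close>
    tokens in cell 0, whose code is \<open>n\<close>. Its index
    \<open>(B ^ 3 - 1) * B ^ D + n\<close> is obtained as a difference of two tabulated
    powers.\<close>
  define final where "final = IAdd (ISub (IGet 1 (ILit (D + 3))) (IGet 1 (ILit D))) (IGet 0 (ILit 0))"
  define prog where "prog = Seq (power_table (D + 3)) (Seq (ISet 3 (ILit 0) (IGet 1 (ILit D)))
     (Seq (While b body) (RSet 0 (ILit 0) (RGet 1 final))))"
  obtain T where T: "\<And>I R. runs (rules_com K D rs) (I, R) T
    (I, array_update R 2 0 (R 2 0 + (\<Sum>\<rho>\<leftarrow>rs. summand D I (R 1) \<rho>)))"
    using runs_rules_com[OF wt] by meson
  define T' where "T' = 3 + (T + (5 + (6 + (1 + 16 * D))))"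
  have "com_lits (power_table q) = {}" for q by (induction q) auto
  moreover have "com_lits (odometer d q) = {}" for d q by (induction d arbitrary: q) auto
  ultimately have lits: "com_lits prog \<subseteq> \<rat> \<union> K"
    using com_lits_rules_com[OF wt] by (auto simp: prog_def body_def b_def)
  show ?thesis
  proof (rule polytime_computableI[OF lits])
    fix n :: nat
    define B where "B = n + 1"
    have Bpos: "B ^ q > 0" for q by (simp add: B_def)
    \<comment> \<open>The pointer runs from \<open>B ^ D\<close> to \<open>B ^ (D + 3) - 1\<close>;
      level 0 is the all-zero initial memory.\<close>
    define N where "N = B ^ (D + 3) - B ^ D"
    have BD: "B ^ D + N = B ^ (D + 3)"
      using power_increasing[of D "D + 3" B] by (simp add: N_def B_def)
    define Inv where "Inv i s \<longleftrightarrow> fst s 0 0 = n \<and> (\<forall>j\<le>D+3. fst s 1 j = B ^ j) \<and>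
      fst s 3 0 = B ^ D + i \<and> (\<forall>q<D. fst s 2 q = i div B ^ q mod B) \<and>
      (\<forall>k C. set_mset C \<subseteq> {..<D} \<longrightarrow> size C = n \<longrightarrow> k * B ^ D + code B C < B ^ D + i \<longrightarrow>
        snd s 1 (k * B ^ D + code B C) = run_weight rs k C)" for i and s :: state
    have step: "bval b s \<and> (\<exists>s'. runs body s T' s' \<and> Inv (Suc i) s')" if i: "i < N" and inv: "Inv i s" for i s
    proof
      show "bval b s" using i inv BD by (simp add: Inv_def b_def ptr_def)
      obtain I R where s: "s = (I, R)" by (cases s)
      define R1 where "R1 = array_update R 2 0 0"
      define S where "S = (\<Sum>\<rho>\<leftarrow>rs. summand D I (R1 1) \<rho>)"
      define R2 where "R2 = array_update R1 2 0 (R1 2 0 + S)"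
      define R3 where "R3 = array_update R2 1 (I 3 0) S"
      define I1 where "I1 = array_update I 3 0 (Suc (I 3 0))"
      have "\<exists>I'. runs (odometer D 0) (I1, R3) (1 + 16 * D) (I', R3) \<and>
        (\<forall>r<0 + D. I' 2 r = Suc i div (n + 1) ^ r mod (n + 1)) \<and> (\<forall>a. a \<noteq> 2 \<longrightarrow> I' a = I1 a)"
        using inv by (intro runs_odometer) (auto simp: Inv_def I1_def s B_def)
      then obtain I' where I': "runs (odometer D 0) (I1, R3) (1 + 16 * D) (I', R3)"
        "\<And>r. r < D \<Longrightarrow> I' 2 r = Suc i div B ^ r mod B" "\<And>a. a \<noteq> 2 \<Longrightarrow> I' a = I1 a"
        unfolding B_def by auto
      have s1: "runs (RSet 2 (ILit 0) (RLit 0)) (I, R) 3 (I, R1)"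
        by (rule runs_RSetI) (simp_all add: R1_def)
      have s2: "runs (rules_com K D rs) (I, R1) T (I, R2)"
        using T[of I R1] by (simp add: R2_def S_def)
      have s3: "runs (RSet 1 ptr (RGet 2 (ILit 0))) (I, R2) 5 (I, R3)"
        by (rule runs_RSetI) (simp_all add: ptr_def R3_def R2_def R1_def)
      have s4: "runs (ISet 3 (ILit 0) (IAdd ptr (ILit 1))) (I, R3) 6 (I1, R3)"
        by (rule runs_ISetI) (simp_all add: ptr_def I1_def)
      have "runs body s T' (I', R3)"
        unfolding body_def s T'_def by (rule runs_Seq[OF s1 runs_Seq[OF s2 runs_Seq[OF s3 runs_Seq[OF s4 I'(1)]]]])
      moreover have "Inv (Suc i) (I', R3)"
      proof -
        have V: "R3 1 (k * B ^ D + code B C) = run_weight rs k C"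
          if C: "set_mset C \<subseteq> {..<D}" "size C = n" and le: "k * B ^ D + code B C < B ^ D + Suc i" for k C
        proof (cases "k * B ^ D + code B C = B ^ D + i")
          case False
          then show ?thesis using le inv C by (simp add: Inv_def s R3_def R2_def R1_def)
        next
          case True
          \<comment> \<open>An index on level 0 would be below \<open>B ^ D\<close> and thus short
            of the pointer, so the entry being written has positive fuel.\<close>
          have "code B C < B ^ D" using code_less[OF C] by (simp add: B_def)
          then have "k \<noteq> 0" using True by (cases k) auto
          then obtain k' where k: "k = Suc k'" by (cases k) auto
          have i_eq: "i = k' * B ^ D + code B C" using True k by simp
          have "summand D I (R1 1) \<rho> = contribution rs k' C \<rho>" if "\<rho> \<in> set rs" for \<rho>
          proof (rule summand_eq[OF ok[OF that] C])
            show "I 1 j = (n + 1) ^ j" if "j \<le> D" for j using inv that by (simp add: Inv_def s B_def)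
            show "I 2 q = count C q" if "q < D" for q
              using inv that code_digit[OF C that, of k'] i_eq by (simp add: Inv_def s B_def)
            show "I 3 0 = Suc k' * (n + 1) ^ D + code (n + 1) C"
              using inv True k by (simp add: Inv_def s B_def)
            show "R1 1 (k' * (n + 1) ^ D + code (n + 1) C') = run_weight rs k' C'"
              if C': "set_mset C' \<subseteq> {..<D}" "size C' = n" for C'
            proof -
              have "k' * B ^ D + code B C' < B ^ D + i"
                using code_less[OF C'] i_eq by (simp add: B_def)
              then show ?thesis using inv C' by (simp add: Inv_def s R1_def B_def)
            qed
          qed
          then have "S = run_weight rs k C"
            unfolding S_def k run_weight_Suc by (intro arg_cong[of _ _ sum_list] map_cong refl)
          then show ?thesis using True inv by (simp add: R3_def Inv_def s)
        qed
        show ?thesis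
          using inv I'(2,3) V by (simp add: Inv_def s I1_def)
      qed
      ultimately show "\<exists>s'. runs body s T' s' \<and> Inv (Suc i) s'" by blast
    qed
    have exit: "\<not> bval b s" if "Inv N s" for s
      using that BD by (simp add: Inv_def b_def ptr_def)
    obtain I1 where I1: "runs (power_table (D + 3)) (init_state n) (3 + (D + 3) * (44 * (n + 1))) (I1, \<lambda>_ _. 0)"
      "\<And>j. j \<le> D + 3 \<Longrightarrow> I1 1 j = B ^ j" "\<And>a. a \<noteq> 1 \<Longrightarrow> a \<noteq> 4 \<Longrightarrow> I1 a = fst (init_state n) a"
      using runs_power_table[of "fst (init_state n)" n "D + 3" "\<lambda>_ _. 0"]
      unfolding init_state_def B_def by auto
    define I2 where "I2 = array_update I1 3 0 (B ^ D)"
    have s2: "runs (ISet 3 (ILit 0) (IGet 1 (ILit D))) (I1, \<lambda>_ _. 0) 4 (I2, \<lambda>_ _. 0)"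
      using I1(2)[of D] by (intro runs_ISetI) (simp_all add: I2_def)
    have init: "Inv 0 (I2, \<lambda>_ _. 0)"
      unfolding Inv_def
    proof (intro conjI allI impI)
      fix k C assume "k * B ^ D + code B C < B ^ D + 0"
      then have "k = 0" by (cases k) auto
      then show "snd (I2, \<lambda>_ _. 0) 1 (k * B ^ D + code B C) = run_weight rs k C" by simp
    qed (use I1(2,3) in \<open>auto simp: I2_def init_state_def\<close>)
    obtain s' where s': "runs (While b body) (I2, \<lambda>_ _. 0) (Suc N * (1 + bcost b + T')) s'" "Inv N s'"
      using runs_While[of N Inv b body T', OF step exit init] by blast
    obtain I R where s'_eq: "s' = (I, R)" by (cases s')
    define R' where "R' = array_update R 0 0 (R 1 (B ^ (D + 3) - B ^ D + n))"
    have s3: "runs (RSet 0 (ILit 0) (RGet 1 final)) (I, R) 11 (I, R')"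
      using s'(2) by (intro runs_RSetI) (simp_all add: final_def R'_def Inv_def s'_eq)
    have "runs prog (init_state n) (3 + (D + 3) * (44 * (n + 1)) + (4 + (Suc N * (1 + bcost b + T') + 11))) (I, R')"
      unfolding prog_def by (rule runs_Seq[OF I1(1) runs_Seq[OF s2 runs_Seq[OF s'(1)[unfolded s'_eq] s3]]])
    then have "runs prog (init_state n) ((18 + (D + 3) * 44 + (1 + bcost b + T')) * (n + 1) ^ (D + 3)) (I, R')"
    proof (rule runs_mono)
      have "Suc N \<le> (n + 1) ^ (D + 3)" using BD Bpos[of D] unfolding B_def by linarith
      then have "Suc N * (1 + bcost b + T') \<le> (n + 1) ^ (D + 3) * (1 + bcost b + T')" by (rule mult_right_mono) simp
      moreover have "(D + 3) * 44 * (n + 1) \<le> (D + 3) * 44 * (n + 1) ^ (D + 3)"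
        using power_increasing[of 1 "D + 3" "n + 1"] by (intro mult_left_mono) auto
      moreover have "18 \<le> 18 * (n + 1) ^ (D + 3)" by simp
      moreover have "3 + (D + 3) * (44 * (n + 1)) + (4 + (u + 11)) = 18 + ((D + 3) * 44 * (n + 1) + u)" for u
        by (simp add: algebra_simps)
      moreover have "(18 + (D + 3) * 44 + v) * x = 18 * x + ((D + 3) * 44 * x + x * v)" for v x :: nat
        by (simp add: algebra_simps)
      ultimately show "3 + (D + 3) * (44 * (n + 1)) + (4 + (Suc N * (1 + bcost b + T') + 11))
          \<le> (18 + (D + 3) * 44 + (1 + bcost b + T')) * (n + 1) ^ (D + 3)"
        by (simp only: add_mono)
    qed
    moreover have "snd (I, R') 0 0 = run_weight rs ((n + 1) ^ 3 - 1) (replicate_mset n 0)"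
    proof -
      define C where "C = replicate_mset n (0 :: nat)"
      have C: "set_mset C \<subseteq> {..<D}" "size C = n" using \<open>D > 0\<close> by (auto simp: C_def)
      have "code B C = n" by (simp add: code_def C_def)
      moreover have "B ^ (D + 3) - B ^ D = (B ^ 3 - 1) * B ^ D"
        by (simp add: power_add diff_mult_distrib diff_mult_distrib2 mult.commute)
      ultimately have a: "B ^ (D + 3) - B ^ D + n = (B ^ 3 - 1) * B ^ D + code B C" by simp
      have "n < B ^ D" using code_less[OF C] \<open>code B C = n\<close> by (simp add: B_def)
      then have "(B ^ 3 - 1) * B ^ D + code B C < B ^ D + N"
        unfolding a[symmetric] BD by (simp add: N_def[symmetric] flip: BD)
      then have "R 1 ((B ^ 3 - 1) * B ^ D + code B C) = run_weight rs (B ^ 3 - 1) C"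
        using s'(2) C by (simp add: s'_eq Inv_def)
      then have "R 1 (B ^ (D + 3) - B ^ D + n) = run_weight rs (B ^ 3 - 1) C"
        unfolding a .
      then show ?thesis by (simp add: R'_def C_def B_def)
    qed
    ultimately show "\<exists>s. runs prog (init_state n) ((18 + (D + 3) * 44 + (1 + bcost b + T')) * (n + 1) ^ (D + 3)) s \<and>
        snd s 0 0 = run_weight rs ((n + 1) ^ 3 - 1) (replicate_mset n 0)" by blast
  qed
qed

section \<open>Insertion processes\<close>

text \<open>\<open>t\<close> is the element being inserted, \<open>L\<close> the old ones it has yet
  to meet and \<open>N\<close> those it has met. A meeting may change both states;
  \<open>tr t s\<close> lists the outcomes with their weights, and \<open>F\<close> values the final
  list.\<close>

primrec attach :: "('s \<Rightarrow> 's \<Rightarrow> (real \<times> 's \<times> 's) list) \<Rightarrow> ('s list \<Rightarrow> real) \<Rightarrow> 's list \<Rightarrow> 's \<Rightarrow> 's list \<Rightarrow> real" where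
  "attach tr F [] t N = F (N @ [t])"
| "attach tr F (s # L) t N = (\<Sum>(r, t', s')\<leftarrow>tr t s. r * attach tr F L t' (N @ [s']))"

definition extend :: "(real \<times> 's) list \<Rightarrow> ('s \<Rightarrow> 's \<Rightarrow> (real \<times> 's \<times> 's) list) \<Rightarrow> ('s list \<Rightarrow> real) \<Rightarrow> 's list \<Rightarrow> real" where
  "extend ini tr F L = (\<Sum>(r, t)\<leftarrow>ini. r * attach tr F L t [])"

definition symmetric :: "('s list \<Rightarrow> real) \<Rightarrow> bool" where
  "symmetric F \<longleftrightarrow> (\<forall>L L'. mset L = mset L' \<longrightarrow> F L = F L')"

text \<open>Meeting \<open>a\<close> before \<open>b\<close> or \<open>b\<close> before
  \<open>a\<close> gives the same weighted collection of outcomes. Testing against an arbitrary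
  \<Phi> states this without matching the outcomes up one by one.\<close>

definition commuting :: "('s \<Rightarrow> 's \<Rightarrow> (real \<times> 's \<times> 's) list) \<Rightarrow> bool" where
  "commuting tr \<longleftrightarrow> (\<forall>t a b (\<Phi> :: 's \<Rightarrow> 's \<Rightarrow> 's \<Rightarrow> real).
     (\<Sum>(r, t', a')\<leftarrow>tr t a. \<Sum>(r', t'', b')\<leftarrow>tr t' b. r * r' * \<Phi> t'' a' b') =
     (\<Sum>(r, t', b')\<leftarrow>tr t b. \<Sum>(r', t'', a')\<leftarrow>tr t' a. r * r' * \<Phi> t'' a' b'))"

lemma attach_perm_new:
  assumes "symmetric F"
  shows "mset N = mset N' \<Longrightarrow> attach tr F L t N = attach tr F L t N'"
proof (induction L arbitrary: t N N')
  case Nil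
  then have "mset (N @ [t]) = mset (N' @ [t])" by simp
  then show ?case using assms unfolding symmetric_def attach.simps by blast
next
  case (Cons s L)
  have "attach tr F L t' (N @ [s']) = attach tr F L t' (N' @ [s'])" for t' s'
    using Cons by simp
  then show ?case by simp
qed

text \<open>Two things change: the order of the meetings, which \<open>commuting tr\<close> takes
  care of, and the order in which the results are appended to \<open>N\<close>, which
  \<open>symmetric F\<close> makes harmless.\<close>

lemma attach_swap:
  assumes "symmetric F" "commuting tr"
  shows "attach tr F (a # b # L) t N = attach tr F (b # a # L) t N"
proof -
  have "attach tr F L t'' (N @ [a', b']) = attach tr F L t'' (N @ [b', a'])" for t'' a' b'
    by (rule attach_perm_new[OF assms(1)]) simp
  moreover have "(\<Sum>(r, t', a')\<leftarrow>tr t a. \<Sum>(r', t'', b')\<leftarrow>tr t' b. r * r' * attach tr F L t'' (N @ [a', b'])) =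
     (\<Sum>(r, t', b')\<leftarrow>tr t b. \<Sum>(r', t'', a')\<leftarrow>tr t' a. r * r' * attach tr F L t'' (N @ [a', b']))"
    using assms(2)[unfolded commuting_def, rule_format, of "\<lambda>t'' a' b'. attach tr F L t'' (N @ [a', b'])"] .
  ultimately show ?thesis
    by (simp add: sum_list_const_mult[symmetric] case_prod_unfold mult.assoc)
qed

lemma attach_move:
  assumes "symmetric F" "commuting tr"
  shows "attach tr F (L1 @ s # L2) t N = attach tr F (s # L1 @ L2) t N"
proof (induction L1 arbitrary: t N)
  case (Cons a L1)
  have "attach tr F ((a # L1) @ s # L2) t N = attach tr F (a # s # L1 @ L2) t N"
    using Cons by simp
  also have "\<dots> = attach tr F (s # a # L1 @ L2) t N" by (rule attach_swap[OF assms])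
  finally show ?case by simp
qed simp

lemma attach_perm:
  assumes "symmetric F" "commuting tr"
  shows "mset L = mset L' \<Longrightarrow> attach tr F L t N = attach tr F L' t N"
proof (induction L arbitrary: L' t N)
  case (Cons s L)
  then have "s \<in> set L'" by (metis list.set_intros(1) mset_eq_setD)
  then obtain L1 L2 where L': "L' = L1 @ s # L2" by (auto simp: in_set_conv_decomp)
  then have "mset L = mset (L1 @ L2)" using Cons.prems by simp
  then have "attach tr F (s # L) t N = attach tr F (s # L1 @ L2) t N"
    using Cons.IH by (simp only: attach.simps)
  then show ?case unfolding L' attach_move[OF assms] .
qed simp

lemma symmetric_extend:
  assumes "symmetric F" "commuting tr"
  shows "symmetric (extend ini tr F)"
  unfolding symmetric_def
proof (intro allI impI)
  fix L L' :: "'a list"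
  assume "mset L = mset L'"
  then have "attach tr F L t [] = attach tr F L' t []" for t by (rule attach_perm[OF assms])
  then show "extend ini tr F L = extend ini tr F L'" by (simp add: extend_def)
qed

lemma symmetric_extend_funpow:
  "symmetric F \<Longrightarrow> commuting tr \<Longrightarrow> symmetric ((extend ini tr ^^ m) F)"
  by (induction m) (auto intro: symmetric_extend)

lemma sum_list_upt_single:
  assumes "a < d" "\<And>x. x < d \<Longrightarrow> x \<noteq> a \<Longrightarrow> f x = 0"
  shows "(\<Sum>x\<leftarrow>[0..<d]. f x) = (f a :: real)"
proof -
  have "(\<Sum>x\<leftarrow>[0..<d]. f x) = (\<Sum>x<d. f x)"
    by (simp add: interv_sum_list_conv_sum_set_nat atLeast0LessThan)
  also have "\<dots> = (\<Sum>x\<in>{a}. f x)" using assms by (intro sum.mono_neutral_right) auto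
  finally show ?thesis by simp
qed

lemma sum_list_map_eq_0: "(\<And>x. x \<in> set xs \<Longrightarrow> f x = 0) \<Longrightarrow> (\<Sum>x\<leftarrow>xs. f x) = (0 :: real)"
  by (induction xs) auto

lemma sum_list_map_concat: "(\<Sum>x\<leftarrow>concat xss. f x) = (\<Sum>xs\<leftarrow>xss. \<Sum>x\<leftarrow>xs. f x :: real)"
  by (induction xss) auto

text \<open>\<open>h\<close> and \<open>g\<close> number the finite state set \<open>S\<close> by
  the naturals below \<open>d\<close>, since the cells of the rewriting system are naturals.\<close>

locale insertion =
  fixes S :: "'s set" and ini :: "(real \<times> 's) list" and tr :: "'s \<Rightarrow> 's \<Rightarrow> (real \<times> 's \<times> 's) list"
    and acc :: "'s \<Rightarrow> bool" and d :: nat and h :: "'s \<Rightarrow> nat" and g :: "nat \<Rightarrow> 's"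
  assumes h: "\<And>s. s \<in> S \<Longrightarrow> h s < d \<and> g (h s) = s"
    and g: "\<And>a. a < d \<Longrightarrow> g a \<in> S \<and> h (g a) = a"
    and ini: "\<And>r t. (r, t) \<in> set ini \<Longrightarrow> t \<in> S"
    and tr: "\<And>t s r t' s'. t \<in> S \<Longrightarrow> s \<in> S \<Longrightarrow> (r, t', s') \<in> set (tr t s) \<Longrightarrow> t' \<in> S \<and> s' \<in> S"
    and comm: "commuting tr"
begin

text \<open>
  Cell \<open>0\<close> holds the elements not yet inserted. The other cells come in three blocks of size \<open>d\<close>:
  old elements waiting for the new one, the new element, and old elements already attached to it.
\<close>

abbreviation current_cells :: "nat list" where
  "current_cells \<equiv> map (\<lambda>x. 1 + d + x) [0..<d]"

abbreviation attached_cells :: "nat \<Rightarrow> nat list" where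
  "attached_cells a \<equiv> map (\<lambda>x. 1 + 2 * d + x) [0..<a]"

text \<open>Requiring the waiting cells below \<open>b\<close> to be empty selects the least waiting
  state. So just one old state is treated at a time, and its multiplicity does not enter the
  weight.\<close>

abbreviation interact_rule :: "nat \<Rightarrow> nat \<Rightarrow> real \<times> 's \<times> 's \<Rightarrow> rule" where
  "interact_rule a b \<equiv> \<lambda>(r, t', s'). Rule [1 + d + a, 1 + b] (map Suc [0..<b]) r
     (Some ([1 + d + a, 1 + b], [1 + d + h t', 1 + 2 * d + h s']))"

definition interact_rules :: "rule list" where
  "interact_rules = concat (map (\<lambda>a. concat (map (\<lambda>b. map (interact_rule a b) (tr (g a) (g b))) [0..<d])) [0..<d])"

definition settle_rules :: "rule list" where
  "settle_rules = map (\<lambda>a. Rule [1 + d + a] (map Suc [0..<d]) 1 (Some ([1 + d + a], [1 + 2 * d + a]))) [0..<d]"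

text \<open>Before the next insertion the attached elements become waiting ones again, one by one
  and the least first, so that the course of this phase is forced.\<close>

definition age_rules :: "rule list" where
  "age_rules = map (\<lambda>a. Rule [1 + 2 * d + a] (current_cells @ attached_cells a)
     1 (Some ([1 + 2 * d + a], [1 + a]))) [0..<d]"

definition spawn_rules :: "rule list" where
  "spawn_rules = map (\<lambda>(r, t). Rule [0] (current_cells @ attached_cells d)
     r (Some ([0], [1 + d + h t]))) ini"

text \<open>That every element is accepted is an absence test: the waiting cells of rejected states
  have to be empty.\<close>

definition halt_rule :: rule where
  "halt_rule = Rule [] (0 # (current_cells @ attached_cells d) @
     map Suc (filter (\<lambda>a. \<not> acc (g a)) [0..<d])) 1 None"

definition rules :: "rule list" where
  "rules = interact_rules @ settle_rules @ age_rules @ spawn_rules @ [halt_rule]"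

definition cfg :: "nat \<Rightarrow> 's multiset \<Rightarrow> 's multiset \<Rightarrow> 's multiset \<Rightarrow> nat multiset" where
  "cfg m L T N = replicate_mset m 0 + image_mset (\<lambda>s. 1 + h s) L + image_mset (\<lambda>s. 1 + d + h s) T +
     image_mset (\<lambda>s. 1 + 2 * d + h s) N"

lemma in_cfg:
  assumes "set_mset L \<subseteq> S" "set_mset T \<subseteq> S" "set_mset N \<subseteq> S"
  shows "0 \<in># cfg m L T N \<longleftrightarrow> m > 0"
    and "x < d \<Longrightarrow> Suc x \<in># cfg m L T N \<longleftrightarrow> g x \<in># L"
    and "x < d \<Longrightarrow> Suc (d + x) \<in># cfg m L T N \<longleftrightarrow> g x \<in># T"
    and "x < d \<Longrightarrow> Suc (2 * d + x) \<in># cfg m L T N \<longleftrightarrow> g x \<in># N"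
proof -
  have lt: "s \<in># L + T + N \<Longrightarrow> h s < d" for s using h assms by auto
  have im: "(\<exists>s. s \<in># M \<and> x = h s) \<longleftrightarrow> g x \<in># M" if "x < d" "set_mset M \<subseteq> S" for M
    using that h g by (metis subsetD)
  show "0 \<in># cfg m L T N \<longleftrightarrow> m > 0" by (auto simp: cfg_def in_replicate_mset)
  assume x: "x < d"
  have Suc: "Suc y \<in># cfg m L T N \<longleftrightarrow>
    (\<exists>s. s \<in># L \<and> y = h s) \<or> (\<exists>s. s \<in># T \<and> y = d + h s) \<or> (\<exists>s. s \<in># N \<and> y = 2 * d + h s)" for y
    by (auto simp: cfg_def)
  have no: "s \<in># L \<Longrightarrow> d + y \<noteq> h s" "s \<in># T \<Longrightarrow> 2 * d + y \<noteq> d + h s" "x \<noteq> d + h s" "x \<noteq> 2 * d + h s"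
    "s \<in># L \<Longrightarrow> 2 * d + y \<noteq> h s" "d + x \<noteq> 2 * d + h s" for s y
    using lt[of s] x by auto
  show "Suc x \<in># cfg m L T N \<longleftrightarrow> g x \<in># L"
    unfolding Suc im[OF x assms(1), symmetric] using no by blast
  have "d + x = d + h s \<longleftrightarrow> x = h s" "2 * d + x = 2 * d + h s \<longleftrightarrow> x = h s" for s by auto
  then show "Suc (d + x) \<in># cfg m L T N \<longleftrightarrow> g x \<in># T" "Suc (2 * d + x) \<in># cfg m L T N \<longleftrightarrow> g x \<in># N"
    unfolding Suc im[OF x assms(2), symmetric] im[OF x assms(3), symmetric] using no by metis+
qed

lemma enabled_iff:
  "enabled \<rho> C \<longleftrightarrow> (\<forall>x\<in>set (present \<rho>). x \<in># C) \<and> (\<forall>x\<in>set (absent \<rho>). x \<notin># C)"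
  by (auto simp: enabled_def)

lemma empty_iff: "set_mset M \<subseteq> S \<Longrightarrow> (\<forall>x<d. g x \<notin># M) \<longleftrightarrow> M = {#}"
  using h by (metis empty_iff multiset_nonemptyE set_mset_empty subsetD)

abbreviation gain :: "nat \<Rightarrow> nat multiset \<Rightarrow> rule \<Rightarrow> real" where
  "gain \<equiv> contribution rules"

lemma run_weight_rules:
  "run_weight rules (Suc k) C = (\<Sum>\<rho>\<leftarrow>interact_rules. gain k C \<rho>) + (\<Sum>\<rho>\<leftarrow>settle_rules. gain k C \<rho>) +
     (\<Sum>\<rho>\<leftarrow>age_rules. gain k C \<rho>) + (\<Sum>\<rho>\<leftarrow>spawn_rules. gain k C \<rho>) + gain k C halt_rule"
  unfolding run_weight_Suc by (subst (2) rules_def) simp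

lemma not_enabled: "\<not> enabled \<rho> C \<Longrightarrow> gain k C \<rho> = 0"
  by (simp add: contribution_def)

context
  fixes m :: nat and L T N :: "'s multiset"
  assumes S: "set_mset L \<subseteq> S" "set_mset T \<subseteq> S" "set_mset N \<subseteq> S"
begin

lemmas in_cfg' = in_cfg[OF S]

lemma enabled_interact:
  assumes "a < d" "b < d"
  shows "enabled (Rule [1 + d + a, 1 + b] (map Suc [0..<b]) r st) (cfg m L T N) \<longleftrightarrow>
    g a \<in># T \<and> g b \<in># L \<and> (\<forall>x<b. g x \<notin># L)"
  using assms by (simp add: enabled_iff ball_Un del: map_Suc_upt image_Suc_atLeastLessThan) (simp add: in_cfg' Ball_def)

lemma enabled_settle:
  assumes "a < d"
  shows "enabled (Rule [1 + d + a] (map Suc [0..<d]) r st) (cfg m L T N) \<longleftrightarrow> g a \<in># T \<and> L = {#}"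
  using assms unfolding empty_iff[OF S(1), symmetric]
  by (simp add: enabled_iff ball_Un del: map_Suc_upt image_Suc_atLeastLessThan) (simp add: in_cfg' Ball_def)

lemma enabled_age:
  assumes "a < d"
  shows "enabled (Rule [1 + 2 * d + a] (current_cells @ attached_cells a) r st) (cfg m L T N) \<longleftrightarrow>
    g a \<in># N \<and> T = {#} \<and> (\<forall>x<a. g x \<notin># N)"
  using assms unfolding empty_iff[OF S(2), symmetric] by (simp add: enabled_iff ball_Un) (simp add: in_cfg' Ball_def)

lemma enabled_spawn:
  "enabled (Rule [0] (current_cells @ attached_cells d) r st) (cfg m L T N) \<longleftrightarrow>
    m > 0 \<and> T = {#} \<and> N = {#}"
  unfolding empty_iff[OF S(2), symmetric] empty_iff[OF S(3), symmetric]
  by (simp add: enabled_iff ball_Un) (simp add: in_cfg' Ball_def)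

lemma enabled_halt:
  "enabled halt_rule (cfg m L T N) \<longleftrightarrow> m = 0 \<and> T = {#} \<and> N = {#} \<and> (\<forall>s\<in>#L. acc s)"
proof -
  have "enabled halt_rule (cfg m L T N) \<longleftrightarrow> m = 0 \<and> T = {#} \<and> N = {#} \<and> (\<forall>x<d. \<not> acc (g x) \<longrightarrow> g x \<notin># L)"
    unfolding empty_iff[OF S(2), symmetric] empty_iff[OF S(3), symmetric] halt_rule_def
    by (simp add: enabled_iff ball_Un del: map_Suc_upt image_Suc_atLeastLessThan) (simp add: in_cfg' Ball_def imp_conjL)
  also have "(\<forall>x<d. \<not> acc (g x) \<longrightarrow> g x \<notin># L) \<longleftrightarrow> (\<forall>s\<in>#L. acc s)"
    using S(1) h by (metis subsetD)
  finally show ?thesis .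
qed

text \<open>Which of \<open>m\<close>, \<open>L\<close>, \<open>T\<close> and \<open>N\<close>
  vanish tells the phase, and the conditions of the five kinds of rules exclude each other. Each
  clause silences one block outside its phase.\<close>

lemma sum_0:
  "T = {#} \<or> L = {#} \<Longrightarrow> (\<Sum>\<rho>\<leftarrow>interact_rules. gain k (cfg m L T N) \<rho>) = 0"
  "T = {#} \<or> L \<noteq> {#} \<Longrightarrow> (\<Sum>\<rho>\<leftarrow>settle_rules. gain k (cfg m L T N) \<rho>) = 0"
  "T \<noteq> {#} \<or> N = {#} \<Longrightarrow> (\<Sum>\<rho>\<leftarrow>age_rules. gain k (cfg m L T N) \<rho>) = 0"
  "m = 0 \<or> T \<noteq> {#} \<or> N \<noteq> {#} \<Longrightarrow> (\<Sum>\<rho>\<leftarrow>spawn_rules. gain k (cfg m L T N) \<rho>) = 0"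
  using enabled_interact enabled_settle enabled_age enabled_spawn
  by (auto intro!: sum_list_map_eq_0 not_enabled
      simp: interact_rules_def settle_rules_def age_rules_def spawn_rules_def)

lemma halt_0:
  assumes "m > 0 \<or> T \<noteq> {#} \<or> N \<noteq> {#}"
  shows "gain k (cfg m L T N) halt_rule = 0"
  using assms enabled_halt by (intro not_enabled) auto

end

lemma run_weight_halt:
  assumes "set_mset L \<subseteq> S"
  shows "run_weight rules (Suc k) (cfg 0 L {#} {#}) = (if \<forall>s\<in>#L. acc s then 1 else 0)"
proof -
  have "gain k (cfg 0 L {#} {#}) halt_rule = (if \<forall>s\<in>#L. acc s then 1 else 0)"
    using assms enabled_halt[of L "{#}" "{#}" 0] unfolding contribution_def by (simp add: halt_rule_def)
  then show ?thesis
    using assms by (simp add: run_weight_rules sum_0)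
qed

lemma run_weight_spawn:
  assumes "set_mset L \<subseteq> S"
  shows "run_weight rules (Suc k) (cfg (Suc m) L {#} {#}) =
    (\<Sum>(r, t)\<leftarrow>ini. r * run_weight rules k (cfg m L {#t#} {#}))"
proof -
  have "gain k (cfg (Suc m) L {#} {#}) (Rule [0] (current_cells @ attached_cells d)
     r (Some ([0], [1 + d + h t]))) = r * run_weight rules k (cfg m L {#t#} {#})" for r t
    unfolding contribution_def using assms
    by (subst enabled_spawn) (auto simp: cfg_def)
  then show ?thesis using assms
    by (simp add: run_weight_rules sum_0 halt_0)
      (simp add: spawn_rules_def o_def case_prod_unfold)
qed

lemma obtain_least:
  assumes "M \<noteq> {#}" "set_mset M \<subseteq> S"
  obtains s where "s \<in># M" "h s < d" "g (h s) = s" "\<forall>x<h s. g x \<notin># M"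
proof -
  define a where "a = (LEAST x. x < d \<and> g x \<in># M)"
  have "\<exists>x<d. g x \<in># M" using empty_iff[OF assms(2)] assms(1) by blast
  then have a: "a < d \<and> g a \<in># M" unfolding a_def by (rule LeastI_ex)
  have "g x \<notin># M" if "x < a" for x
    using not_less_Least[of x "\<lambda>x. x < d \<and> g x \<in># M"] that a by (auto simp: a_def[symmetric])
  then show ?thesis using that[of "g a"] a g by auto
qed

text \<open>The element that ages does not depend on the fuel, hence \<open>s\<close> is obtained
  before \<open>k\<close>.\<close>

lemma run_weight_age:
  assumes "set_mset L \<subseteq> S" "set_mset N \<subseteq> S" "N \<noteq> {#}"
  obtains s where "s \<in># N" "\<And>k. run_weight rules (Suc k) (cfg m L {#} N) = run_weight rules k (cfg m (add_mset s L) {#} (N - {#s#}))"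
proof -
  obtain s where s: "s \<in># N" "h s < d" "g (h s) = s" "\<forall>x<h s. g x \<notin># N"
    using obtain_least[OF assms(3,2)] .
  obtain N' where N: "N = add_mset s N'" using s(1) by (metis insert_DiffM)
  have "run_weight rules (Suc k) (cfg m L {#} N) = run_weight rules k (cfg m (add_mset s L) {#} (N - {#s#}))" for k
  proof -
    define \<rho> where "\<rho> a = Rule [1 + 2 * d + a] (current_cells @ attached_cells a)
       1 (Some ([1 + 2 * d + a], [1 + a]))" for a
    have en: "enabled (\<rho> a) (cfg m L {#} N) \<longleftrightarrow> a = h s" if "a < d" for a
      unfolding \<rho>_def using s that g assms by (subst enabled_age) (auto, metis linorder_neqE_nat)
    have "(\<Sum>a\<leftarrow>[0..<d]. gain k (cfg m L {#} N) (\<rho> a)) = gain k (cfg m L {#} N) (\<rho> (h s))"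
      using en s by (intro sum_list_upt_single) (auto intro: not_enabled)
    also have "\<dots> = run_weight rules k (cfg m (add_mset s L) {#} (N - {#s#}))"
      using en[of "h s"] s(2) unfolding contribution_def by (simp add: \<rho>_def N) (simp add: cfg_def)
    finally show ?thesis using assms
      by (simp add: run_weight_rules sum_0 halt_0)
        (simp add: age_rules_def \<rho>_def o_def)
  qed
  then show ?thesis using that s(1) by blast
qed

lemma run_weight_settle:
  assumes "t \<in> S" "set_mset N \<subseteq> S"
  shows "run_weight rules (Suc k) (cfg m {#} {#t#} N) = run_weight rules k (cfg m {#} {#} (add_mset t N))"
proof -
  define \<rho> where "\<rho> a = Rule [1 + d + a] (map Suc [0..<d]) 1 (Some ([1 + d + a], [1 + 2 * d + a]))" for a
  have en: "enabled (\<rho> a) (cfg m {#} {#t#} N) \<longleftrightarrow> a = h t" if "a < d" for a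
    unfolding \<rho>_def using that g h assms by (subst enabled_settle) auto
  have "(\<Sum>a\<leftarrow>[0..<d]. gain k (cfg m {#} {#t#} N) (\<rho> a)) = gain k (cfg m {#} {#t#} N) (\<rho> (h t))"
    using en h assms by (intro sum_list_upt_single) (auto intro: not_enabled)
  also have "\<dots> = run_weight rules k (cfg m {#} {#} (add_mset t N))"
    using en[of "h t"] h assms unfolding contribution_def by (simp add: \<rho>_def) (simp add: cfg_def)
  finally show ?thesis using assms
    by (simp add: run_weight_rules sum_0 halt_0)
      (simp add: settle_rules_def \<rho>_def o_def)
qed

lemma run_weight_interact:
  assumes "t \<in> S" "set_mset L \<subseteq> S" "set_mset N \<subseteq> S" "L \<noteq> {#}"
  obtains s where "s \<in># L" "\<And>k. run_weight rules (Suc k) (cfg m L {#t#} N) =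
    (\<Sum>(r, t', s')\<leftarrow>tr t s. r * run_weight rules k (cfg m (L - {#s#}) {#t'#} (add_mset s' N)))"
proof -
  obtain s where s: "s \<in># L" "h s < d" "g (h s) = s" "\<forall>x<h s. g x \<notin># L"
    using obtain_least[OF assms(4,2)] .
  obtain L' where L: "L = add_mset s L'" using s(1) by (metis insert_DiffM)
  have t: "h t < d" "g (h t) = t" using h assms by auto
  have "run_weight rules (Suc k) (cfg m L {#t#} N) =
    (\<Sum>(r, t', s')\<leftarrow>tr t s. r * run_weight rules k (cfg m (L - {#s#}) {#t'#} (add_mset s' N)))" for k
  proof -
    define \<rho> where "\<rho> a b = interact_rule a b" for a b
    let ?C = "cfg m L {#t#} N"
    have en: "enabled (\<rho> a b x) ?C \<longleftrightarrow> a = h t \<and> b = h s" if "a < d" "b < d" for a b x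
      unfolding \<rho>_def case_prod_unfold using s t that g assms
      by (subst enabled_interact) (auto, metis linorder_neqE_nat)
    have "(\<Sum>a\<leftarrow>[0..<d]. \<Sum>b\<leftarrow>[0..<d]. \<Sum>x\<leftarrow>tr (g a) (g b). gain k ?C (\<rho> a b x)) =
      (\<Sum>b\<leftarrow>[0..<d]. \<Sum>x\<leftarrow>tr (g (h t)) (g b). gain k ?C (\<rho> (h t) b x))"
      using en t by (intro sum_list_upt_single sum_list_map_eq_0 not_enabled) auto
    also have "\<dots> = (\<Sum>x\<leftarrow>tr (g (h t)) (g (h s)). gain k ?C (\<rho> (h t) (h s) x))"
      using en t s(2) by (intro sum_list_upt_single sum_list_map_eq_0 not_enabled) auto
    also have "\<dots> = (\<Sum>(r, t', s')\<leftarrow>tr t s. r * run_weight rules k (cfg m (L - {#s#}) {#t'#} (add_mset s' N)))"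
    proof -
      have "gain k ?C (\<rho> (h t) (h s) (r, t', s')) =
         r * run_weight rules k (cfg m (L - {#s#}) {#t'#} (add_mset s' N))" for r t' s'
      proof -
        have "?C - mset [1 + d + h t, 1 + h s] + mset [1 + d + h t', 1 + 2 * d + h s'] =
           cfg m (L - {#s#}) {#t'#} (add_mset s' N)"
          by (simp add: cfg_def L)
        then show ?thesis
          using en[of "h t" "h s" "(r, t', s')"] s(2) t(1) unfolding contribution_def by (simp add: \<rho>_def)
      qed
      then show ?thesis unfolding s(3) t(2) by (intro arg_cong[of _ _ sum_list] map_cong) auto
    qed
    finally show ?thesis using assms
      by (simp add: run_weight_rules sum_0 halt_0)
        (simp add: interact_rules_def \<rho>_def o_def sum_list_map_concat)
  qed
  then show ?thesis using that s(1) by blast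
qed

text \<open>Ageing is forced and has weight 1, so it only uses up \<open>size N\<close> units of
  fuel. The value \<open>Z\<close> is the same for all fuels from \<open>k0\<close> on.\<close>

lemma run_weight_ages:
  assumes "set_mset L \<subseteq> S" "set_mset N \<subseteq> S"
    and "\<And>k. k \<ge> k0 \<Longrightarrow> run_weight rules k (cfg m (L + N) {#} {#}) = Z"
    and "k \<ge> k0 + size N"
  shows "run_weight rules k (cfg m L {#} N) = Z"
  using assms
proof (induction "size N" arbitrary: L N k)
  case 0
  then show ?case by simp
next
  case (Suc c)
  then have "N \<noteq> {#}" by auto
  then obtain s where s: "s \<in># N" "\<And>k. run_weight rules (Suc k) (cfg m L {#} N) =
      run_weight rules k (cfg m (add_mset s L) {#} (N - {#s#}))"
    using run_weight_age Suc.prems(1,2) by blast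
  obtain N' where N: "N = add_mset s N'" using s(1) by (metis insert_DiffM)
  obtain k' where k: "k = Suc k'" using Suc.prems(4) Suc.hyps(2) by (cases k) auto
  have "run_weight rules k' (cfg m (add_mset s L) {#} N') = Z"
  proof (rule Suc.hyps(1))
    show "run_weight rules j (cfg m (add_mset s L + N') {#} {#}) = Z" if "k0 \<le> j" for j
      using Suc.prems(3)[OF that] by (simp add: N)
  qed (use Suc.hyps(2) Suc.prems(1,2,4) in \<open>auto simp: N k\<close>)
  then show ?case using s(2) by (simp add: k N)
qed

text \<open>Beyond \<open>k0\<close> the fuel pays for \<open>length L\<close> meetings, one
  settling step and \<open>c + 1\<close> ageing steps. The system meets the least waiting state
  whereas \<open>attach\<close> takes the head of the list; \<open>attach_move\<close> reconciles
  the two.\<close>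

lemma run_weight_attach:
  assumes F: "symmetric F"
    and base: "\<And>k L. set L \<subseteq> S \<Longrightarrow> length L = Suc c \<Longrightarrow> k \<ge> k0 \<Longrightarrow> run_weight rules k (cfg m (mset L) {#} {#}) = F L"
  shows "t \<in> S \<Longrightarrow> set L \<subseteq> S \<Longrightarrow> set N \<subseteq> S \<Longrightarrow> length L + length N = c \<Longrightarrow> k \<ge> k0 + c + 2 + length L \<Longrightarrow>
    run_weight rules k (cfg m (mset L) {#t#} (mset N)) = attach tr F L t N"
proof (induction "length L" arbitrary: L t N k)
  case 0
  then obtain k' where k: "k = Suc k'" by (cases k) auto
  have "run_weight rules k' (cfg m {#} {#} (add_mset t (mset N))) = F (N @ [t])"
  proof (rule run_weight_ages)
    show "run_weight rules j (cfg m ({#} + add_mset t (mset N)) {#} {#}) = F (N @ [t])" if "k0 \<le> j" for j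
      using base[of "N @ [t]" j] that 0 by simp
  qed (use 0 in \<open>auto simp: k\<close>)
  then show ?case using 0 run_weight_settle[of t "mset N" k' m] by (simp add: k)
next
  case (Suc l)
  then obtain k' where k: "k = Suc k'" by (cases k) auto
  have "mset L \<noteq> {#}" using Suc.hyps(2) by auto
  then obtain s where s: "s \<in># mset L" "\<And>k. run_weight rules (Suc k) (cfg m (mset L) {#t#} (mset N)) =
    (\<Sum>(r, t', s')\<leftarrow>tr t s. r * run_weight rules k (cfg m (mset L - {#s#}) {#t'#} (add_mset s' (mset N))))"
    using run_weight_interact[of t "mset L" "mset N" m] Suc.prems(1-3) by auto
  obtain L1 L2 where L: "L = L1 @ s # L2" using s(1) by (auto simp: in_set_conv_decomp)
  have "run_weight rules k' (cfg m (mset L - {#s#}) {#t'#} (add_mset s' (mset N))) = attach tr F (L1 @ L2) t' (N @ [s'])"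
    if "(r, t', s') \<in> set (tr t s)" for r t' s'
  proof -
    have "t' \<in> S" "s' \<in> S" using tr[OF _ _ that] Suc.prems(1,2) s(1) by auto
    then have "run_weight rules k' (cfg m (mset (L1 @ L2)) {#t'#} (mset (N @ [s']))) = attach tr F (L1 @ L2) t' (N @ [s'])"
      using Suc.prems Suc.hyps(2) by (intro Suc.hyps(1)) (auto simp: L k)
    then show ?thesis by (simp add: L)
  qed
  then have "run_weight rules k (cfg m (mset L) {#t#} (mset N)) = attach tr F (s # L1 @ L2) t N"
    unfolding k s(2) attach.simps by (intro arg_cong[of _ _ sum_list] map_cong) auto
  then show ?case unfolding L attach_move[OF F comm] .
qed

text \<open>An insertion among \<open>c\<close> old elements takes 1 + c + 1 + (c + 1) = 2 * c + 3
  steps: spawning, meetings, settling and ageing.\<close>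

lemma run_weight_extend:
  assumes F: "symmetric F"
    and base: "\<And>k L. set L \<subseteq> S \<Longrightarrow> length L = Suc c \<Longrightarrow> k \<ge> k0 \<Longrightarrow> run_weight rules k (cfg m (mset L) {#} {#}) = F L"
    and L: "set L \<subseteq> S" "length L = c" and k: "k \<ge> k0 + 2 * c + 3"
  shows "run_weight rules k (cfg (Suc m) (mset L) {#} {#}) = extend ini tr F L"
proof -
  obtain k' where k': "k = Suc k'" using k by (cases k) auto
  have "run_weight rules k' (cfg m (mset L) {#t#} (mset [])) = attach tr F L t []" if "(r, t) \<in> set ini" for r t
    by (rule run_weight_attach[OF F base]) (use ini[OF that] L k k' in auto)
  then show ?thesis
    unfolding k' extend_def run_weight_spawn[OF L(1)[folded set_mset_mset]]
    by (intro arg_cong[of _ _ sum_list] map_cong) auto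
qed

definition accept_all :: "'s list \<Rightarrow> real" where
  "accept_all L = (if \<forall>s\<in>set L. acc s then 1 else 0)"

lemma symmetric_accept_all: "symmetric accept_all"
  unfolding symmetric_def accept_all_def by (auto dest: mset_eq_setD)

text \<open>The fuel adds up the insertion costs 2 * (l + i) + 3 for i < m, where l is the length of
  \<open>L\<close>, and one final step for halting.\<close>

lemma run_weight_process:
  "set L \<subseteq> S \<Longrightarrow> k \<ge> m * m + 2 * m * length L + 2 * m + 1 \<Longrightarrow>
    run_weight rules k (cfg m (mset L) {#} {#}) = (extend ini tr ^^ m) accept_all L"
proof (induction m arbitrary: L k)
  case 0
  then obtain k' where "k = Suc k'" by (cases k) auto
  then show ?case using 0 run_weight_halt[of "mset L"] by (simp add: accept_all_def)
next
  case (Suc m)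
  have "run_weight rules k (cfg (Suc m) (mset L) {#} {#}) = extend ini tr ((extend ini tr ^^ m) accept_all) L"
  proof (rule run_weight_extend[of _ "length L" "m * m + 2 * m * Suc (length L) + 2 * m + 1"])
    show "symmetric ((extend ini tr ^^ m) accept_all)"
      by (rule symmetric_extend_funpow[OF symmetric_accept_all comm])
  qed (use Suc in \<open>auto simp: algebra_simps\<close>)
  then show ?case by simp
qed

lemma rules_ok:
  assumes "\<And>r t. (r, t) \<in> set ini \<Longrightarrow> r \<in> constants K"
    and "\<And>t s r t' s'. t \<in> S \<Longrightarrow> s \<in> S \<Longrightarrow> (r, t', s') \<in> set (tr t s) \<Longrightarrow> r \<in> constants K"
    and "\<rho> \<in> set rules"
  shows "rule_ok (1 + 3 * d) K \<rho>"
proof -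
  have one: "1 \<in> constants K" by (simp add: constants_base)
  have "rule_ok (1 + 3 * d) K \<rho>" if "\<rho> \<in> set interact_rules"
  proof -
    obtain a b r t' s' where *: "a < d" "b < d" "(r, t', s') \<in> set (tr (g a) (g b))"
      "\<rho> = interact_rule a b (r, t', s')"
      using \<open>\<rho> \<in> set interact_rules\<close> by (auto simp: interact_rules_def)
    have "r \<in> constants K" "h t' < d" "h s' < d"
      using assms(2) tr g h *(1-3) by blast+
    then show ?thesis using * by (auto simp: rule_ok_def)
  qed
  moreover have "rule_ok (1 + 3 * d) K \<rho>" if "\<rho> \<in> set (settle_rules @ age_rules @ [halt_rule])"
    using that one by (auto simp: settle_rules_def age_rules_def halt_rule_def rule_ok_def)
  moreover have "rule_ok (1 + 3 * d) K \<rho>" if "\<rho> \<in> set spawn_rules"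
    using that assms(1) ini h by (fastforce simp: spawn_rules_def rule_ok_def)
  ultimately show ?thesis using assms(3) unfolding rules_def by auto
qed

lemma polytime_computable_process:
  assumes "\<And>r t. (r, t) \<in> set ini \<Longrightarrow> r \<in> constants K"
    and "\<And>t s r t' s'. t \<in> S \<Longrightarrow> s \<in> S \<Longrightarrow> (r, t', s') \<in> set (tr t s) \<Longrightarrow> r \<in> constants K"
  shows "polytime_computable K (\<lambda>n. (extend ini tr ^^ n) accept_all [])"
proof -
  have "polytime_computable K (\<lambda>n. run_weight rules ((n + 1) ^ 3 - 1) (replicate_mset n 0))"
    using rules_ok[OF assms] by (rule polytime_computable_run_weight[where D = "1 + 3 * d"]) auto
  \<comment> \<open>For n = 0 the fuel \<open>(n + 1) ^ 3 - 1\<close> is 0, too little even to halt,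
    whereas the empty list is accepted with value 1.\<close>
  from polytime_computable_at_0[OF this, of 1]
  have "polytime_computable K (\<lambda>n. if n = 0 then 1 else run_weight rules ((n + 1) ^ 3 - 1) (replicate_mset n 0))"
    by (simp add: constants_base)
  moreover have "(if n = 0 then 1 else run_weight rules ((n + 1) ^ 3 - 1) (replicate_mset n 0)) =
      (extend ini tr ^^ n) accept_all []" for n
  proof (cases "n = 0")
    case True
    then show ?thesis by (simp add: accept_all_def)
  next
    case False
    have "run_weight rules ((n + 1) ^ 3 - 1) (cfg n (mset []) {#} {#}) = (extend ini tr ^^ n) accept_all []"
    proof (rule run_weight_process)
      \<comment> \<open>Starting from the empty list, \<open>(n + 1) ^ 2\<close> steps are required;
        from n = 1 on the third power leaves room for them even after subtracting 1.\<close>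
      have "2 * (n + 1) ^ 2 \<le> (n + 1) * (n + 1) ^ 2" using False by (intro mult_right_mono) auto
      moreover have "(n + 1) ^ 2 \<ge> 1" by simp
      moreover have "(n + 1) * (n + 1) ^ 2 = (n + 1) ^ 3" by (simp add: power2_eq_square power3_eq_cube)
      ultimately have "(n + 1) ^ 2 \<le> (n + 1) ^ 3 - 1" by linarith
      then show "n * n + 2 * n * length [] + 2 * n + 1 \<le> (n + 1) ^ 3 - 1"
        by (simp add: power2_eq_square)
    qed simp
    then show ?thesis using False by (simp add: cfg_def)
  qed
  ultimately show ?thesis by simp
qed

end

theorem polytime_computable_insertion:
  fixes S :: "'s set"
  assumes "finite S"
    and "\<And>r t. (r, t) \<in> set ini \<Longrightarrow> r \<in> constants K \<and> t \<in> S"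
    and "\<And>t s r t' s'. t \<in> S \<Longrightarrow> s \<in> S \<Longrightarrow> (r, t', s') \<in> set (tr t s) \<Longrightarrow> r \<in> constants K \<and> t' \<in> S \<and> s' \<in> S"
    and "commuting tr"
  shows "polytime_computable K (\<lambda>n. (extend ini tr ^^ n) (\<lambda>L. if \<forall>s\<in>set L. acc s then 1 else 0) [])"
proof -
  obtain h where h: "bij_betw h S {..<card S}"
    using ex_bij_betw_finite_nat[OF assms(1)] by (auto simp: atLeast0LessThan)
  have h1: "h s < card S \<and> inv_into S h (h s) = s" if "s \<in> S" for s
    using h that by (auto simp: bij_betw_def)
  have h2: "inv_into S h a \<in> S \<and> h (inv_into S h a) = a" if "a < card S" for a
    using h that by (auto simp: bij_betw_def inv_into_into f_inv_into_f)
  interpret insertion S ini tr acc "card S" h "inv_into S h"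
    by unfold_locales (use h1 h2 assms in blast)+
  show ?thesis using polytime_computable_process[of K] assms unfolding accept_all_def by blast
qed

section \<open>Reduction to counting quantifiers over two variables\<close>

text \<open>The two variables are the truth values, so \<open>\<not> b\<close> names the other
  variable and an assignment is a function on \<open>bool\<close>. Lower thresholds suffice as
  quantifiers, the others being Boolean combinations of them.\<close>

datatype 'p gf = GAtom 'p "bool list" | GEq bool bool | GNot "'p gf" | GAnd "'p gf" "'p gf" | GGe nat bool "'p gf"

fun gsat :: "nat \<Rightarrow> 'p world \<Rightarrow> (bool \<Rightarrow> nat) \<Rightarrow> 'p gf \<Rightarrow> bool" where
  "gsat n \<omega> \<tau> (GAtom p bs) \<longleftrightarrow> (p, map \<tau> bs) \<in> \<omega>"
| "gsat n \<omega> \<tau> (GEq b c) \<longleftrightarrow> \<tau> b = \<tau> c"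
| "gsat n \<omega> \<tau> (GNot f) \<longleftrightarrow> \<not> gsat n \<omega> \<tau> f"
| "gsat n \<omega> \<tau> (GAnd f g) \<longleftrightarrow> gsat n \<omega> \<tau> f \<and> gsat n \<omega> \<tau> g"
| "gsat n \<omega> \<tau> (GGe k b f) \<longleftrightarrow> k \<le> card {a \<in> {1..n}. gsat n \<omega> (\<tau>(b := a)) f}"

fun translate :: "(nat \<Rightarrow> bool) \<Rightarrow> 'p fm \<Rightarrow> 'p gf" where
  "translate r (Atom p xs) = GAtom p (map r xs)"
| "translate r (Equal x y) = GEq (r x) (r y)"
| "translate r (Neg f) = GNot (translate r f)"
| "translate r (Conj f g) = GAnd (translate r f) (translate r g)"
| "translate r (Disj f g) = GNot (GAnd (GNot (translate r f)) (GNot (translate r g)))"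
| "translate r (Imp f g) = GNot (GAnd (translate r f) (GNot (translate r g)))"
| "translate r (Iff f g) = GAnd (GNot (GAnd (translate r f) (GNot (translate r g))))
     (GNot (GAnd (translate r g) (GNot (translate r f))))"
| "translate r (Forall x f) = GNot (GGe 1 (r x) (GNot (translate r f)))"
| "translate r (Exists x f) = GGe 1 (r x) (translate r f)"
| "translate r (ExistsEq k x f) = GAnd (GGe k (r x) (translate r f)) (GNot (GGe (Suc k) (r x) (translate r f)))"
| "translate r (ExistsLe k x f) = GNot (GGe (Suc k) (r x) (translate r f))"
| "translate r (ExistsGe k x f) = GGe k (r x) (translate r f)"

lemma card_ge_1_iff: "Suc 0 \<le> card {a. Suc 0 \<le> a \<and> a \<le> (n::nat) \<and> Q a} \<longleftrightarrow> (\<exists>a\<in>{Suc 0..n}. Q a)"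
  by (auto simp: Suc_le_eq card_gt_0_iff)

lemma free_vars_subset: "free_vars f \<subseteq> vars f"
  by (induction f) auto

text \<open>Agreement is asked for on the free variables only, so it survives requantification;
  injectivity of \<open>r\<close> on all variables keeps the update at \<open>r x\<close> from
  touching another variable.\<close>

lemma gsat_translate:
  assumes "inj_on r (vars f)" "\<And>x. x \<in> free_vars f \<Longrightarrow> \<sigma> x = \<tau> (r x)"
  shows "gsat n \<omega> \<tau> (translate r f) \<longleftrightarrow> sat n \<omega> \<sigma> f"
  using assms
proof (induction f arbitrary: \<sigma> \<tau>)
  case (Atom p xs)
  then have "map \<tau> (map r xs) = map \<sigma> xs" by simp
  then show ?case by (simp only: translate.simps gsat.simps sat.simps)
next
  case (Neg f)
  show ?case using Neg.IH[of \<sigma> \<tau>] Neg.prems by simp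
next
  case (Conj f g)
  show ?case using Conj.IH(1)[of \<sigma> \<tau>] Conj.IH(2)[of \<sigma> \<tau>] Conj.prems by (simp add: inj_on_Un)
next
  case (Disj f g)
  show ?case using Disj.IH(1)[of \<sigma> \<tau>] Disj.IH(2)[of \<sigma> \<tau>] Disj.prems by (simp add: inj_on_Un)
next
  case (Imp f g)
  show ?case using Imp.IH(1)[of \<sigma> \<tau>] Imp.IH(2)[of \<sigma> \<tau>] Imp.prems by (simp add: inj_on_Un)
next
  case (Iff f g)
  have "gsat n \<omega> \<tau> (translate r f) \<longleftrightarrow> sat n \<omega> \<sigma> f" "gsat n \<omega> \<tau> (translate r g) \<longleftrightarrow> sat n \<omega> \<sigma> g"
    using Iff.IH(1)[of \<sigma> \<tau>] Iff.IH(2)[of \<sigma> \<tau>] Iff.prems by (simp_all add: inj_on_Un)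
  then show ?case by auto
next
  case (Forall x f)
  have "gsat n \<omega> (\<tau>(r x := a)) (translate r f) \<longleftrightarrow> sat n \<omega> (\<sigma>(x := a)) f" for a
    by (rule Forall.IH) (use Forall.prems free_vars_subset[of f] in \<open>auto simp: inj_on_def\<close>)
  then show ?case by (simp add: card_ge_1_iff)
next
  case (Exists x f)
  have "gsat n \<omega> (\<tau>(r x := a)) (translate r f) \<longleftrightarrow> sat n \<omega> (\<sigma>(x := a)) f" for a
    by (rule Exists.IH) (use Exists.prems free_vars_subset[of f] in \<open>auto simp: inj_on_def\<close>)
  then show ?case by (simp add: card_ge_1_iff)
next
  case (ExistsEq k x f)
  have "gsat n \<omega> (\<tau>(r x := a)) (translate r f) \<longleftrightarrow> sat n \<omega> (\<sigma>(x := a)) f" for a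
    by (rule ExistsEq.IH) (use ExistsEq.prems free_vars_subset[of f] in \<open>auto simp: inj_on_def\<close>)
  then show ?case by auto
next
  case (ExistsLe k x f)
  have "gsat n \<omega> (\<tau>(r x := a)) (translate r f) \<longleftrightarrow> sat n \<omega> (\<sigma>(x := a)) f" for a
    by (rule ExistsLe.IH) (use ExistsLe.prems free_vars_subset[of f] in \<open>auto simp: inj_on_def\<close>)
  then show ?case by (simp add: not_less_eq_eq)
next
  case (ExistsGe k x f)
  have "gsat n \<omega> (\<tau>(r x := a)) (translate r f) \<longleftrightarrow> sat n \<omega> (\<sigma>(x := a)) f" for a
    by (rule ExistsGe.IH) (use ExistsGe.prems free_vars_subset[of f] in \<open>auto simp: inj_on_def\<close>)
  then show ?case by simp
qed auto

text \<open>A sentence has no free variable, so one common value serves both variables. Letting this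
  value range over the domain turns truth into a condition on single elements, which can be tested
  at the end of the insertions; on the empty domain it is vacuous.\<close>

definition gmodels :: "'p gf \<Rightarrow> nat \<Rightarrow> 'p world \<Rightarrow> bool" where
  "gmodels \<phi> n \<omega> \<longleftrightarrow> (\<forall>i\<in>{1..n}. gsat n \<omega> (\<lambda>_. i) \<phi>)"

lemma finite_vars: "finite (vars f)"
  by (induction f) auto

lemma ex_gmodels:
  assumes "C2_sentence P ar \<psi>"
  shows "\<exists>\<phi>. \<forall>n>0. \<forall>\<omega>. models \<psi> n \<omega> \<longleftrightarrow> gmodels \<phi> n \<omega>"
proof -
  have "card (vars \<psi>) \<le> card (UNIV :: bool set)" using assms by (simp add: C2_sentence_def)
  then obtain r :: "nat \<Rightarrow> bool" where r: "inj_on r (vars \<psi>)"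
    using inj_on_iff_card_le[OF finite_vars, of "UNIV :: bool set"] by auto
  have "models \<psi> n \<omega> \<longleftrightarrow> gmodels (translate r \<psi>) n \<omega>" if "n > 0" for n \<omega>
  proof -
    have "sat n \<omega> \<sigma> \<psi> \<longleftrightarrow> gsat n \<omega> (\<lambda>_. i) (translate r \<psi>)" for \<sigma> i
      using assms gsat_translate[OF r, of \<sigma> "\<lambda>_. i"] by (simp add: C2_sentence_def)
    moreover have "\<exists>i. i \<in> {1..n}" using that by auto
    ultimately show ?thesis unfolding models_def gmodels_def by blast
  qed
  then show ?thesis by blast
qed

section \<open>Local evaluation\<close>

text \<open>
  A quantified subformula has at most one free variable, so its truth value is a property of a single
  element. In \<open>lev\<close> these values are guessed: \<open>\<beta> i\<close> is the set of quantified subformulas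
  assumed to hold of \<open>i\<close>, read off at the variable that is not bound.
\<close>

fun quants :: "'p gf \<Rightarrow> 'p gf set" where
  "quants (GAtom p bs) = {}"
| "quants (GEq b c) = {}"
| "quants (GNot f) = quants f"
| "quants (GAnd f g) = quants f \<union> quants g"
| "quants (GGe k b f) = insert (GGe k b f) (quants f)"

fun lev :: "'p world \<Rightarrow> (nat \<Rightarrow> 'p gf set) \<Rightarrow> (bool \<Rightarrow> nat) \<Rightarrow> 'p gf \<Rightarrow> bool" where
  "lev \<omega> \<beta> \<tau> (GAtom p bs) \<longleftrightarrow> (p, map \<tau> bs) \<in> \<omega>"
| "lev \<omega> \<beta> \<tau> (GEq b c) \<longleftrightarrow> \<tau> b = \<tau> c"
| "lev \<omega> \<beta> \<tau> (GNot f) \<longleftrightarrow> \<not> lev \<omega> \<beta> \<tau> f"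
| "lev \<omega> \<beta> \<tau> (GAnd f g) \<longleftrightarrow> lev \<omega> \<beta> \<tau> f \<and> lev \<omega> \<beta> \<tau> g"
| "lev \<omega> \<beta> \<tau> (GGe k b f) \<longleftrightarrow> GGe k b f \<in> \<beta> (\<tau> (\<not> b))"

fun bound :: "'p gf \<Rightarrow> nat" where
  "bound (GGe k b f) = k"
| "bound _ = 0"

fun holds :: "'p world \<Rightarrow> (nat \<Rightarrow> 'p gf set) \<Rightarrow> nat \<Rightarrow> nat \<Rightarrow> 'p gf \<Rightarrow> bool" where
  "holds \<omega> \<beta> i a (GGe k b f) = lev \<omega> \<beta> ((\<lambda>_. i)(b := a)) f"
| "holds \<omega> \<beta> i a _ = False"

lemma finite_quants: "finite (quants f)"
  by (induction f) auto

lemma quants_trans: "GGe k b f \<in> quants g \<Longrightarrow> insert (GGe k b f) (quants f) \<subseteq> quants g"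
  by (induction g) auto

lemma quants_GGe: "q \<in> quants g \<Longrightarrow> \<exists>k b f. q = GGe k b f"
  by (induction g) auto

lemma lev_cong:
  assumes "\<And>p bs. (p, map \<tau> bs) \<in> \<omega> \<longleftrightarrow> (p, map \<tau>' bs) \<in> \<omega>'"
    and "\<And>b c. \<tau> b = \<tau> c \<longleftrightarrow> \<tau>' b = \<tau>' c" and "\<And>b. \<beta> (\<tau> b) = \<beta>' (\<tau>' b)"
  shows "lev \<omega> \<beta> \<tau> f \<longleftrightarrow> lev \<omega>' \<beta>' \<tau>' f"
  using assms by (induction f) auto

text \<open>Only atoms over the pair, equality of its members and their guesses enter, so the pair
  may be moved along \<open>h\<close> into another world. This reduces arbitrary pairs to a template
  pair.\<close>

lemma holds_cong:
  assumes "\<And>p ts. set ts \<subseteq> {i, a} \<Longrightarrow> (p, ts) \<in> \<omega> \<longleftrightarrow> (p, map h ts) \<in> \<omega>'"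
    and "h i = h a \<longleftrightarrow> i = a" and "\<beta> i = \<beta>' (h i)" "\<beta> a = \<beta>' (h a)"
  shows "holds \<omega> \<beta> i a q \<longleftrightarrow> holds \<omega>' \<beta>' (h i) (h a) q"
proof (cases q)
  case (GGe k b f)
  define \<tau> where "\<tau> = (\<lambda>_. i)(b := a)"
  have \<tau>: "(\<lambda>_. h i)(b := h a) = h \<circ> \<tau>" by (auto simp: \<tau>_def)
  have "lev \<omega> \<beta> \<tau> f \<longleftrightarrow> lev \<omega>' \<beta>' (h \<circ> \<tau>) f"
  proof (rule lev_cong)
    fix p bs
    have "set (map \<tau> bs) \<subseteq> {i, a}" by (auto simp: \<tau>_def)
    from assms(1)[OF this, of p] show "(p, map \<tau> bs) \<in> \<omega> \<longleftrightarrow> (p, map (h \<circ> \<tau>) bs) \<in> \<omega>'" by simp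
  qed (use assms(2-4) in \<open>auto simp: \<tau>_def\<close>)
  then show ?thesis unfolding GGe holds.simps \<tau> unfolding \<tau>_def .
qed auto

definition consistent :: "'p gf set \<Rightarrow> nat \<Rightarrow> 'p world \<Rightarrow> (nat \<Rightarrow> 'p gf set) \<Rightarrow> bool" where
  "consistent Q n \<omega> \<beta> \<longleftrightarrow>
     (\<forall>i\<in>{1..n}. \<forall>q\<in>Q. q \<in> \<beta> i \<longleftrightarrow> bound q \<le> card {a \<in> {1..n}. holds \<omega> \<beta> i a q})"

text \<open>A guess that satisfies its own consistency equations is right: by induction the matrix
  of a quantified subformula is evaluated correctly, hence so is the count on which its truth
  depends.\<close>

lemma consistent_lev:
  assumes "consistent Q n \<omega> \<beta>"
  shows "quants f \<subseteq> Q \<Longrightarrow> range \<tau> \<subseteq> {1..n} \<Longrightarrow> lev \<omega> \<beta> \<tau> f \<longleftrightarrow> gsat n \<omega> \<tau> f"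
proof (induction f arbitrary: \<tau>)
  case (GGe k b f)
  have upd: "(\<lambda>_. \<tau> (\<not> b))(b := a) = \<tau>(b := a)" for a by (auto simp: fun_eq_iff)
  have mem: "\<tau> (\<not> b) \<in> {1..n}" using GGe.prems(2) by (rule subsetD) simp
  have "GGe k b f \<in> \<beta> (\<tau> (\<not> b)) \<longleftrightarrow> k \<le> card {a \<in> {1..n}. holds \<omega> \<beta> (\<tau> (\<not> b)) a (GGe k b f)}"
    using assms GGe.prems(1) mem unfolding consistent_def by fastforce
  also have "{a \<in> {1..n}. holds \<omega> \<beta> (\<tau> (\<not> b)) a (GGe k b f)} = {a \<in> {1..n}. gsat n \<omega> (\<tau>(b := a)) f}"
    unfolding holds.simps upd using GGe.prems mem by (intro Collect_cong conj_cong refl GGe.IH) auto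
  finally show ?case by simp
qed auto

text \<open>Left \<open>undefined\<close> outside the domain so as to lie in the extensional
  function space over which guesses are summed.\<close>

definition truth :: "'p gf set \<Rightarrow> nat \<Rightarrow> 'p world \<Rightarrow> nat \<Rightarrow> 'p gf set" where
  "truth Q n \<omega> = (\<lambda>i. if i \<in> {1..n} then {q \<in> Q. gsat n \<omega> (\<lambda>_. i) q} else undefined)"

lemma consistent_unique:
  assumes "consistent Q n \<omega> \<beta>" "Q = quants \<phi>" "\<beta> \<in> {1..n} \<rightarrow>\<^sub>E Pow Q"
  shows "\<beta> = truth Q n \<omega>"
proof
  fix i
  show "\<beta> i = truth Q n \<omega> i"
  proof (cases "i \<in> {1..n}")
    case True
    have "q \<in> \<beta> i \<longleftrightarrow> gsat n \<omega> (\<lambda>_. i) q" if "q \<in> Q" for q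
    proof -
      obtain k b f where q: "q = GGe k b f" using \<open>q \<in> Q\<close> assms(2) quants_GGe by blast
      have "lev \<omega> \<beta> (\<lambda>_. i) q \<longleftrightarrow> gsat n \<omega> (\<lambda>_. i) q"
        using that assms(2) True by (intro consistent_lev[OF assms(1)]) (auto simp: q dest: quants_trans)
      then show ?thesis by (simp add: q)
    qed
    moreover have "\<beta> i \<subseteq> Q" using assms(3) True by auto
    ultimately show ?thesis using True by (auto simp: truth_def)
  next
    case False
    then show ?thesis using PiE_arb[OF assms(3) False] by (auto simp: truth_def)
  qed
qed

lemma lev_truth:
  "quants f \<subseteq> Q \<Longrightarrow> range \<tau> \<subseteq> {1..n} \<Longrightarrow> lev \<omega> (truth Q n \<omega>) \<tau> f \<longleftrightarrow> gsat n \<omega> \<tau> f"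
proof (induction f)
  case (GGe k b f)
  have upd: "(\<lambda>_. \<tau> (\<not> b))(b := a) = \<tau>(b := a)" for a by (auto simp: fun_eq_iff)
  have "\<tau> (\<not> b) \<in> {1..n}" using GGe.prems(2) by (rule subsetD) simp
  then have "GGe k b f \<in> truth Q n \<omega> (\<tau> (\<not> b)) \<longleftrightarrow> gsat n \<omega> (\<lambda>_. \<tau> (\<not> b)) (GGe k b f)"
    using GGe.prems(1) unfolding truth_def by auto
  then show ?case by (simp add: upd)
qed auto

lemma consistent_truth:
  assumes "Q = quants \<phi>"
  shows "consistent Q n \<omega> (truth Q n \<omega>)"
  unfolding consistent_def
proof (intro ballI)
  fix i q assume i: "i \<in> {1..n}" and q: "q \<in> Q"
  obtain k b f where qf: "q = GGe k b f" using q assms quants_GGe by blast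
  have "quants f \<subseteq> Q" using q assms quants_trans unfolding qf by blast
  then have "{a \<in> {1..n}. holds \<omega> (truth Q n \<omega>) i a q} = {a \<in> {1..n}. gsat n \<omega> ((\<lambda>_. i)(b := a)) f}"
    unfolding qf holds.simps using i by (intro Collect_cong conj_cong refl lev_truth) auto
  then show "q \<in> truth Q n \<omega> i \<longleftrightarrow> bound q \<le> card {a \<in> {1..n}. holds \<omega> (truth Q n \<omega>) i a q}"
    using i q by (simp add: truth_def qf)
qed

text \<open>The true guess is the only consistent one, so summing over guesses counts each model
  once.\<close>

lemma sum_consistent:
  assumes Q: "Q = quants \<phi>"
  shows "(\<Sum>\<beta>\<in>{1..n} \<rightarrow>\<^sub>E Pow Q. if consistent Q n \<omega> \<beta> \<and> (\<forall>i\<in>{1..n}. lev \<omega> \<beta> (\<lambda>_. i) \<phi>) then 1 else 0 :: real) =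
    (if gmodels \<phi> n \<omega> then 1 else 0)"
proof -
  have fin: "finite ({1..n} \<rightarrow>\<^sub>E Pow Q)" using finite_quants Q by (intro finite_PiE) auto
  have mem: "truth Q n \<omega> \<in> {1..n} \<rightarrow>\<^sub>E Pow Q" by (auto simp: truth_def PiE_def extensional_def)
  have "(consistent Q n \<omega> \<beta> \<and> (\<forall>i\<in>{1..n}. lev \<omega> \<beta> (\<lambda>_. i) \<phi>)) \<longleftrightarrow> \<beta> = truth Q n \<omega> \<and> gmodels \<phi> n \<omega>"
    if "\<beta> \<in> {1..n} \<rightarrow>\<^sub>E Pow Q" for \<beta>
  proof (cases "\<beta> = truth Q n \<omega>")
    case True
    have "lev \<omega> (truth Q n \<omega>) (\<lambda>_. i) \<phi> \<longleftrightarrow> gsat n \<omega> (\<lambda>_. i) \<phi>" if "i \<in> {1..n}" for i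
      using that by (intro lev_truth) (auto simp: Q)
    then show ?thesis using True consistent_truth[OF Q] by (simp add: gmodels_def)
  next
    case False
    then show ?thesis using consistent_unique[OF _ Q that] by blast
  qed
  then have "(\<Sum>\<beta>\<in>{1..n} \<rightarrow>\<^sub>E Pow Q. if consistent Q n \<omega> \<beta> \<and> (\<forall>i\<in>{1..n}. lev \<omega> \<beta> (\<lambda>_. i) \<phi>) then 1 else 0 :: real) =
    (\<Sum>\<beta>\<in>{1..n} \<rightarrow>\<^sub>E Pow Q. if \<beta> = truth Q n \<omega> then (if gmodels \<phi> n \<omega> then 1 else 0) else 0)"
    by (intro sum.cong refl) auto
  then show ?thesis using fin mem by simp
qed

section \<open>Sums over subsets\<close>

lemma sum_Pow_Un:
  fixes f :: "'a set \<Rightarrow> real"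
  assumes "A \<inter> B = {}"
  shows "(\<Sum>\<omega>\<in>Pow (A \<union> B). f \<omega>) = (\<Sum>\<omega>\<in>Pow A. \<Sum>\<nu>\<in>Pow B. f (\<omega> \<union> \<nu>))"
proof -
  have "bij_betw (\<lambda>(\<omega>, \<nu>). \<omega> \<union> \<nu>) (Pow A \<times> Pow B) (Pow (A \<union> B))"
    by (rule bij_betw_byWitness[where f' = "\<lambda>\<omega>. (\<omega> \<inter> A, \<omega> \<inter> B)"]) (use assms in auto)
  from sum.reindex_bij_betw[OF this, of f] show ?thesis
    by (simp add: sum.cartesian_product case_prod_unfold)
qed

lemma sum_Pow_image:
  fixes f :: "'b set \<Rightarrow> real"
  assumes "inj_on h A"
  shows "(\<Sum>\<omega>\<in>Pow (h ` A). f \<omega>) = (\<Sum>\<omega>\<in>Pow A. f (h ` \<omega>))"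
  using sum.reindex_bij_betw[OF bij_betw_Pow[OF inj_on_imp_bij_betw[OF assms]], of f] by simp

text \<open>Weights belong to atoms rather than predicates, so that the order can be fixed by
  weights 0 and 1.\<close>

definition set_weight :: "('a \<Rightarrow> real) \<Rightarrow> ('a \<Rightarrow> real) \<Rightarrow> 'a set \<Rightarrow> 'a set \<Rightarrow> real" where
  "set_weight W1 W0 A \<omega> = (\<Prod>l\<in>\<omega>. W1 l) * (\<Prod>l\<in>A - \<omega>. W0 l)"

abbreviation pred_weight :: "('p \<Rightarrow> real) \<Rightarrow> ('p \<Rightarrow> real) \<Rightarrow> 'p world \<Rightarrow> 'p world \<Rightarrow> real" where
  "pred_weight w wbar \<equiv> set_weight (\<lambda>l. w (fst l)) (\<lambda>l. wbar (fst l))"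

lemma set_weight_Un:
  assumes "finite A" "finite B" "A \<inter> B = {}" "\<omega> \<subseteq> A" "\<nu> \<subseteq> B"
  shows "set_weight W1 W0 (A \<union> B) (\<omega> \<union> \<nu>) = set_weight W1 W0 A \<omega> * set_weight W1 W0 B \<nu>"
proof -
  have "A \<union> B - (\<omega> \<union> \<nu>) = (A - \<omega>) \<union> (B - \<nu>)" using assms by auto
  moreover have "(\<Prod>l\<in>\<omega> \<union> \<nu>. W1 l) = (\<Prod>l\<in>\<omega>. W1 l) * (\<Prod>l\<in>\<nu>. W1 l)"
    using assms by (intro prod.union_disjoint) (auto intro: finite_subset)
  moreover have "(\<Prod>l\<in>(A - \<omega>) \<union> (B - \<nu>). W0 l) = (\<Prod>l\<in>A - \<omega>. W0 l) * (\<Prod>l\<in>B - \<nu>. W0 l)"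
    using assms by (intro prod.union_disjoint) auto
  ultimately show ?thesis by (simp add: set_weight_def)
qed

lemma set_weight_image:
  assumes "inj_on h A" "\<omega> \<subseteq> A" "\<And>l. l \<in> A \<Longrightarrow> W1 (h l) = W1' l \<and> W0 (h l) = W0' l"
  shows "set_weight W1 W0 (h ` A) (h ` \<omega>) = set_weight W1' W0' A \<omega>"
proof -
  have inj: "inj_on h \<omega>" "inj_on h (A - \<omega>)" using assms(1,2) by (auto intro: inj_on_subset)
  have "h ` A - h ` \<omega> = h ` (A - \<omega>)" using assms(1,2) by (auto simp: inj_on_def)
  then show ?thesis unfolding set_weight_def using assms
    by (simp add: prod.reindex[OF inj(1)] prod.reindex[OF inj(2)] subset_iff cong: prod.cong)
      (metis (no_types, lifting) DiffD1 prod.cong subsetD)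
qed

lemma sum_set_weight:
  assumes "finite A"
  shows "(\<Sum>\<omega>\<in>Pow A. set_weight W1 W0 A \<omega>) = (\<Prod>l\<in>A. W1 l + W0 l)"
  unfolding set_weight_def prod_add[OF assms] ..

text \<open>\<open>ini\<close> and \<open>tr\<close> of an insertion process are lists; this
  enumerates, in an arbitrary order, the finite sets they come from.\<close>

definition listing :: "'a set \<Rightarrow> 'a list" where
  "listing A = (SOME xs. distinct xs \<and> set xs = A)"

lemma listing: "finite A \<Longrightarrow> distinct (listing A) \<and> set (listing A) = A"
  unfolding listing_def using finite_distinct_list[of A] by (metis (mono_tags, lifting) someI_ex)

lemma sum_listing: "finite A \<Longrightarrow> (\<Sum>x\<leftarrow>listing A. f x) = (sum f A :: real)"
  using listing[of A] sum_list_distinct_conv_sum_set[of "listing A" f] by simp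

section \<open>The element-by-element recursion\<close>

definition ren :: "(nat \<Rightarrow> nat) \<Rightarrow> 'p ground_atom \<Rightarrow> 'p ground_atom" where
  "ren h l = (fst l, map h (snd l))"

type_synonym 'p estate = "('p world \<times> 'p gf set) \<times> ('p gf \<Rightarrow> nat)"

text \<open>\<open>W_ren\<close> says that a template atom over 1 and 2 keeps its weights when it is
  moved to any increasing pair. Weights may thus distinguish (1, 2) from (2, 1), as those of the
  order do.\<close>

locale recursion =
  fixes P :: "'p set" and ar :: "'p \<Rightarrow> nat" and W1 W0 :: "'p ground_atom \<Rightarrow> real" and \<phi> :: "'p gf"
  assumes finite_P: "finite P"
    and W_ren: "\<And>h l. set (snd l) \<subseteq> {1, 2} \<Longrightarrow> strict_mono_on (set (snd l)) h \<Longrightarrow>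
      W1 (ren h l) = W1 l \<and> W0 (ren h l) = W0 l"
begin

abbreviation Q :: "'p gf set" where "Q \<equiv> quants \<phi>"

definition cap :: nat where "cap = Max (insert 0 (bound ` Q))"

lemma bound_le_cap: "q \<in> Q \<Longrightarrow> bound q \<le> cap"
  unfolding cap_def using finite_quants by (intro Max_ge) auto

text \<open>The argument set is exactly \<open>V\<close>, so that different \<open>V\<close> give
  disjoint sets of atoms: \<open>atoms {}\<close> is the nullary part, singletons carry the 1-types
  and two-element sets the 2-tables, whatever the arities.\<close>

definition atoms :: "nat set \<Rightarrow> 'p ground_atom set" where
  "atoms V = {(p, ts). p \<in> P \<and> length ts = ar p \<and> set ts = V}"

lemma finite_atoms: "finite V \<Longrightarrow> finite (atoms V)"
proof -
  assume "finite V"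
  then have "finite (SIGMA p:P. {ts. set ts \<subseteq> V \<and> length ts = ar p})"
    using finite_P by (intro finite_SigmaI finite_lists_length_eq)
  then show ?thesis by (rule finite_subset[rotated]) (auto simp: atoms_def)
qed

lemma atoms_disjoint: "V \<noteq> V' \<Longrightarrow> atoms V \<inter> atoms V' = {}"
  by (auto simp: atoms_def)

lemma snd_atoms: "l \<in> atoms V \<Longrightarrow> set (snd l) = V"
  by (auto simp: atoms_def)

lemma image_ren_atoms:
  assumes "inj_on h V"
  shows "ren h ` atoms V = atoms (h ` V)" "inj_on (ren h) (atoms V)"
proof -
  define h' where "h' = inv_into V h"
  have h': "x \<in> V \<Longrightarrow> h' (h x) = x" "y \<in> h ` V \<Longrightarrow> h (h' y) = y \<and> h' y \<in> V" for x y
    using assms by (auto simp: h'_def f_inv_into_f inv_into_into)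
  show "ren h ` atoms V = atoms (h ` V)"
  proof
    show "ren h ` atoms V \<subseteq> atoms (h ` V)" by (auto simp: ren_def atoms_def)
    show "atoms (h ` V) \<subseteq> ren h ` atoms V"
    proof
      fix l assume l: "l \<in> atoms (h ` V)"
      then have "set (snd l) = h ` V" by (rule snd_atoms)
      then have "map (h \<circ> h') (snd l) = snd l" using h'(2) by (intro map_idI) simp
      moreover have "h' ` set (snd l) = V" unfolding \<open>set (snd l) = h ` V\<close> using h'(1) by (simp add: image_image)
      ultimately have "l = ren h (ren h' l)" "ren h' l \<in> atoms V"
        using l by (simp_all add: ren_def atoms_def case_prod_unfold)
      then show "l \<in> ren h ` atoms V" by blast
    qed
  qed
  have "ren h' (ren h l) = l" if "l \<in> atoms V" for l
  proof -
    have "map (h' \<circ> h) (snd l) = snd l" using h'(1) snd_atoms[OF that] by (intro map_idI) auto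
    then show ?thesis by (simp add: ren_def)
  qed
  then show "inj_on (ren h) (atoms V)" by (rule inj_on_inverseI)
qed

abbreviation wt :: "'p ground_atom set \<Rightarrow> 'p world \<Rightarrow> real" where
  "wt \<equiv> set_weight W1 W0"

lemma wt_ren:
  assumes "V \<subseteq> {1, 2}" "strict_mono_on V h" "\<omega> \<subseteq> atoms V"
  shows "wt (atoms (h ` V)) (ren h ` \<omega>) = wt (atoms V) \<omega>"
proof -
  have inj: "inj_on h V" using assms(2) by (rule strict_mono_on_imp_inj_on)
  show ?thesis
    unfolding image_ren_atoms(1)[OF inj, symmetric]
  proof (rule set_weight_image[OF image_ren_atoms(2)[OF inj] assms(3)])
    fix l assume "l \<in> atoms V"
    then show "W1 (ren h l) = W1 l \<and> W0 (ren h l) = W0 l"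
      using assms(1,2) by (intro W_ren) (auto simp: snd_atoms)
  qed
qed

text \<open>The 1-type of \<open>i\<close>, written at the template element 1 so that different
  elements can share a state.\<close>

definition unary :: "'p world \<Rightarrow> nat \<Rightarrow> 'p world" where
  "unary \<omega> i = {l \<in> atoms {1}. ren (\<lambda>_. i) l \<in> \<omega>}"

text \<open>\<open>X\<close> is the set of partners met so far. The value 0 outside \<open>Q\<close>
  keeps the set of possible counters finite.\<close>

definition counter :: "'p world \<Rightarrow> (nat \<Rightarrow> 'p gf set) \<Rightarrow> nat set \<Rightarrow> nat \<Rightarrow> 'p gf \<Rightarrow> nat" where
  "counter \<omega> \<beta> X i = (\<lambda>q. if q \<in> Q then min cap (card {a \<in> X. holds \<omega> \<beta> i a q}) else 0)"

definition state :: "'p world \<Rightarrow> (nat \<Rightarrow> 'p gf set) \<Rightarrow> nat set \<Rightarrow> nat \<Rightarrow> 'p estate" where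
  "state \<omega> \<beta> X i = ((unary \<omega> i, \<beta> i), counter \<omega> \<beta> X i)"

definition bump :: "('p gf \<Rightarrow> nat) \<Rightarrow> 'p gf set \<Rightarrow> 'p gf \<Rightarrow> nat" where
  "bump c X = (\<lambda>q. if q \<in> X \<inter> Q then min cap (Suc (c q)) else c q)"

lemma bump_commute: "bump (bump c X) Y = bump (bump c Y) X"
  by (auto simp: bump_def fun_eq_iff)

lemma counter_insert:
  assumes "finite X" "a \<notin> X"
  shows "counter \<omega> \<beta> (insert a X) i = bump (counter \<omega> \<beta> X i) {q. holds \<omega> \<beta> i a q}"
proof
  fix q
  have "{x \<in> insert a X. holds \<omega> \<beta> i x q} =
    (if holds \<omega> \<beta> i a q then insert a {x \<in> X. holds \<omega> \<beta> i x q} else {x \<in> X. holds \<omega> \<beta> i x q})" by auto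
  then show "counter \<omega> \<beta> (insert a X) i q = bump (counter \<omega> \<beta> X i) {q. holds \<omega> \<beta> i a q} q"
    using assms by (auto simp: counter_def bump_def)
qed

text \<open>The state of \<open>i\<close> relative to \<open>X\<close> involves only atoms over
  \<open>i\<close> and at most one further element, taken from \<open>X\<close>; a change elsewhere
  in the world does not affect it.\<close>

lemma state_cong:
  assumes "\<And>a l. a \<in> insert i X \<Longrightarrow> set (snd l) \<subseteq> {i, a} \<Longrightarrow> l \<in> \<omega> \<longleftrightarrow> l \<in> \<omega>'"
    and "\<And>a. a \<in> insert i X \<Longrightarrow> \<beta> a = \<beta>' a"
  shows "state \<omega> \<beta> X i = state \<omega>' \<beta>' X i"
proof -
  have "ren (\<lambda>_. i) l \<in> \<omega> \<longleftrightarrow> ren (\<lambda>_. i) l \<in> \<omega>'" for l :: "'p ground_atom"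
    by (rule assms(1)[of i]) (auto simp: ren_def)
  then have "unary \<omega> i = unary \<omega>' i" by (simp add: unary_def)
  moreover have "holds \<omega> \<beta> i a q \<longleftrightarrow> holds \<omega>' \<beta>' i a q" if "a \<in> X" for a q
    using holds_cong[of i a \<omega> "\<lambda>x. x" \<omega>' \<beta> \<beta>' q] assms(1)[of a] assms(2) that by auto
  then have "{a \<in> X. holds \<omega> \<beta> i a q} = {a \<in> X. holds \<omega>' \<beta>' i a q}" for q by blast
  then have "counter \<omega> \<beta> X i = counter \<omega>' \<beta>' X i" unfolding counter_def by presburger
  ultimately show ?thesis using assms(2)[of i] by (simp add: state_def)
qed

text \<open>A world on two elements, rebuilt from its nullary part, the two 1-types and the 2-table.\<close>

definition pair_world :: "'p world \<Rightarrow> 'p world \<Rightarrow> 'p world \<Rightarrow> 'p world \<Rightarrow> 'p world" where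
  "pair_world g u u' \<epsilon> = g \<union> u \<union> ren (\<lambda>_. 2) ` u' \<union> \<epsilon>"

definition pair_guess :: "'p gf set \<Rightarrow> 'p gf set \<Rightarrow> nat \<Rightarrow> 'p gf set" where
  "pair_guess b b' k = (if k = 1 then b else b')"

text \<open>The first state is that of the new element, which plays 2, while the old one plays 1:
  the renaming to the actual pair is then increasing.\<close>

definition update :: "'p world \<Rightarrow> 'p world \<Rightarrow> 'p estate \<Rightarrow> 'p estate \<Rightarrow> 'p estate \<times> 'p estate" where
  "update g \<epsilon> = (\<lambda>((u', b'), c') ((u, b), c).
     (((u', b'), bump c' {q. holds (pair_world g u u' \<epsilon>) (pair_guess b b') 2 1 q}),
      ((u, b), bump c {q. holds (pair_world g u u' \<epsilon>) (pair_guess b b') 1 2 q})))"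

definition transitions :: "'p world \<Rightarrow> 'p estate \<Rightarrow> 'p estate \<Rightarrow> (real \<times> 'p estate \<times> 'p estate) list" where
  "transitions g t s = map (\<lambda>\<epsilon>. (wt (atoms {1, 2}) \<epsilon>, update g \<epsilon> t s)) (listing (Pow (atoms {1, 2})))"

text \<open>A new element starts out having met itself, as a bound variable may take the value of
  the free one.\<close>

definition fresh :: "'p world \<Rightarrow> 'p world \<Rightarrow> 'p gf set \<Rightarrow> 'p estate" where
  "fresh g u b = ((u, b), bump (\<lambda>_. 0) {q. holds (g \<union> u) (\<lambda>_. b) 1 1 q})"

definition initials :: "'p world \<Rightarrow> (real \<times> 'p estate) list" where
  "initials g = map (\<lambda>(u, b). (wt (atoms {1}) u, fresh g u b)) (listing (Pow (atoms {1}) \<times> Pow Q))"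

abbreviation att :: "'p world \<Rightarrow> ('p estate list \<Rightarrow> real) \<Rightarrow> 'p estate list \<Rightarrow> 'p estate \<Rightarrow> 'p estate list \<Rightarrow> real" where
  "att g \<equiv> attach (transitions g)"

abbreviation ext :: "'p world \<Rightarrow> ('p estate list \<Rightarrow> real) \<Rightarrow> 'p estate list \<Rightarrow> real" where
  "ext g \<equiv> extend (initials g) (transitions g)"

abbreviation states :: "'p world \<Rightarrow> (nat \<Rightarrow> 'p gf set) \<Rightarrow> nat \<Rightarrow> 'p estate list" where
  "states \<omega> \<beta> n \<equiv> map (state \<omega> \<beta> {1..n}) [1..<Suc n]"

lemma attach_transitions:
  "att g F (s # L) t N = (\<Sum>\<epsilon>\<in>Pow (atoms {1, 2}). wt (atoms {1, 2}) \<epsilon> *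
     att g F L (fst (update g \<epsilon> t s)) (N @ [snd (update g \<epsilon> t s)]))"
proof -
  have "att g F (s # L) t N = (\<Sum>\<epsilon>\<leftarrow>listing (Pow (atoms {1, 2})). wt (atoms {1, 2}) \<epsilon> *
     att g F L (fst (update g \<epsilon> t s)) (N @ [snd (update g \<epsilon> t s)]))"
    unfolding attach.simps by (simp only: transitions_def[of g t s] map_map o_def case_prod_unfold fst_conv snd_conv)
  then show ?thesis by (simp add: sum_listing finite_atoms)
qed

lemma extend_initials:
  "ext g F L = (\<Sum>u\<in>Pow (atoms {1}). \<Sum>b\<in>Pow Q. wt (atoms {1}) u *
     att g F L (fresh g u b) [])"
proof -
  have "ext g F L = (\<Sum>x\<leftarrow>listing (Pow (atoms {1}) \<times> Pow Q). wt (atoms {1}) (fst x) *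
     att g F L (fresh g (fst x) (snd x)) [])"
    unfolding extend_def initials_def by (simp add: o_def case_prod_unfold)
  then show ?thesis
    by (simp add: sum_listing finite_atoms finite_quants sum.cartesian_product case_prod_unfold)
qed

text \<open>A meeting reads 1-types and guesses, which never change, and alters only counters by
  bumps, which commute. So for each choice of the two 2-tables both orders lead to the same
  states.\<close>

lemma commuting_transitions: "commuting (transitions g)"
  unfolding commuting_def
proof (intro allI)
  fix t a b :: "'p estate" and \<Phi>
  let ?E = "Pow (atoms {1, 2})" and ?w = "wt (atoms {1, 2})"
  have fst_fst: "fst (fst (update g \<epsilon> x y)) = fst x" for \<epsilon> x y
    by (auto simp: update_def split: prod.split)
  have snd_upd: "snd (update g \<epsilon> x y) = snd (update g \<epsilon> x' y)" if "fst x = fst x'" for \<epsilon> x x' y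
    using that by (auto simp: update_def split: prod.split)
  have comm: "fst (update g \<epsilon>' (fst (update g \<epsilon> t x)) y) = fst (update g \<epsilon> (fst (update g \<epsilon>' t y)) x)" for \<epsilon> \<epsilon>' x y
    by (auto simp: update_def bump_commute split: prod.split)
  have expand: "(\<Sum>(r, t', a')\<leftarrow>transitions g t x. \<Sum>(r', t'', b')\<leftarrow>transitions g t' y. r * r' * \<Psi> t'' a' b') =
    (\<Sum>\<epsilon>\<in>?E. \<Sum>\<epsilon>'\<in>?E. ?w \<epsilon> * ?w \<epsilon>' * \<Psi> (fst (update g \<epsilon>' (fst (update g \<epsilon> t x)) y)) (snd (update g \<epsilon> t x))
       (snd (update g \<epsilon>' t y)))" for x y \<Psi>
  proof -
    have "snd (update g \<epsilon>' (fst (update g \<epsilon> t x)) y) = snd (update g \<epsilon>' t y)" for \<epsilon> \<epsilon>'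
      by (rule snd_upd) (rule fst_fst)
    then show ?thesis
      by (simp add: transitions_def o_def case_prod_unfold sum_listing finite_atoms)
  qed
  show "(\<Sum>(r, t', a')\<leftarrow>transitions g t a. \<Sum>(r', t'', b')\<leftarrow>transitions g t' b. r * r' * \<Phi> t'' a' b') =
     (\<Sum>(r, t', b')\<leftarrow>transitions g t b. \<Sum>(r', t'', a')\<leftarrow>transitions g t' a. r * r' * \<Phi> t'' a' b')"
    unfolding expand[where x = a and y = b and \<Psi> = \<Phi>] expand[where x = b and y = a and \<Psi> = "\<lambda>t a b. \<Phi> t b a"]
    by (subst sum.swap) (simp add: comm[of _ _ b] mult.commute)
qed

definition estates :: "'p estate set" where
  "estates = (Pow (atoms {1}) \<times> Pow Q) \<times> {c. \<forall>q. if q \<in> Q then c q \<le> cap else c q = 0}"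

lemma finite_estates: "finite estates"
proof -
  have "{c. \<forall>q. if q \<in> Q then c q \<le> cap else c q = 0} =
      {c. \<forall>q. (q \<in> Q \<longrightarrow> c q \<in> {..cap}) \<and> (q \<notin> Q \<longrightarrow> c q = 0)}" by auto
  also have "finite \<dots>" using finite_quants by (intro finite_set_of_finite_funs) auto
  finally show ?thesis unfolding estates_def by (intro finite_cartesian_product) (auto simp: finite_quants finite_atoms)
qed

lemma bump_bounded: "\<forall>q. if q \<in> Q then c q \<le> cap else c q = 0 \<Longrightarrow>
    \<forall>q. if q \<in> Q then bump c X q \<le> cap else bump c X q = 0"
  by (auto simp: bump_def)

lemma initials_in: "(r, t) \<in> set (initials g) \<Longrightarrow> t \<in> estates \<and> r \<in> wt (atoms {1}) ` Pow (atoms {1})"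
  using listing[of "Pow (atoms {1}) \<times> Pow Q"] bump_bounded[of "\<lambda>_. 0"]
  by (auto simp: initials_def fresh_def estates_def finite_atoms finite_quants)

lemma transitions_in:
  assumes "t \<in> estates" "s \<in> estates" "(r, t', s') \<in> set (transitions g t s)"
  shows "t' \<in> estates \<and> s' \<in> estates \<and> r \<in> wt (atoms {1, 2}) ` Pow (atoms {1, 2})"
proof -
  obtain \<epsilon> where "\<epsilon> \<subseteq> atoms {1, 2}" "r = wt (atoms {1, 2}) \<epsilon>" "(t', s') = update g \<epsilon> t s"
    using assms(3) listing[of "Pow (atoms {1, 2})"] by (auto simp: transitions_def finite_atoms)
  then show ?thesis
    using assms(1,2) bump_bounded by (auto simp: update_def estates_def split: prod.splits)
qed

definition wf_world :: "'p world \<Rightarrow> bool" where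
  "wf_world \<Omega> \<longleftrightarrow> (\<forall>l\<in>\<Omega>. l \<in> atoms (set (snd l)))"

lemma wf_worldD: "wf_world \<Omega> \<Longrightarrow> (p, ts) \<in> \<Omega> \<Longrightarrow> p \<in> P \<and> length ts = ar p"
  by (auto simp: wf_world_def atoms_def)

lemma wf_world_Un: "wf_world (\<omega> \<union> \<nu>) \<longleftrightarrow> wf_world \<omega> \<and> wf_world \<nu>"
  by (auto simp: wf_world_def)

lemma wf_world_atoms: "\<omega> \<subseteq> atoms V \<Longrightarrow> wf_world \<omega>"
  unfolding wf_world_def by (auto simp: atoms_def)

text \<open>An atom over the template pair uses neither element, only 1, only 2, or both; each case
  is answered by one of the four components.\<close>

lemma pair_world_iff:
  assumes \<Omega>: "wf_world \<Omega>" and ts: "set ts \<subseteq> {1, 2}"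
    and h: "h = (\<lambda>k. if k = 1 then i else j)"
  shows "(p, ts) \<in> pair_world (\<Omega> \<inter> atoms {}) (unary \<Omega> i) (unary \<Omega> j) {l \<in> atoms {1, 2}. ren h l \<in> \<Omega>}
    \<longleftrightarrow> (p, map h ts) \<in> \<Omega>"
    (is "_ \<in> ?L \<longleftrightarrow> _")
proof
  have const: "map f xs = map (\<lambda>_. f a) xs" if "set xs \<subseteq> {a}" for f :: "nat \<Rightarrow> nat" and a xs
    using that by auto
  {
    assume "(p, ts) \<in> ?L"
    then consider "ts = []" "(p, ts) \<in> \<Omega>" | "(p, ts) \<in> unary \<Omega> i"
      | l where "l \<in> unary \<Omega> j" "(p, ts) = ren (\<lambda>_. 2) l"
      | "(p, map h ts) \<in> \<Omega>"
      by (auto simp: pair_world_def atoms_def ren_def)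
    then show "(p, map h ts) \<in> \<Omega>"
    proof cases
      case 2
      then have "set ts \<subseteq> {1}" "(p, map (\<lambda>_. i) ts) \<in> \<Omega>" by (auto simp: unary_def atoms_def ren_def)
      moreover have "h 1 = i" by (simp add: h)
      ultimately show ?thesis using const[of ts 1 h] by metis
    next
      case 3
      then show ?thesis by (auto simp: unary_def ren_def h o_def)
    qed auto
  }
  {
    assume in_\<Omega>: "(p, map h ts) \<in> \<Omega>"
    then have p: "p \<in> P" "length ts = ar p" using wf_worldD[OF \<Omega> in_\<Omega>] by auto
    from ts have "set ts \<in> Pow {1, 2}" by blast
    then have "set ts = {} \<or> set ts = {1} \<or> set ts = {2} \<or> set ts = {1, 2}"
      by (auto simp: Pow_insert)
    then consider "set ts = {}" | "set ts = {1}" | "set ts = {2}" | "set ts = {1, 2}" by blast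
    then show "(p, ts) \<in> ?L"
    proof cases
      case 1
      then show ?thesis using in_\<Omega> p by (auto simp: pair_world_def atoms_def)
    next
      case 2
      moreover have "h 1 = i" by (simp add: h)
      ultimately have "(p, map (\<lambda>_. i) ts) \<in> \<Omega>" using const[of ts 1 h] in_\<Omega> by (metis order_refl)
      then show ?thesis using 2 p by (simp add: pair_world_def unary_def atoms_def ren_def)
    next
      case 3
      moreover have "h 2 = j" by (simp add: h)
      ultimately have "(p, map (\<lambda>_. j) ts) \<in> \<Omega>" using const[of ts 2 h] in_\<Omega> by (metis order_refl)
      moreover have "map (\<lambda>_. 2) ts = ts" using 3 by (intro map_idI) auto
      moreover have "set (map (\<lambda>_. 1 :: nat) ts) = {1}" using 3 by auto
      ultimately have "(p, map (\<lambda>_. 1) ts) \<in> unary \<Omega> j" "(p, ts) = ren (\<lambda>_. 2) (p, map (\<lambda>_. 1 :: nat) ts)"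
        using p by (auto simp: unary_def atoms_def ren_def o_def)
      then show ?thesis unfolding pair_world_def by blast
    next
      case 4
      then show ?thesis using in_\<Omega> p by (simp add: pair_world_def atoms_def ren_def)
    qed
  }
qed

text \<open>Seen from a world, a meeting adds each of \<open>i\<close> and \<open>j\<close> to the
  set of partners counted by the other.\<close>

lemma update_state:
  assumes \<Omega>: "wf_world \<Omega>" and ij: "i \<noteq> j" and X: "finite X" "j \<notin> X" and Y: "finite Y" "i \<notin> Y"
    and h: "h = (\<lambda>k. if k = 1 then i else j)"
  shows "update (\<Omega> \<inter> atoms {}) {l \<in> atoms {1, 2}. ren h l \<in> \<Omega>} (state \<Omega> \<beta> Y j) (state \<Omega> \<beta> X i) =
    (state \<Omega> \<beta> (insert i Y) j, state \<Omega> \<beta> (insert j X) i)"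
proof -
  let ?L = "pair_world (\<Omega> \<inter> atoms {}) (unary \<Omega> i) (unary \<Omega> j) {l \<in> atoms {1, 2}. ren h l \<in> \<Omega>}"
  have "holds ?L (pair_guess (\<beta> i) (\<beta> j)) x y q \<longleftrightarrow> holds \<Omega> \<beta> (h x) (h y) q" if "{x, y} = {1, 2}" for x y q
  proof (rule holds_cong)
    show "(p, ts) \<in> ?L \<longleftrightarrow> (p, map h ts) \<in> \<Omega>" if "set ts \<subseteq> {x, y}" for p ts
      using pair_world_iff[OF \<Omega> _ h] that \<open>{x, y} = {1, 2}\<close> by simp
  qed (use that ij in \<open>auto simp: h pair_guess_def doubleton_eq_iff\<close>)
  from this[of 1 2] this[of 2 1]
  have "holds ?L (pair_guess (\<beta> i) (\<beta> j)) 1 2 q \<longleftrightarrow> holds \<Omega> \<beta> i j q"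
    "holds ?L (pair_guess (\<beta> i) (\<beta> j)) 2 1 q \<longleftrightarrow> holds \<Omega> \<beta> j i q" for q
    by (auto simp: h)
  then have "{q. holds ?L (pair_guess (\<beta> i) (\<beta> j)) 1 2 q} = {q. holds \<Omega> \<beta> i j q}"
    "{q. holds ?L (pair_guess (\<beta> i) (\<beta> j)) 2 1 q} = {q. holds \<Omega> \<beta> j i q}" by blast+
  then show ?thesis
    unfolding update_def state_def counter_insert[OF X] counter_insert[OF Y] by (simp only: prod.case)
qed

lemma fresh_state:
  assumes \<Omega>: "wf_world \<Omega>"
  shows "fresh (\<Omega> \<inter> atoms {}) (unary \<Omega> j) (\<beta> j) = state \<Omega> \<beta> {j} j"
proof -
  let ?L = "(\<Omega> \<inter> atoms {}) \<union> unary \<Omega> j"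
  have "holds ?L (\<lambda>_. \<beta> j) 1 1 q \<longleftrightarrow> holds \<Omega> \<beta> ((\<lambda>_. j) 1) ((\<lambda>_. j) 1) q" for q
  proof (rule holds_cong)
    fix p and ts :: "nat list"
    assume ts: "set ts \<subseteq> {1, 1}"
    show "(p, ts) \<in> ?L \<longleftrightarrow> (p, map (\<lambda>_. j) ts) \<in> \<Omega>"
    proof (cases "ts = []")
      case True
      then show ?thesis using wf_worldD[OF \<Omega>, of p "[]"] by (auto simp: atoms_def unary_def)
    next
      case False
      then have "set ts = {1}" using ts by (cases ts) auto
      then show ?thesis using wf_worldD[OF \<Omega>, of p "map (\<lambda>_. j) ts"] False
        by (auto simp: atoms_def unary_def ren_def)
    qed
  qed auto
  moreover have "counter \<Omega> \<beta> {} j = (\<lambda>_. 0)" by (auto simp: counter_def fun_eq_iff)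
  ultimately show ?thesis
    using counter_insert[of "{}" j \<Omega> \<beta> j] by (simp add: fresh_def state_def)
qed

section \<open>Inserting an element into a world\<close>

definition pairs :: "nat \<Rightarrow> nat \<Rightarrow> 'p ground_atom set" where
  "pairs n k = (\<Union>i\<in>{k<..n}. atoms {i, Suc n})"

lemma finite_pairs: "finite (pairs n k)"
  by (auto simp: pairs_def finite_atoms)

lemma in_pairs:
  assumes "l \<in> pairs n k"
  shows "\<exists>i. k < i \<and> i \<le> n \<and> set (snd l) = {i, Suc n}"
proof -
  obtain i where "i \<in> {k<..n}" "l \<in> atoms {i, Suc n}" using assms unfolding pairs_def by blast
  then show ?thesis using snd_atoms[of l "{i, Suc n}"] by auto
qed

lemma nullary_pairs_disjoint: "atoms {} \<inter> pairs n k = {}"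
proof (rule equals0I)
  fix l assume l: "l \<in> atoms {} \<inter> pairs n k"
  then have "set (snd l) = {}" using snd_atoms by blast
  then show False using l in_pairs[of l n k] by auto
qed

text \<open>Snapshot when the new element \<open>Suc n\<close> has met the elements up to
  \<open>k\<close>: these already count it, the later ones do not, and it counts itself and those it
  has met. \<Omega> holds no atom over a pair still to be met, so each meeting chooses a 2-table
  freely.\<close>

lemma attach_world:
  "k \<le> n \<Longrightarrow> wf_world \<Omega> \<Longrightarrow> \<Omega> \<inter> atoms {} = g \<Longrightarrow> \<Omega> \<inter> pairs n k = {} \<Longrightarrow>
    att g F (map (state \<Omega> \<beta> {1..n}) [Suc k..<Suc n]) (state \<Omega> \<beta> (insert (Suc n) {1..k}) (Suc n))
      (map (state \<Omega> \<beta> {1..Suc n}) [1..<Suc k]) =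
    (\<Sum>\<nu>\<in>Pow (pairs n k). wt (pairs n k) \<nu> * F (states (\<Omega> \<union> \<nu>) \<beta> (Suc n)))"
proof (induction "n - k" arbitrary: k \<Omega>)
  case 0
  then have k: "k = n" by simp
  have "insert (Suc n) {1..n} = {1..Suc n}" by auto
  then show ?case by (simp add: k pairs_def set_weight_def)
next
  case (Suc c)
  define i j where "i = Suc k" and "j = Suc n"
  define h where "h = (\<lambda>k :: nat. if k = 1 then i else j)"
  have ij: "i < j" "i \<le> n" using Suc.hyps(2) by (auto simp: i_def j_def)
  have h12: "h ` {1, 2} = {i, j}" by (auto simp: h_def)
  \<comment> \<open>The old element is the smaller one, as the invariance of the weights
    requires.\<close>
  have mono: "strict_mono_on {1, 2} h" using ij by (auto simp: strict_mono_on_def h_def)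
  then have inj: "inj_on h {1, 2}" by (rule strict_mono_on_imp_inj_on)
  have pairs_k: "pairs n k = atoms {i, j} \<union> pairs n i"
  proof -
    have "{k<..n} = insert i {i<..n}" using ij by (auto simp: i_def)
    then show ?thesis by (simp add: pairs_def j_def)
  qed
  have disj: "atoms {i, j} \<inter> pairs n i = {}"
  proof (rule equals0I)
    fix l assume l: "l \<in> atoms {i, j} \<inter> pairs n i"
    then obtain x where x: "i < x" "x \<le> n" "set (snd l) = {x, j}" using in_pairs[of l n i] by (auto simp: j_def)
    moreover have "set (snd l) = {i, j}" using l snd_atoms by blast
    ultimately have "i \<in> {x, j}" by blast
    then show False using x(1) ij by simp
  qed
  have img: "ren h ` atoms {1, 2} = atoms {i, j}" using image_ren_atoms(1)[OF inj] h12 by simp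
  define G where "G \<Omega>' = F (states \<Omega>' \<beta> (Suc n))" for \<Omega>'
  define R where "R \<epsilon> = (\<Sum>\<nu>\<in>Pow (pairs n i). wt (pairs n i) \<nu> * G (\<Omega> \<union> \<epsilon> \<union> \<nu>))" for \<epsilon>
  have "att g F (map (state \<Omega> \<beta> {1..n}) [Suc i..<Suc n])
      (fst (update g \<epsilon> (state \<Omega> \<beta> (insert j {1..k}) j) (state \<Omega> \<beta> {1..n} i)))
      (map (state \<Omega> \<beta> {1..Suc n}) [1..<Suc k] @ [snd (update g \<epsilon> (state \<Omega> \<beta> (insert j {1..k}) j) (state \<Omega> \<beta> {1..n} i))])
      = R (ren h ` \<epsilon>)" if \<epsilon>: "\<epsilon> \<subseteq> atoms {1, 2}" for \<epsilon>
  proof -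
    define \<Omega>' where "\<Omega>' = \<Omega> \<union> ren h ` \<epsilon>"
    have sub: "ren h ` \<epsilon> \<subseteq> atoms {i, j}" using \<epsilon> img by blast
    have wf': "wf_world \<Omega>'"
      unfolding \<Omega>'_def wf_world_Un using Suc.prems(2) wf_world_atoms[OF sub] by blast
    have g': "\<Omega>' \<inter> atoms {} = g"
      using Suc.prems(3) sub atoms_disjoint[of "{i, j}" "{}"] by (auto simp: \<Omega>'_def)
    have "\<Omega>' \<inter> pairs n i = {}"
      using Suc.prems(4) sub disj pairs_k by (auto simp: \<Omega>'_def)
    moreover have "c = n - i" "i \<le> n" using Suc.hyps(2) ij by (auto simp: i_def)
    ultimately have IH: "att g F (map (state \<Omega>' \<beta> {1..n}) [Suc i..<Suc n])
       (state \<Omega>' \<beta> (insert j {1..i}) j) (map (state \<Omega>' \<beta> {1..Suc n}) [1..<Suc i]) = R (ren h ` \<epsilon>)"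
      unfolding R_def G_def \<Omega>'_def[symmetric] j_def using Suc.hyps(1)[OF _ _ wf' g'] by blast
    \<comment> \<open>The table just chosen can be read off the enlarged world, since \<Omega>
      contains no atom over both \<open>i\<close> and \<open>j\<close>.\<close>
    have eps: "{l \<in> atoms {1, 2}. ren h l \<in> \<Omega>'} = \<epsilon>"
    proof -
      have "ren h l \<notin> \<Omega>" if "l \<in> atoms {1, 2}" for l
        using that img Suc.prems(4) pairs_k by auto
      moreover have "ren h l \<in> ren h ` \<epsilon> \<longleftrightarrow> l \<in> \<epsilon>" if "l \<in> atoms {1, 2}" for l
        using inj_on_image_mem_iff[OF image_ren_atoms(2)[OF inj] that \<epsilon>] .
      ultimately have "ren h l \<in> \<Omega>' \<longleftrightarrow> l \<in> \<epsilon>" if "l \<in> atoms {1, 2}" for l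
        using that unfolding \<Omega>'_def Un_iff by simp
      then show ?thesis using \<epsilon> by blast
    qed
    have same: "l \<in> \<Omega> \<longleftrightarrow> l \<in> \<Omega>'" if "\<not> {i, j} \<subseteq> set (snd l)" for l
      using that sub snd_atoms[of l "{i, j}"] by (auto simp: \<Omega>'_def)
    \<comment> \<open>A state that does not involve \<open>i\<close> and \<open>j\<close> together
      cannot see the added atoms.\<close>
    have eqs: "state \<Omega> \<beta> X x = state \<Omega>' \<beta> X x" if "\<And>a. a \<in> insert x X \<Longrightarrow> \<not> {i, j} \<subseteq> {x, a}" for X x
    proof (rule state_cong)
      show "l \<in> \<Omega> \<longleftrightarrow> l \<in> \<Omega>'" if "a \<in> insert x X" "set (snd l) \<subseteq> {x, a}" for a and l :: "'p ground_atom"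
        using same[of l] that \<open>\<And>a. a \<in> insert x X \<Longrightarrow> \<not> {i, j} \<subseteq> {x, a}\<close> by blast
    qed simp
    have e1: "map (state \<Omega> \<beta> {1..n}) [Suc i..<Suc n] = map (state \<Omega>' \<beta> {1..n}) [Suc i..<Suc n]"
      by (intro map_cong refl eqs) (auto simp: j_def)
    have e2: "state \<Omega> \<beta> (insert j {1..k}) j = state \<Omega>' \<beta> (insert j {1..k}) j"
      using ij by (intro eqs) (auto simp: i_def)
    have e3: "state \<Omega> \<beta> {1..n} i = state \<Omega>' \<beta> {1..n} i"
      using ij by (intro eqs) (auto simp: j_def)
    have e4: "map (state \<Omega> \<beta> {1..Suc n}) [1..<Suc k] = map (state \<Omega>' \<beta> {1..Suc n}) [1..<Suc k]"
      using ij by (intro map_cong refl eqs) (auto simp: i_def)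
    have "update g \<epsilon> (state \<Omega>' \<beta> (insert j {1..k}) j) (state \<Omega>' \<beta> {1..n} i) =
        (state \<Omega>' \<beta> (insert i (insert j {1..k})) j, state \<Omega>' \<beta> (insert j {1..n}) i)"
      using update_state[OF wf', of i j "{1..n}" "insert j {1..k}" h \<beta>] ij
      unfolding eps g' by (simp add: h_def) (simp add: i_def j_def)
    moreover have "insert i (insert j {1..k}) = insert j {1..i}" "insert j {1..n} = {1..Suc n}"
      by (auto simp: i_def j_def)
    moreover have "map (state \<Omega>' \<beta> {1..Suc n}) [1..<Suc k] @ [state \<Omega>' \<beta> {1..Suc n} i] =
        map (state \<Omega>' \<beta> {1..Suc n}) [1..<Suc i]" by (simp add: i_def)
    ultimately show ?thesis unfolding e1 e2 e3 e4 by (simp only: fst_conv snd_conv IH)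
  qed
  then have "att g F (map (state \<Omega> \<beta> {1..n}) [Suc k..<Suc n]) (state \<Omega> \<beta> (insert (Suc n) {1..k}) (Suc n))
      (map (state \<Omega> \<beta> {1..Suc n}) [1..<Suc k]) = (\<Sum>\<epsilon>\<in>Pow (atoms {1, 2}). wt (atoms {1, 2}) \<epsilon> * R (ren h ` \<epsilon>))"
    using ij upt_conv_Cons[of i "Suc n"]
    by (simp add: attach_transitions flip: i_def j_def del: attach.simps(2))
  also have "\<dots> = (\<Sum>\<epsilon>\<in>Pow (atoms {1, 2}). wt (atoms {i, j}) (ren h ` \<epsilon>) * R (ren h ` \<epsilon>))"
    using wt_ren[OF subset_refl mono] unfolding h12 by (intro sum.cong) auto
  also have "\<dots> = (\<Sum>\<epsilon>\<in>Pow (atoms {i, j}). wt (atoms {i, j}) \<epsilon> * R \<epsilon>)"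
    using sum_Pow_image[OF image_ren_atoms(2)[OF inj], of "\<lambda>\<epsilon>. wt (atoms {i, j}) \<epsilon> * R \<epsilon>"] img by simp
  also have "\<dots> = (\<Sum>\<epsilon>\<in>Pow (atoms {i, j}). \<Sum>\<nu>\<in>Pow (pairs n i). wt (pairs n k) (\<epsilon> \<union> \<nu>) * G (\<Omega> \<union> (\<epsilon> \<union> \<nu>)))"
    unfolding R_def sum_distrib_left pairs_k
    by (intro sum.cong refl) (simp add: set_weight_Un finite_atoms finite_pairs disj Un_assoc)
  also have "\<dots> = (\<Sum>\<nu>\<in>Pow (pairs n k). wt (pairs n k) \<nu> * G (\<Omega> \<union> \<nu>))"
    unfolding pairs_k by (rule sum_Pow_Un[OF disj, symmetric])
  finally show ?case unfolding G_def .
qed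

definition small :: "nat \<Rightarrow> 'p ground_atom set" where
  "small n = (\<Union>V\<in>{V. V \<subseteq> {1..n} \<and> V \<noteq> {} \<and> card V \<le> 2}. atoms V)"

lemma finite_small: "finite (small n)"
proof -
  have "finite {V. V \<subseteq> {1..n} \<and> V \<noteq> {} \<and> card V \<le> 2}" by (rule finite_subset[of _ "Pow {1..n}"]) auto
  then show ?thesis unfolding small_def by (intro finite_UN_I) (auto intro: finite_atoms finite_subset)
qed

lemma in_small: "l \<in> small n \<longleftrightarrow> l \<in> atoms (set (snd l)) \<and> set (snd l) \<subseteq> {1..n} \<and> set (snd l) \<noteq> {} \<and> card (set (snd l)) \<le> 2"
  unfolding small_def by (auto dest: snd_atoms)

lemma small_nullary_disjoint: "small n \<inter> atoms {} = {}"
  using in_small[of _ n] snd_atoms[of _ "{}"] by blast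

lemma small_Suc: "small (Suc n) = small n \<union> (atoms {Suc n} \<union> pairs n 0)"
proof -
  have "{V. V \<subseteq> {1..Suc n} \<and> V \<noteq> {} \<and> card V \<le> 2} =
      {V. V \<subseteq> {1..n} \<and> V \<noteq> {} \<and> card V \<le> 2} \<union> ({{Suc n}} \<union> (\<lambda>i. {i, Suc n}) ` {0<..n})" (is "?A = ?B")
  proof
    show "?B \<subseteq> ?A" by (auto simp: card_insert_if)
    show "?A \<subseteq> ?B"
    proof
      fix V assume V: "V \<in> ?A"
      then have fin: "finite V" by (auto intro: finite_subset)
      show "V \<in> ?B"
      proof (cases "Suc n \<in> V")
        case False
        then have "V \<subseteq> {1..n}" using V by (auto simp: subset_iff le_Suc_eq) 
        then show ?thesis using V by blast
      next
        case True
        define V' where "V' = V - {Suc n}"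
        have V': "V = insert (Suc n) V'" "V' \<subseteq> {1..n}"
          using True V by (auto simp: V'_def subset_iff le_Suc_eq)
        have "card V' = card V - 1" using True by (simp add: V'_def)
        then have "card V' \<le> 1" using V by auto
        then have "V' = {} \<or> (\<exists>i. V' = {i})"
          using fin by (metis V'_def card_1_singletonE card_eq_0_iff finite_Diff le_0_eq le_SucE One_nat_def)
        then show ?thesis using V' by (auto simp: insert_commute)
      qed
    qed
  qed
  then show ?thesis unfolding small_def pairs_def by auto
qed

lemma small_disjoint: "small n \<inter> (atoms {Suc n} \<union> pairs n 0) = {}" "atoms {Suc n} \<inter> pairs n 0 = {}"
proof -
  have "Suc n \<in> set (snd l)" if "l \<in> atoms {Suc n} \<union> pairs n 0" for l
    using that in_pairs[of l n 0] snd_atoms[of l "{Suc n}"] by blast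
  moreover have "Suc n \<notin> set (snd l)" if "l \<in> small n" for l
    using that in_small[of l n] by auto
  ultimately show "small n \<inter> (atoms {Suc n} \<union> pairs n 0) = {}" by blast
  show "atoms {Suc n} \<inter> pairs n 0 = {}"
  proof (rule equals0I)
    fix l assume l: "l \<in> atoms {Suc n} \<inter> pairs n 0"
    then obtain i where i: "i \<le> n" "set (snd l) = {i, Suc n}" using in_pairs[of l n 0] by blast
    moreover have "set (snd l) = {Suc n}" using l snd_atoms by blast
    ultimately have "i \<in> {Suc n}" by blast
    then show False using i(1) by simp
  qed
qed

lemma sum_PiE_Suc:
  fixes f :: "(nat \<Rightarrow> 'b) \<Rightarrow> real"
  shows "(\<Sum>\<beta>\<in>{1..Suc n} \<rightarrow>\<^sub>E B. f \<beta>) = (\<Sum>\<beta>\<in>{1..n} \<rightarrow>\<^sub>E B. \<Sum>b\<in>B. f (\<beta>(Suc n := b)))"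
proof -
  have *: "{1..Suc n} = insert (Suc n) {1..n}" by auto
  have "(\<Sum>\<beta>\<in>{1..Suc n} \<rightarrow>\<^sub>E B. f \<beta>) = (\<Sum>(b, \<beta>)\<in>B \<times> ({1..n} \<rightarrow>\<^sub>E B). f (\<beta>(Suc n := b)))"
  proof -
    have "inj_on (\<lambda>(b, \<beta>). \<beta>(Suc n := b)) (B \<times> ({1..n} \<rightarrow>\<^sub>E B))"
      using inj_combinator[of "Suc n" "{1..n}" "\<lambda>_. B"] by simp
    from sum.reindex[OF this, of f] show ?thesis
      unfolding * PiE_insert_eq by (simp add: case_prod_unfold o_def)
  qed
  also have "\<dots> = (\<Sum>b\<in>B. \<Sum>\<beta>\<in>{1..n} \<rightarrow>\<^sub>E B. f (\<beta>(Suc n := b)))"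
    by (simp add: sum.cartesian_product)
  finally show ?thesis by (subst sum.swap)
qed

text \<open>The weighted sum for an arbitrary functional \<open>F\<close> of the list of final
  states; generality in \<open>F\<close> is what the recursion on \<open>n\<close> needs.\<close>

definition total :: "'p world \<Rightarrow> nat \<Rightarrow> ('p estate list \<Rightarrow> real) \<Rightarrow> real" where
  "total g n F = (\<Sum>\<omega>\<in>Pow (small n). \<Sum>\<beta>\<in>{1..n} \<rightarrow>\<^sub>E Pow Q.
     wt (small n) \<omega> * F (states (g \<union> \<omega>) \<beta> n))"

lemma wf_world_small: "\<omega> \<subseteq> small n \<Longrightarrow> wf_world \<omega>"
  unfolding wf_world_def using in_small by blast

text \<open>Choosing the 1-type and guess of the new element and then its 2-tables amounts to
  summing over the atoms that \<open>small (Suc n)\<close> has beyond \<open>small n\<close>, and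
  over the value of the guess at \<open>Suc n\<close>.\<close>

lemma extend_world:
  assumes g: "g \<subseteq> atoms {}" and \<omega>: "\<omega> \<subseteq> small n"
  shows "ext g F (states (g \<union> \<omega>) \<beta> n) =
    (\<Sum>\<mu>\<in>Pow (atoms {Suc n}). \<Sum>\<nu>\<in>Pow (pairs n 0). \<Sum>b\<in>Pow Q. wt (atoms {Suc n}) \<mu> * wt (pairs n 0) \<nu> *
      F (map (state (g \<union> \<omega> \<union> \<mu> \<union> \<nu>) (\<beta>(Suc n := b)) {1..Suc n}) [1..<Suc (Suc n)]))"
proof -
  define j where "j = Suc n"
  define H where "H \<mu> b = (\<Sum>\<nu>\<in>Pow (pairs n 0). wt (pairs n 0) \<nu> *
      F (states (g \<union> \<omega> \<union> \<mu> \<union> \<nu>) (\<beta>(j := b)) (Suc n)))" for \<mu> b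
  let ?h = "\<lambda>_ :: nat. j"
  have inj: "inj_on ?h {1}" by simp
  have img: "ren ?h ` atoms {1} = atoms {j}" using image_ren_atoms(1)[OF inj] by simp
  have attach: "att g F (states (g \<union> \<omega>) \<beta> n) (fresh g u b) [] = H (ren ?h ` u) b"
    if u: "u \<subseteq> atoms {1}" for u b
  proof -
    define \<Omega> where "\<Omega> = g \<union> \<omega> \<union> ren ?h ` u"
    define \<beta>' where "\<beta>' = \<beta>(j := b)"
    have sub: "ren ?h ` u \<subseteq> atoms {j}" using u img by blast
    have wf: "wf_world \<Omega>"
      unfolding \<Omega>_def wf_world_Un using wf_world_atoms[OF g] wf_world_atoms[OF sub] wf_world_small[OF \<omega>] by blast
    have g': "\<Omega> \<inter> atoms {} = g"
      using g \<omega> sub atoms_disjoint[of "{j}" "{}"] small_nullary_disjoint[of n] by (auto simp: \<Omega>_def)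
    have disj: "\<Omega> \<inter> pairs n 0 = {}"
      using g \<omega> sub nullary_pairs_disjoint[of n 0] small_disjoint[of n] by (auto simp: \<Omega>_def j_def)
    have not: "l \<notin> g \<union> \<omega>" if "l \<in> atoms {j}" for l
      using that g \<omega> atoms_disjoint[of "{j}" "{}"] small_disjoint[of n] by (auto simp: j_def)
    have "unary \<Omega> j = u"
    proof -
      have "ren ?h l \<in> \<Omega> \<longleftrightarrow> l \<in> u" if "l \<in> atoms {1}" for l
      proof -
        have "ren ?h l \<in> atoms {j}" using img that by blast
        then show ?thesis
          using not inj_on_image_mem_iff[OF image_ren_atoms(2)[OF inj] that u] unfolding \<Omega>_def by blast
      qed
      then show ?thesis using u by (auto simp: unary_def)
    qed
    then have fr: "fresh g u b = state \<Omega> \<beta>' (insert (Suc n) {1..0}) (Suc n)"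
      using fresh_state[OF wf, of j \<beta>'] g' by (simp add: \<beta>'_def j_def)
    have old: "states (g \<union> \<omega>) \<beta> n = map (state \<Omega> \<beta>' {1..n}) [Suc 0..<Suc n]"
    proof (simp only: One_nat_def, intro map_cong refl state_cong)
      fix x a and l :: "'p ground_atom"
      assume "x \<in> set [Suc 0..<Suc n]" "a \<in> insert x {Suc 0..n}" "set (snd l) \<subseteq> {x, a}"
      then have "j \<notin> set (snd l)" by (auto simp: j_def)
      then show "l \<in> g \<union> \<omega> \<longleftrightarrow> l \<in> \<Omega>" using sub snd_atoms[of l "{j}"] by (auto simp: \<Omega>_def)
    next
      fix x a assume "x \<in> set [Suc 0..<Suc n]" "a \<in> insert x {Suc 0..n}"
      then show "\<beta> a = \<beta>' a" by (auto simp: \<beta>'_def j_def)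
    qed
    show ?thesis
      unfolding H_def \<Omega>_def[symmetric] \<beta>'_def[symmetric] fr old
      using attach_world[OF _ wf g' disj, of F \<beta>'] by simp
  qed
  have "ext g F (states (g \<union> \<omega>) \<beta> n) =
    (\<Sum>u\<in>Pow (atoms {1}). \<Sum>b\<in>Pow Q. wt (atoms {j}) (ren ?h ` u) * H (ren ?h ` u) b)"
    unfolding extend_initials
  proof (intro sum.cong refl)
    fix u b assume "u \<in> Pow (atoms {1})"
    then show "wt (atoms {1}) u * att g F (states (g \<union> \<omega>) \<beta> n) (fresh g u b) [] =
       wt (atoms {j}) (ren ?h ` u) * H (ren ?h ` u) b"
      using wt_ren[of "{1}" ?h u] attach[of u b] by (simp add: strict_mono_on_def)
  qed
  also have "\<dots> = (\<Sum>\<mu>\<in>Pow (atoms {j}). \<Sum>b\<in>Pow Q. wt (atoms {j}) \<mu> * H \<mu> b)"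
    using sum_Pow_image[OF image_ren_atoms(2)[OF inj], of "\<lambda>\<mu>. \<Sum>b\<in>Pow Q. wt (atoms {j}) \<mu> * H \<mu> b"] img by simp
  also have "\<dots> = (\<Sum>\<mu>\<in>Pow (atoms {j}). \<Sum>\<nu>\<in>Pow (pairs n 0). \<Sum>b\<in>Pow Q. wt (atoms {j}) \<mu> * wt (pairs n 0) \<nu> *
      F (states (g \<union> \<omega> \<union> \<mu> \<union> \<nu>) (\<beta>(j := b)) (Suc n)))"
    unfolding H_def sum_distrib_left by (intro sum.cong refl, subst sum.swap) (simp only: mult.assoc)
  finally show ?thesis unfolding j_def .
qed

text \<open>The last element is absorbed into the functional: its atoms and its guess are summed by
  \<open>ext\<close>, which leaves a sum over the smaller domain.\<close>

lemma total_Suc: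
  assumes g: "g \<subseteq> atoms {}"
  shows "total g (Suc n) F = total g n (ext g F)"
proof -
  let ?F = "\<lambda>\<omega> \<beta>. F (states \<omega> \<beta> (Suc n))"
  have "total g (Suc n) F = (\<Sum>\<omega>\<in>Pow (small n). \<Sum>\<mu>\<in>Pow (atoms {Suc n}). \<Sum>\<nu>\<in>Pow (pairs n 0).
      \<Sum>\<beta>\<in>{1..n} \<rightarrow>\<^sub>E Pow Q. \<Sum>b\<in>Pow Q. wt (small (Suc n)) (\<omega> \<union> (\<mu> \<union> \<nu>)) * ?F (g \<union> (\<omega> \<union> (\<mu> \<union> \<nu>))) (\<beta>(Suc n := b)))"
    unfolding total_def sum_PiE_Suc small_Suc sum_Pow_Un[OF small_disjoint(1)] sum_Pow_Un[OF small_disjoint(2)] ..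
  also have "\<dots> = (\<Sum>\<omega>\<in>Pow (small n). \<Sum>\<mu>\<in>Pow (atoms {Suc n}). \<Sum>\<nu>\<in>Pow (pairs n 0).
      \<Sum>\<beta>\<in>{1..n} \<rightarrow>\<^sub>E Pow Q. \<Sum>b\<in>Pow Q. wt (small n) \<omega> * (wt (atoms {Suc n}) \<mu> * wt (pairs n 0) \<nu> *
        ?F (g \<union> \<omega> \<union> \<mu> \<union> \<nu>) (\<beta>(Suc n := b))))"
  proof (intro sum.cong refl)
    fix \<omega> \<mu> \<nu> \<beta> b
    assume a: "\<omega> \<in> Pow (small n)" "\<mu> \<in> Pow (atoms {Suc n})" "\<nu> \<in> Pow (pairs n 0)"
    have "wt (small (Suc n)) (\<omega> \<union> (\<mu> \<union> \<nu>)) = wt (small n) \<omega> * wt (atoms {Suc n} \<union> pairs n 0) (\<mu> \<union> \<nu>)"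
      unfolding small_Suc using a small_disjoint
      by (intro set_weight_Un) (auto simp: finite_small finite_atoms finite_pairs)
    also have "wt (atoms {Suc n} \<union> pairs n 0) (\<mu> \<union> \<nu>) = wt (atoms {Suc n}) \<mu> * wt (pairs n 0) \<nu>"
      using a small_disjoint by (intro set_weight_Un) (auto simp: finite_atoms finite_pairs)
    finally show "wt (small (Suc n)) (\<omega> \<union> (\<mu> \<union> \<nu>)) * ?F (g \<union> (\<omega> \<union> (\<mu> \<union> \<nu>))) (\<beta>(Suc n := b)) =
      wt (small n) \<omega> * (wt (atoms {Suc n}) \<mu> * wt (pairs n 0) \<nu> * ?F (g \<union> \<omega> \<union> \<mu> \<union> \<nu>) (\<beta>(Suc n := b)))"
      by (simp only: mult.assoc Un_assoc)
  qed
  also have "\<dots> = (\<Sum>\<omega>\<in>Pow (small n). \<Sum>\<beta>\<in>{1..n} \<rightarrow>\<^sub>E Pow Q. \<Sum>\<mu>\<in>Pow (atoms {Suc n}). \<Sum>\<nu>\<in>Pow (pairs n 0).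
      \<Sum>b\<in>Pow Q. wt (small n) \<omega> * (wt (atoms {Suc n}) \<mu> * wt (pairs n 0) \<nu> * ?F (g \<union> \<omega> \<union> \<mu> \<union> \<nu>) (\<beta>(Suc n := b))))"
    by (intro sum.cong refl) (simp only: sum.swap[of _ "{1..n} \<rightarrow>\<^sub>E Pow Q"])
  also have "\<dots> = total g n (ext g F)"
    unfolding total_def by (intro sum.cong refl) (simp only: extend_world[OF g] Pow_iff sum_distrib_left)
  finally show ?thesis .
qed

lemma total_eq_funpow:
  assumes "g \<subseteq> atoms {}"
  shows "total g n F = (ext g ^^ n) F []"
proof (induction n arbitrary: F)
  case 0
  have "small 0 = {}" by (auto simp: small_def)
  then show ?case by (simp add: total_def set_weight_def)
next
  case (Suc n)
  then show ?case by (simp add: total_Suc[OF assms] funpow_swap1)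
qed

text \<open>The final test of one element. A capped counter decides \<open>bound q \<le> c q\<close>
  as the true count does, since the cap is at least every bound.\<close>

definition acc :: "'p world \<Rightarrow> 'p estate \<Rightarrow> bool" where
  "acc g = (\<lambda>((u, b), c). (\<forall>q\<in>Q. q \<in> b \<longleftrightarrow> bound q \<le> c q) \<and> lev (g \<union> u) (\<lambda>_. b) (\<lambda>_. 1) \<phi>)"

lemma acc_state:
  assumes \<Omega>: "wf_world \<Omega>"
  shows "acc (\<Omega> \<inter> atoms {}) (state \<Omega> \<beta> {1..n} i) \<longleftrightarrow>
    (\<forall>q\<in>Q. q \<in> \<beta> i \<longleftrightarrow> bound q \<le> card {a \<in> {1..n}. holds \<Omega> \<beta> i a q}) \<and> lev \<Omega> \<beta> (\<lambda>_. i) \<phi>"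
proof -
  have "lev (\<Omega> \<inter> atoms {} \<union> unary \<Omega> i) (\<lambda>_. \<beta> i) (\<lambda>_. 1) \<phi> \<longleftrightarrow> lev \<Omega> \<beta> (\<lambda>_. i) \<phi>"
  proof (rule lev_cong)
    fix p and bs :: "bool list"
    show "(p, map (\<lambda>_. 1) bs) \<in> \<Omega> \<inter> atoms {} \<union> unary \<Omega> i \<longleftrightarrow> (p, map (\<lambda>_. i) bs) \<in> \<Omega>"
    proof (cases "bs = []")
      case True
      then show ?thesis using wf_worldD[OF \<Omega>, of p "[]"] by (auto simp: atoms_def unary_def)
    next
      case False
      then have "set (map (\<lambda>_. 1 :: nat) bs) = {1}" by (simp add: image_constant_conv)
      then show ?thesis using wf_worldD[OF \<Omega>, of p "map (\<lambda>_. i) bs"] False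
        by (auto simp: atoms_def unary_def ren_def o_def)
    qed
  qed auto
  moreover have "bound q \<le> counter \<Omega> \<beta> {1..n} i q \<longleftrightarrow> bound q \<le> card {a \<in> {1..n}. holds \<Omega> \<beta> i a q}"
    if "q \<in> Q" for q
    using that bound_le_cap[OF that] by (simp add: counter_def)
  ultimately show ?thesis by (simp add: acc_def state_def)
qed

lemma total_acc:
  assumes g: "g \<subseteq> atoms {}"
  shows "total g n (\<lambda>L. if \<forall>s\<in>set L. acc g s then 1 else 0) =
    (\<Sum>\<omega>\<in>Pow (small n). if gmodels \<phi> n (g \<union> \<omega>) then wt (small n) \<omega> else 0)"
  unfolding total_def
proof (intro sum.cong refl)
  fix \<omega> assume "\<omega> \<in> Pow (small n)"
  then have \<omega>: "\<omega> \<subseteq> small n" by simp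
  have wf: "wf_world (g \<union> \<omega>)"
    unfolding wf_world_Un using wf_world_atoms[OF g] wf_world_small[OF \<omega>] by blast
  have g': "(g \<union> \<omega>) \<inter> atoms {} = g"
    using g \<omega> small_nullary_disjoint[of n] by auto
  have "(\<forall>s\<in>set (states (g \<union> \<omega>) \<beta> n). acc g s) \<longleftrightarrow>
      consistent Q n (g \<union> \<omega>) \<beta> \<and> (\<forall>i\<in>{1..n}. lev (g \<union> \<omega>) \<beta> (\<lambda>_. i) \<phi>)" for \<beta>
    using acc_state[OF wf, of \<beta> n] unfolding g' consistent_def
    by (auto simp: atLeastLessThanSuc_atLeastAtMost)
  then have "(\<Sum>\<beta>\<in>{1..n} \<rightarrow>\<^sub>E Pow Q. wt (small n) \<omega> *
      (if \<forall>s\<in>set (states (g \<union> \<omega>) \<beta> n). acc g s then 1 else 0)) =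
      wt (small n) \<omega> * (\<Sum>\<beta>\<in>{1..n} \<rightarrow>\<^sub>E Pow Q.
        if consistent Q n (g \<union> \<omega>) \<beta> \<and> (\<forall>i\<in>{1..n}. lev (g \<union> \<omega>) \<beta> (\<lambda>_. i) \<phi>) then 1 else 0)" (is "?sum = _")
    by (simp only: sum_distrib_left)
  also have "\<dots> = (if gmodels \<phi> n (g \<union> \<omega>) then wt (small n) \<omega> else 0)"
    unfolding sum_consistent[OF refl] by simp
  finally show "?sum = (if gmodels \<phi> n (g \<union> \<omega>) then wt (small n) \<omega> else 0)" .
qed

text \<open>The nullary part \<open>g\<close> is fixed because all elements share it; its finitely
  many values do not depend on \<open>n\<close> and are summed over outside.\<close>

theorem polytime_computable_small:
  assumes g: "g \<subseteq> atoms {}" and W: "\<And>l. W1 l \<in> constants K \<and> W0 l \<in> constants K"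
  shows "polytime_computable K (\<lambda>n. \<Sum>\<omega>\<in>Pow (small n). if gmodels \<phi> n (g \<union> \<omega>) then wt (small n) \<omega> else 0)"
proof -
  have wt: "wt A \<omega> \<in> constants K" for A \<omega>
    unfolding set_weight_def using W by (intro constants_mult constants_prod) auto
  have "polytime_computable K (\<lambda>n. (ext g ^^ n) (\<lambda>L. if \<forall>s\<in>set L. acc g s then 1 else 0) [])"
    by (rule polytime_computable_insertion[OF finite_estates _ _ commuting_transitions])
      (use initials_in transitions_in wt in blast)+
  then show ?thesis
    by (simp only: total_eq_funpow[OF g, symmetric] total_acc[OF g])
qed

end

section \<open>Ground atoms with at least three distinct arguments\<close>

text \<open>The number of words of length \<open>k\<close> in which each of \<open>j\<close> letters
  occurs. It does not depend on \<open>n\<close>, so a power with this exponent is a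
  constant.\<close>

definition surjections :: "nat \<Rightarrow> nat \<Rightarrow> nat" where
  "surjections k j = card {ts :: nat list. length ts = k \<and> set ts = {1..j}}"

lemma card_lists_with_set:
  assumes "finite X" "card X = j"
  shows "card {ts :: nat list. length ts = k \<and> set ts = X} = surjections k j"
proof -
  obtain h where h: "bij_betw h {1..j} X"
    using assms ex_bij_betw_nat_finite_1 by blast
  define h' where "h' = inv_into {1..j} h"
  have inv: "x \<in> {1..j} \<Longrightarrow> h' (h x) = x" "y \<in> X \<Longrightarrow> h (h' y) = y \<and> h' y \<in> {1..j}" for x y
    using h by (auto simp: h'_def bij_betw_def inv_into_into f_inv_into_f)
  have img: "h ` {1..j} = X" using h by (simp add: bij_betw_def)
  have img': "h' ` X = {1..j}" using img inv(1) by (force simp: image_iff)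
  have "bij_betw (map h) {ts. length ts = k \<and> set ts = {1..j}} {ts. length ts = k \<and> set ts = X}"
  proof (rule bij_betw_byWitness[where f' = "map h'"])
    show "\<forall>ts\<in>{ts. length ts = k \<and> set ts = {1..j}}. map h' (map h ts) = ts"
      using inv(1) by (auto intro!: map_idI)
    show "\<forall>ts\<in>{ts. length ts = k \<and> set ts = X}. map h (map h' ts) = ts"
      using inv(2) by (auto intro!: map_idI)
  qed (use img img' in auto)
  then show ?thesis unfolding surjections_def by (rule bij_betw_same_card[symmetric])
qed

lemma card_lists_card_set:
  "card {ts. length ts = k \<and> set ts \<subseteq> {1..n} \<and> card (set ts) = j} = (n choose j) * surjections k j"
proof -
  have fin: "finite {ts. length ts = k \<and> set ts = X}" if "X \<subseteq> {1..n}" for X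
    by (rule finite_subset[OF _ finite_lists_length_eq[of "{1..n}" k]]) (use that in auto)
  have "{ts. length ts = k \<and> set ts \<subseteq> {1..n} \<and> card (set ts) = j} =
      (\<Union>X\<in>{X. X \<subseteq> {1..n} \<and> card X = j}. {ts. length ts = k \<and> set ts = X})" by auto
  also have "card \<dots> = (\<Sum>X\<in>{X. X \<subseteq> {1..n} \<and> card X = j}. card {ts. length ts = k \<and> set ts = X})"
    using fin by (intro card_UN_disjoint) auto
  also have "\<dots> = (\<Sum>X\<in>{X. X \<subseteq> {1..n} \<and> card X = j}. surjections k j)"
    by (intro sum.cong refl card_lists_with_set) (auto intro: finite_subset)
  also have "\<dots> = (n choose j) * surjections k j"
    using n_subsets[of "{1..n}" j] by simp
  finally show ?thesis .
qed

lemma card_lists_ge_3: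
  "card {ts. length ts = k \<and> set ts \<subseteq> {1..n} \<and> 3 \<le> card (set ts)} = (\<Sum>j\<in>{3..k}. (n choose j) * surjections k j)"
proof -
  have fin: "finite {ts. length ts = k \<and> set ts \<subseteq> {1..n} \<and> card (set ts) = j}" for j
    by (rule finite_subset[OF _ finite_lists_length_eq[of "{1..n}" k]]) auto
  have "{ts. length ts = k \<and> set ts \<subseteq> {1..n} \<and> 3 \<le> card (set ts)} =
      (\<Union>j\<in>{3..k}. {ts. length ts = k \<and> set ts \<subseteq> {1..n} \<and> card (set ts) = j})"
    using card_length by fastforce
  also have "card \<dots> = (\<Sum>j\<in>{3..k}. card {ts. length ts = k \<and> set ts \<subseteq> {1..n} \<and> card (set ts) = j})"
    using fin by (intro card_UN_disjoint) auto
  finally show ?thesis by (simp only: card_lists_card_set)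
qed

definition big :: "'p set \<Rightarrow> ('p \<Rightarrow> nat) \<Rightarrow> nat \<Rightarrow> 'p ground_atom set" where
  "big P ar n = {l \<in> herbrand_base P ar n. 3 \<le> card (set (snd l))}"

lemma finite_herbrand_base: "finite P \<Longrightarrow> finite (herbrand_base P ar n)"
proof -
  assume "finite P"
  then have "finite (SIGMA p:P. {ts. set ts \<subseteq> {1..n} \<and> length ts = ar p})"
    by (intro finite_SigmaI finite_lists_length_eq) auto
  then show ?thesis by (rule finite_subset[rotated]) (auto simp: herbrand_base_def)
qed

text \<open>The tuples of \<open>p\<close> are grouped by the number \<open>j\<close> of distinct
  arguments: there are \<open>n choose j\<close> argument sets with
  \<open>surjections (ar p) j\<close> tuples each. Only the binomial coefficient depends on
  \<open>n\<close>.\<close>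

lemma prod_big:
  fixes c :: "'p \<Rightarrow> real"
  assumes "finite P"
  shows "(\<Prod>l\<in>big P ar n. c (fst l)) = (\<Prod>p\<in>P. \<Prod>j\<in>{3..ar p}. (c p ^ surjections (ar p) j) ^ (n choose j))"
proof -
  let ?T = "\<lambda>p. {ts. length ts = ar p \<and> set ts \<subseteq> {1..n} \<and> 3 \<le> card (set ts)}"
  have fin: "finite (?T p)" for p
    by (rule finite_subset[OF _ finite_lists_length_eq[of "{1..n}" "ar p"]]) auto
  have "big P ar n = (SIGMA p:P. ?T p)" by (auto simp: big_def herbrand_base_def)
  then have "(\<Prod>l\<in>big P ar n. c (fst l)) = (\<Prod>p\<in>P. \<Prod>ts\<in>?T p. c p)"
    using prod.Sigma[of P ?T "\<lambda>p _. c p"] assms fin by (simp add: case_prod_unfold)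
  also have "\<dots> = (\<Prod>p\<in>P. c p ^ card (?T p))" by simp
  also have "\<dots> = (\<Prod>p\<in>P. \<Prod>j\<in>{3..ar p}. (c p ^ surjections (ar p) j) ^ (n choose j))"
    by (simp only: card_lists_ge_3 power_sum power_mult[symmetric] mult.commute)
  finally show ?thesis .
qed

lemma polytime_computable_prod_big:
  assumes "finite P" "\<And>p. p \<in> P \<Longrightarrow> c p \<in> constants K"
  shows "polytime_computable K (\<lambda>n. \<Prod>l\<in>big P ar n. c (fst l))"
  unfolding prod_big[OF assms(1)] using assms
  by (intro polytime_computable_prod polytime_computable_power_choose constants_power) auto

text \<open>Under an assignment to two variables an atom has at most two distinct arguments.\<close>

lemma gsat_cong:
  assumes "\<And>l. card (set (snd l)) \<le> 2 \<Longrightarrow> l \<in> \<omega> \<longleftrightarrow> l \<in> \<omega>'"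
  shows "gsat n \<omega> \<tau> f \<longleftrightarrow> gsat n \<omega>' \<tau> f"
proof (induction f arbitrary: \<tau>)
  case (GAtom p bs)
  have "set (map \<tau> bs) \<subseteq> {\<tau> True, \<tau> False}" by (auto, metis (full_types))
  then have "card (set (map \<tau> bs)) \<le> card {\<tau> True, \<tau> False}" by (intro card_mono) auto
  also have "\<dots> \<le> 2" by (simp add: card_insert_if)
  finally show ?case using assms[of "(p, map \<tau> bs)"] by simp
qed auto

context recursion
begin

lemma herbrand_base_split: "herbrand_base P ar n = atoms {} \<union> (small n \<union> big P ar n)"
proof -
  have "set ts = {} \<or> 3 \<le> card (set ts) \<or> card (set ts) \<le> 2 \<and> set ts \<noteq> {}" for ts :: "nat list"
    by linarith
  moreover have "l \<in> herbrand_base P ar n \<longleftrightarrow> l \<in> atoms (set (snd l)) \<and> set (snd l) \<subseteq> {1..n}" for l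
    by (cases l) (simp add: herbrand_base_def atoms_def)
  moreover have "l \<in> atoms {} \<longleftrightarrow> l \<in> atoms (set (snd l)) \<and> set (snd l) = {}" for l
    by (cases l) (auto simp: atoms_def)
  ultimately show ?thesis
    unfolding set_eq_iff Un_iff big_def mem_Collect_eq in_small by blast
qed

lemma split_disjoint: "atoms {} \<inter> (small n \<union> big P ar n) = {}" "small n \<inter> big P ar n = {}"
  by (auto simp: atoms_def in_small big_def)

text \<open>The sentence does not see the big atoms, so each of them contributes the sum of its two
  weights as a factor.\<close>

lemma sum_herbrand_base:
  "(\<Sum>\<omega>\<in>Pow (herbrand_base P ar n). if gmodels \<phi> n \<omega> then wt (herbrand_base P ar n) \<omega> else 0) =
   (\<Prod>l\<in>big P ar n. W1 l + W0 l) * (\<Sum>g\<in>Pow (atoms {}). wt (atoms {}) g *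
      (\<Sum>\<omega>\<in>Pow (small n). if gmodels \<phi> n (g \<union> \<omega>) then wt (small n) \<omega> else 0))"
proof -
  have fin: "finite (big P ar n)" using finite_herbrand_base[OF finite_P] by (simp add: big_def)
  have eq: "(if gmodels \<phi> n (g \<union> (\<omega> \<union> \<xi>)) then wt (herbrand_base P ar n) (g \<union> (\<omega> \<union> \<xi>)) else 0) =
      wt (big P ar n) \<xi> * (wt (atoms {}) g * (if gmodels \<phi> n (g \<union> \<omega>) then wt (small n) \<omega> else 0))"
    if "g \<in> Pow (atoms {})" "\<omega> \<in> Pow (small n)" "\<xi> \<in> Pow (big P ar n)" for g \<omega> \<xi>
  proof -
    have "l \<in> g \<union> (\<omega> \<union> \<xi>) \<longleftrightarrow> l \<in> g \<union> \<omega>" if "card (set (snd l)) \<le> 2" for l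
      using that \<open>\<xi> \<in> Pow (big P ar n)\<close> by (auto simp: big_def)
    then have "gmodels \<phi> n (g \<union> (\<omega> \<union> \<xi>)) \<longleftrightarrow> gmodels \<phi> n (g \<union> \<omega>)"
      unfolding gmodels_def using gsat_cong by blast
    moreover have "wt (herbrand_base P ar n) (g \<union> (\<omega> \<union> \<xi>)) = wt (atoms {}) g * wt (small n \<union> big P ar n) (\<omega> \<union> \<xi>)"
      unfolding herbrand_base_split using that split_disjoint[of n]
      by (intro set_weight_Un) (auto simp: finite_atoms finite_small fin)
    moreover have "wt (small n \<union> big P ar n) (\<omega> \<union> \<xi>) = wt (small n) \<omega> * wt (big P ar n) \<xi>"
      using that split_disjoint[of n] by (intro set_weight_Un) (auto simp: finite_small fin)
    ultimately show ?thesis by simp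
  qed
  have "(\<Sum>\<omega>\<in>Pow (herbrand_base P ar n). if gmodels \<phi> n \<omega> then wt (herbrand_base P ar n) \<omega> else 0) =
    (\<Sum>g\<in>Pow (atoms {}). \<Sum>\<omega>\<in>Pow (small n). \<Sum>\<xi>\<in>Pow (big P ar n).
      if gmodels \<phi> n (g \<union> (\<omega> \<union> \<xi>)) then wt (herbrand_base P ar n) (g \<union> (\<omega> \<union> \<xi>)) else 0)"
    unfolding herbrand_base_split sum_Pow_Un[OF split_disjoint(1)] sum_Pow_Un[OF split_disjoint(2)] ..
  also have "\<dots> = (\<Sum>g\<in>Pow (atoms {}). \<Sum>\<omega>\<in>Pow (small n). \<Sum>\<xi>\<in>Pow (big P ar n).
      wt (big P ar n) \<xi> * (wt (atoms {}) g * (if gmodels \<phi> n (g \<union> \<omega>) then wt (small n) \<omega> else 0)))"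
    by (intro sum.cong refl eq)
  also have "\<dots> = (\<Sum>\<xi>\<in>Pow (big P ar n). wt (big P ar n) \<xi>) * (\<Sum>g\<in>Pow (atoms {}). wt (atoms {}) g *
      (\<Sum>\<omega>\<in>Pow (small n). if gmodels \<phi> n (g \<union> \<omega>) then wt (small n) \<omega> else 0))"
    by (simp only: sum_distrib_right[symmetric] sum_distrib_left[symmetric])
  finally show ?thesis by (simp only: sum_set_weight[OF fin])
qed

lemma polytime_computable_herbrand_base:
  assumes "\<And>l. W1 l \<in> constants K \<and> W0 l \<in> constants K"
    and c: "\<And>l n. l \<in> big P ar n \<Longrightarrow> W1 l + W0 l = c (fst l)" "\<And>p. p \<in> P \<Longrightarrow> c p \<in> constants K"
  shows "polytime_computable K
    (\<lambda>n. \<Sum>\<omega>\<in>Pow (herbrand_base P ar n). if gmodels \<phi> n \<omega> then wt (herbrand_base P ar n) \<omega> else 0)"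
proof -
  have wt: "wt A \<omega> \<in> constants K" for A \<omega>
    unfolding set_weight_def using assms(1) by (intro constants_mult constants_prod) auto
  have "(\<Prod>l\<in>big P ar n. W1 l + W0 l) = (\<Prod>l\<in>big P ar n. c (fst l))" for n
    using c(1) by (intro prod.cong) auto
  then show ?thesis
    unfolding sum_herbrand_base using finite_atoms assms wt c(2)
    by (auto intro!: polytime_computable_mult polytime_computable_prod_big polytime_computable_sum
        polytime_computable_const polytime_computable_small simp: finite_P)
qed

end

section \<open>Fixing the linear order\<close>

text \<open>\<pi> is the rank function of the order: the element \<open>a\<close> stands at place
  \<open>\<pi> a\<close>.\<close>

definition ordered_by :: "(nat \<Rightarrow> nat) \<Rightarrow> 'p \<Rightarrow> nat \<Rightarrow> 'p world \<Rightarrow> bool" where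
  "ordered_by \<pi> le n \<omega> \<longleftrightarrow> (\<forall>a\<in>{1..n}. \<forall>b\<in>{1..n}. (le, [a, b]) \<in> \<omega> \<longleftrightarrow> \<pi> a \<le> \<pi> b)"

lemma ordered_by_linear_order:
  fixes r :: "(nat \<times> nat) set"
  assumes r: "r \<subseteq> {1..n} \<times> {1..n}" and \<pi>: "\<pi> permutes {1..n}"
    and eq: "\<And>a b. a \<in> {1..n} \<Longrightarrow> b \<in> {1..n} \<Longrightarrow> (a, b) \<in> r \<longleftrightarrow> \<pi> a \<le> \<pi> b"
  shows "linear_order_on {1..n} r"
proof -
  have inj: "\<pi> a = \<pi> b \<Longrightarrow> a = b" for a b using permutes_inj[OF \<pi>] by (auto simp: inj_def)
  have mem: "a \<in> {1..n} \<and> b \<in> {1..n}" if "(a, b) \<in> r" for a b using that r by blast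
  have "refl_on {1..n} r" using eq r by (auto simp: refl_on_def)
  moreover have "trans r"
  proof (rule transI)
    fix a b c assume "(a, b) \<in> r" "(b, c) \<in> r"
    then show "(a, c) \<in> r" using mem eq by (meson order_trans)
  qed
  moreover have "antisym r"
  proof (rule antisymI)
    fix a b assume "(a, b) \<in> r" "(b, a) \<in> r"
    then show "a = b" using mem eq inj by (meson order_antisym)
  qed
  moreover have "total_on {1..n} r" using eq unfolding total_on_def by (meson linear)
  ultimately show ?thesis
    using r by (simp add: linear_order_on_def partial_order_on_def preorder_on_def)
qed

text \<open>The witness counts the elements up to and including \<open>a\<close>. This number grows
  strictly along the order, hence it permutes the domain.\<close>

lemma linear_order_rank:
  fixes r :: "(nat \<times> nat) set"
  assumes "linear_order_on {1..n} r"
  shows "\<exists>\<pi>. \<pi> permutes {1..n} \<and> (\<forall>a\<in>{1..n}. \<forall>b\<in>{1..n}. (a, b) \<in> r \<longleftrightarrow> \<pi> a \<le> \<pi> b)"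
proof -
  let ?A = "{1..n}"
  have refl: "a \<in> ?A \<Longrightarrow> (a, a) \<in> r" and trans: "trans r" and antisym: "antisym r" and total: "total_on ?A r" for a
    using assms by (auto simp: linear_order_on_def partial_order_on_def preorder_on_def refl_on_def)
  define \<rho> where "\<rho> a = card {b \<in> ?A. (b, a) \<in> r}" for a
  have less: "\<rho> a < \<rho> b" if "a \<in> ?A" "b \<in> ?A" "(a, b) \<in> r" "a \<noteq> b" for a b
    unfolding \<rho>_def
  proof (rule psubset_card_mono)
    show "{c \<in> ?A. (c, a) \<in> r} \<subset> {c \<in> ?A. (c, b) \<in> r}"
    proof
      show "{c \<in> ?A. (c, a) \<in> r} \<subseteq> {c \<in> ?A. (c, b) \<in> r}" using that(3) trans by (auto dest: transD)
      have "b \<in> {c \<in> ?A. (c, b) \<in> r}" "b \<notin> {c \<in> ?A. (c, a) \<in> r}"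
        using that refl antisym by (auto dest: antisymD)
      then show "{c \<in> ?A. (c, a) \<in> r} \<noteq> {c \<in> ?A. (c, b) \<in> r}" by blast
    qed
  qed simp
  have iff: "(a, b) \<in> r \<longleftrightarrow> \<rho> a \<le> \<rho> b" if "a \<in> ?A" "b \<in> ?A" for a b
  proof (cases "a = b")
    case True
    then show ?thesis using refl that by simp
  next
    case False
    then have "(a, b) \<in> r \<or> (b, a) \<in> r" using total that by (auto simp: total_on_def)
    then show ?thesis using less[of a b] less[of b a] that False antisym by (auto dest: antisymD)
  qed
  have inj: "inj_on \<rho> ?A"
  proof (rule inj_onI)
    fix a b assume ab: "a \<in> ?A" "b \<in> ?A" "\<rho> a = \<rho> b"
    then have "(a, b) \<in> r" "(b, a) \<in> r" using iff by auto
    then show "a = b" using antisym by (auto dest: antisymD)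
  qed
  have "\<rho> a \<in> ?A" if "a \<in> ?A" for a
  proof -
    have "\<rho> a \<le> card ?A" unfolding \<rho>_def by (rule card_mono) auto
    moreover have "\<rho> a > 0" unfolding \<rho>_def using refl[OF that] that by (auto simp: card_gt_0_iff)
    ultimately show ?thesis by simp
  qed
  then have "\<rho> ` ?A = ?A" using inj by (intro endo_inj_surj) auto
  then have bij: "bij_betw \<rho> ?A ?A" using inj by (simp add: bij_betw_def)
  define \<pi> where "\<pi> a = (if a \<in> ?A then \<rho> a else a)" for a
  have "bij_betw \<pi> ?A ?A" using bij by (subst bij_betw_cong[of _ _ \<rho>]) (auto simp: \<pi>_def)
  then have "\<pi> permutes ?A" by (rule bij_imp_permutes) (auto simp: \<pi>_def)
  moreover have "\<forall>a\<in>?A. \<forall>b\<in>?A. (a, b) \<in> r \<longleftrightarrow> \<pi> a \<le> \<pi> b" using iff by (simp add: \<pi>_def)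
  ultimately show ?thesis by blast
qed

text \<open>\<open>\<pi> a\<close> is recovered from the order as the number of \<open>b\<close>
  with \<open>\<pi> b \<le> \<pi> a\<close>. This makes the classes of worlds belonging to different
  permutations disjoint.\<close>

lemma permutes_determined:
  assumes \<pi>: "\<pi> permutes {1..n}" and \<sigma>: "\<sigma> permutes {1..n}"
    and eq: "\<And>a b. a \<in> {1..n} \<Longrightarrow> b \<in> {1..n} \<Longrightarrow> \<pi> a \<le> \<pi> b \<longleftrightarrow> \<sigma> a \<le> (\<sigma> b :: nat)"
  shows "\<pi> = \<sigma>"
proof
  fix a
  have rank: "card {b \<in> {1..n}. p b \<le> p a} = p a" if p: "p permutes {1..n}" "a \<in> {1..n}" for p
  proof -
    have "p ` {b \<in> {1..n}. p b \<le> p a} = {c \<in> p ` {1..n}. c \<le> p a}" by auto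
    also have "\<dots> = {1..p a}"
      using permutes_image[OF p(1)] permutes_in_image[OF p(1), of a] p(2) by auto
    finally have "card (p ` {b \<in> {1..n}. p b \<le> p a}) = p a" by simp
    then show ?thesis using card_image[OF inj_on_subset[OF permutes_inj[OF p(1)] subset_UNIV]] by metis
  qed
  show "\<pi> a = \<sigma> a"
  proof (cases "a \<in> {1..n}")
    case True
    then have "{b \<in> {1..n}. \<pi> b \<le> \<pi> a} = {b \<in> {1..n}. \<sigma> b \<le> \<sigma> a}" using eq by blast
    then show ?thesis using rank[OF \<pi> True] rank[OF \<sigma> True] by simp
  next
    case False
    then show ?thesis using permutes_not_in[OF \<pi>] permutes_not_in[OF \<sigma>] by metis
  qed
qed

section \<open>Relabelling the domain\<close>

lemma inj_ren: "inj h \<Longrightarrow> inj (ren h)"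
  by (auto simp: inj_def ren_def prod_eq_iff)

lemma gsat_ren:
  assumes \<pi>: "\<pi> permutes {1..n}"
  shows "gsat n (ren \<pi> ` \<omega>) (\<pi> \<circ> \<tau>) f \<longleftrightarrow> gsat n \<omega> \<tau> f"
proof (induction f arbitrary: \<tau>)
  case (GAtom p bs)
  have "(p, map (\<pi> \<circ> \<tau>) bs) = ren \<pi> (p, map \<tau> bs)" by (simp add: ren_def)
  then have "(p, map (\<pi> \<circ> \<tau>) bs) \<in> ren \<pi> ` \<omega> \<longleftrightarrow> (p, map \<tau> bs) \<in> \<omega>"
    using inj_image_mem_iff[OF inj_ren[OF permutes_inj[OF \<pi>]]] by metis
  then show ?case by (simp only: gsat.simps)
next
  case (GEq b c)
  then show ?case using permutes_inj[OF \<pi>] by (simp add: inj_eq)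
next
  case (GGe k b f)
  have "{a \<in> {1..n}. gsat n (ren \<pi> ` \<omega>) ((\<pi> \<circ> \<tau>)(b := a)) f} = \<pi> ` {a \<in> {1..n}. gsat n \<omega> (\<tau>(b := a)) f}"
  proof -
    have "gsat n (ren \<pi> ` \<omega>) ((\<pi> \<circ> \<tau>)(b := \<pi> a)) f \<longleftrightarrow> gsat n \<omega> (\<tau>(b := a)) f" for a
    proof -
      have "\<pi> \<circ> \<tau>(b := a) = (\<pi> \<circ> \<tau>)(b := \<pi> a)" by (auto simp: fun_eq_iff)
      then show ?thesis using GGe[of "\<tau>(b := a)"] by metis
    qed
    moreover have "\<exists>a\<in>{1..n}. x = \<pi> a" if "x \<in> {1..n}" for x
      using permutes_image[OF \<pi>] that by blast
    moreover have "\<pi> a \<in> {1..n}" if "a \<in> {1..n}" for a using permutes_in_image[OF \<pi>] that by blast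
    ultimately show ?thesis by blast
  qed
  then have "card {a \<in> {1..n}. gsat n (ren \<pi> ` \<omega>) ((\<pi> \<circ> \<tau>)(b := a)) f} = card {a \<in> {1..n}. gsat n \<omega> (\<tau>(b := a)) f}"
    using card_image[OF inj_on_subset[OF permutes_inj[OF \<pi>] subset_UNIV]] by metis
  then show ?case by (simp only: gsat.simps)
qed auto

lemma gmodels_ren:
  assumes \<pi>: "\<pi> permutes {1..n}"
  shows "gmodels \<phi> n (ren \<pi> ` \<omega>) \<longleftrightarrow> gmodels \<phi> n \<omega>"
proof -
  have "gsat n (ren \<pi> ` \<omega>) (\<lambda>_. \<pi> i) \<phi> \<longleftrightarrow> gsat n \<omega> (\<lambda>_. i) \<phi>" for i
    using gsat_ren[OF \<pi>, of \<omega> "\<lambda>_. i"] by (simp add: comp_def)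
  then have "(\<forall>i\<in>\<pi> ` {1..n}. gsat n (ren \<pi> ` \<omega>) (\<lambda>_. i) \<phi>) \<longleftrightarrow> gmodels \<phi> n \<omega>"
    unfolding gmodels_def by simp
  then show ?thesis unfolding permutes_image[OF \<pi>] gmodels_def .
qed

lemma herbrand_base_ren:
  assumes \<pi>: "\<pi> permutes {1..n}"
  shows "ren \<pi> ` herbrand_base P ar n \<subseteq> herbrand_base P ar n"
  using permutes_in_image[OF \<pi>] by (fastforce simp: herbrand_base_def ren_def)

lemma ren_inverse:
  assumes "\<pi> permutes A"
  shows "ren \<pi> ` ren (inv \<pi>) ` \<omega> = \<omega>" "ren (inv \<pi>) ` ren \<pi> ` \<omega> = \<omega>"
  using permutes_inverses[OF assms] by (auto simp: image_image ren_def comp_def)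

text \<open>Renaming the elements by \<pi> carries the worlds ordered by \<pi> to those with the
  natural order; truth of the sentence and weights per predicate are invariant under it.\<close>

lemma sum_ordered_by:
  fixes P :: "'p set" and ar :: "'p \<Rightarrow> nat" and w wbar :: "'p \<Rightarrow> real"
  assumes \<pi>: "\<pi> permutes {1..n}"
  defines "H \<equiv> herbrand_base P ar n"
  shows "(\<Sum>\<omega> | \<omega> \<subseteq> H \<and> gmodels \<phi> n \<omega> \<and> ordered_by \<pi> le n \<omega>. pred_weight w wbar H \<omega>) =
    (\<Sum>\<omega> | \<omega> \<subseteq> H \<and> gmodels \<phi> n \<omega> \<and> ordered_by id le n \<omega>. pred_weight w wbar H \<omega>)"
proof (rule sum.reindex_bij_witness[where i = "image (ren (inv \<pi>))" and j = "image (ren \<pi>)"])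
  let ?S = "\<lambda>\<pi>. {\<omega>. \<omega> \<subseteq> H \<and> gmodels \<phi> n \<omega> \<and> ordered_by \<pi> le n \<omega>}"
  note inv = permutes_inv[OF \<pi>]
  have sub: "ren \<sigma> ` \<omega> \<subseteq> H" if "\<omega> \<subseteq> H" "\<sigma> permutes {1..n}" for \<sigma> \<omega>
    using herbrand_base_ren[OF that(2)] that(1) unfolding H_def by blast
  have mem: "(le, [a, b]) \<in> ren \<sigma> ` \<omega> \<longleftrightarrow> (le, [inv \<sigma> a, inv \<sigma> b]) \<in> \<omega>" if \<sigma>: "\<sigma> permutes {1..n}" for \<sigma> a b and \<omega> :: "'p world"
  proof -
    have "(le, [a, b]) = ren \<sigma> (le, [inv \<sigma> a, inv \<sigma> b])"
      using permutes_inverses(1)[OF \<sigma>] by (simp add: ren_def)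
    then show ?thesis using inj_image_mem_iff[OF inj_ren[OF permutes_inj[OF \<sigma>]]] by metis
  qed
  fix \<omega>
  {
    assume \<omega>: "\<omega> \<in> ?S \<pi>"
    show "ren (inv \<pi>) ` ren \<pi> ` \<omega> = \<omega>" by (rule ren_inverse(2)[OF \<pi>])
    have "ordered_by id le n (ren \<pi> ` \<omega>)"
      unfolding ordered_by_def mem[OF \<pi>]
    proof (intro ballI)
      fix a b assume "a \<in> {1..n}" "b \<in> {1..n}"
      then have "inv \<pi> a \<in> {1..n}" "inv \<pi> b \<in> {1..n}" using permutes_in_image[OF inv] by blast+
      then show "(le, [inv \<pi> a, inv \<pi> b]) \<in> \<omega> \<longleftrightarrow> id a \<le> id b"
        using \<omega> permutes_inverses(1)[OF \<pi>] by (simp add: ordered_by_def)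
    qed
    then show "ren \<pi> ` \<omega> \<in> ?S id"
      using \<omega> sub[OF _ \<pi>] gmodels_ren[OF \<pi>] by blast
    have img: "ren \<pi> ` H = H"
    proof
      show "ren \<pi> ` H \<subseteq> H" using sub[OF subset_refl \<pi>] .
      have "ren \<pi> ` ren (inv \<pi>) ` H \<subseteq> ren \<pi> ` H" using sub[OF subset_refl inv] by (rule image_mono)
      then show "H \<subseteq> ren \<pi> ` H" unfolding ren_inverse(1)[OF \<pi>] .
    qed
    have "pred_weight w wbar (ren \<pi> ` H) (ren \<pi> ` \<omega>) =
        pred_weight w wbar H \<omega>"
      using \<omega> inj_ren[OF permutes_inj[OF \<pi>]] by (intro set_weight_image) (auto simp: ren_def intro: inj_on_subset)
    then show "pred_weight w wbar H (ren \<pi> ` \<omega>) =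
        pred_weight w wbar H \<omega>" unfolding img .
  }
  {
    assume \<omega>: "\<omega> \<in> ?S id"
    show "ren \<pi> ` ren (inv \<pi>) ` \<omega> = \<omega>" by (rule ren_inverse(1)[OF \<pi>])
    have "ordered_by \<pi> le n (ren (inv \<pi>) ` \<omega>)"
      unfolding ordered_by_def mem[OF inv] inv_inv_eq[OF permutes_bij[OF \<pi>]]
      using \<omega> permutes_in_image[OF \<pi>] by (simp add: ordered_by_def)
    then show "ren (inv \<pi>) ` \<omega> \<in> ?S \<pi>"
      using \<omega> sub[OF _ inv] gmodels_ren[OF inv] by blast
  }
qed

lemma linear_order_iff:
  assumes "\<omega> \<subseteq> herbrand_base P ar n"
  shows "linear_order_on {1..n} {(a, b). (le, [a, b]) \<in> \<omega>} \<longleftrightarrow> (\<exists>\<pi>. \<pi> permutes {1..n} \<and> ordered_by \<pi> le n \<omega>)"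
proof
  assume "linear_order_on {1..n} {(a, b). (le, [a, b]) \<in> \<omega>}"
  from linear_order_rank[OF this] show "\<exists>\<pi>. \<pi> permutes {1..n} \<and> ordered_by \<pi> le n \<omega>"
    unfolding ordered_by_def by simp
next
  assume "\<exists>\<pi>. \<pi> permutes {1..n} \<and> ordered_by \<pi> le n \<omega>"
  then obtain \<pi> where "\<pi> permutes {1..n}" "ordered_by \<pi> le n \<omega>" by blast
  then show "linear_order_on {1..n} {(a, b). (le, [a, b]) \<in> \<omega>}"
    using assms by (intro ordered_by_linear_order) (auto simp: herbrand_base_def ordered_by_def)
qed

text \<open>Worlds are sorted by the permutation that their order induces; the n! classes are
  disjoint and have equal sums.\<close>

lemma WFOMC_eq_fact:
  fixes P :: "'p set" and ar :: "'p \<Rightarrow> nat" and w wbar :: "'p \<Rightarrow> real"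
  assumes P: "finite P" and \<phi>: "\<And>\<omega>. models \<psi> n \<omega> \<longleftrightarrow> gmodels \<phi> n \<omega>"
  defines "H \<equiv> herbrand_base P ar n"
  shows "WFOMC P ar (with_linear_order \<psi> le) n w wbar =
    fact n * (\<Sum>\<omega> | \<omega> \<subseteq> H \<and> gmodels \<phi> n \<omega> \<and> ordered_by id le n \<omega>. pred_weight w wbar H \<omega>)"
proof -
  define S where "S \<pi> = {\<omega>. \<omega> \<subseteq> H \<and> gmodels \<phi> n \<omega> \<and> ordered_by \<pi> le n \<omega>}" for \<pi>
  let ?w = "pred_weight w wbar H"
  let ?\<Pi> = "{\<pi>. \<pi> permutes {1..n}}"
  have fin: "finite (S \<pi>)" for \<pi>
    using finite_herbrand_base[OF P] by (intro finite_subset[of "S \<pi>" "Pow H"]) (auto simp: S_def H_def)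
  have disj: "S \<pi> \<inter> S \<sigma> = {}" if "\<pi> \<in> ?\<Pi>" "\<sigma> \<in> ?\<Pi>" "\<pi> \<noteq> \<sigma>" for \<pi> \<sigma>
    using that permutes_determined[of \<pi> n \<sigma>] by (auto simp: S_def ordered_by_def)
  have "{\<omega>. \<omega> \<subseteq> H \<and> with_linear_order \<psi> le n \<omega>} = (\<Union>\<pi>\<in>?\<Pi>. S \<pi>)"
    using linear_order_iff[of _ P ar n le] unfolding with_linear_order_def \<phi> S_def H_def by blast
  then have "WFOMC P ar (with_linear_order \<psi> le) n w wbar = (\<Sum>\<omega>\<in>(\<Union>\<pi>\<in>?\<Pi>. S \<pi>). ?w \<omega>)"
    unfolding WFOMC_def set_weight_def H_def by simp
  also have "\<dots> = (\<Sum>\<pi>\<in>?\<Pi>. \<Sum>\<omega>\<in>S \<pi>. ?w \<omega>)"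
    using fin disj by (intro sum.UNION_disjoint) (auto simp: finite_permutations)
  also have "\<dots> = (\<Sum>\<pi>\<in>?\<Pi>. \<Sum>\<omega>\<in>S id. ?w \<omega>)"
    unfolding S_def H_def by (intro sum.cong refl sum_ordered_by) auto
  also have "\<dots> = fact n * (\<Sum>\<omega>\<in>S id. ?w \<omega>)"
    using card_permutations[of "{1..n}" n] by simp
  finally show ?thesis unfolding S_def .
qed

section \<open>The natural order expressed by weights 0 and 1\<close>

definition ascending :: "nat list \<Rightarrow> bool" where
  "ascending ts \<longleftrightarrow> (\<exists>a b. ts = [a, b] \<and> a \<le> b)"

lemma ascending_map:
  assumes "strict_mono_on (set ts) h"
  shows "ascending (map h ts) \<longleftrightarrow> ascending ts"
proof -
  have "h a \<le> h b \<longleftrightarrow> a \<le> b" if "ts = [a, b]" for a b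
    using strict_mono_on_less_eq[OF assms, of a b] that by simp
  then show ?thesis by (auto simp: ascending_def map_eq_Cons_conv)
qed

text \<open>Order weights of \<open>0\<close> and \<open>1\<close> make the worlds not ordered by \<open>id\<close> vanish from the sum.\<close>

lemma set_weight_ascending:
  fixes P :: "'p set" and ar :: "'p \<Rightarrow> nat" and w wbar :: "'p \<Rightarrow> real" and n :: nat
  assumes P: "finite P" "le \<in> P" "ar le = 2" "w le = 1" "wbar le = 1"
    and W: "\<And>l. fst l \<in> P \<Longrightarrow> W1 l = (if fst l = le then of_bool (ascending (snd l)) else w (fst l))"
      "\<And>l. fst l \<in> P \<Longrightarrow> W0 l = (if fst l = le then of_bool (\<not> ascending (snd l)) else wbar (fst l))"
  defines "H \<equiv> herbrand_base P ar n"
  assumes \<omega>: "\<omega> \<subseteq> H"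
  shows "set_weight W1 W0 H \<omega> =
    (if ordered_by id le n \<omega> then pred_weight w wbar H \<omega> else 0)"
proof -
  have fin: "finite H" using finite_herbrand_base[OF P(1)] by (simp add: H_def)
  have inP: "fst l \<in> P" if "l \<in> H" for l using that by (auto simp: H_def herbrand_base_def)
  have le_atom: "\<exists>a\<in>{1..n}. \<exists>b\<in>{1..n}. l = (le, [a, b])" if "l \<in> H" "fst l = le" for l
  proof -
    obtain ts where l: "l = (le, ts)" "length ts = 2" "set ts \<subseteq> {1..n}"
      using \<open>l \<in> H\<close> \<open>fst l = le\<close> P(3) by (cases l) (auto simp: H_def herbrand_base_def)
    then obtain a b where "ts = [a, b]" by (auto simp: length_Suc_conv eval_nat_numeral)
    then show ?thesis using l by auto
  qed
  show ?thesis
  proof (cases "ordered_by id le n \<omega>")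
    case True
    have asc: "ascending (snd l) \<longleftrightarrow> l \<in> \<omega>" if "l \<in> H" "fst l = le" for l
      using le_atom[OF that] True by (auto simp: ordered_by_def ascending_def)
    \<comment> \<open>On atoms of \<open>le\<close> both weightings give the factor 1 here, as
      \<open>w le = 1\<close> and \<open>wbar le = 1\<close>.\<close>
    have "W1 l = w (fst l)" if "l \<in> \<omega>" for l
      using that \<omega> asc[of l] inP[of l] W(1)[of l] P(4) by auto
    moreover have "W0 l = wbar (fst l)" if "l \<in> H - \<omega>" for l
      using that asc[of l] inP[of l] W(2)[of l] P(5) by auto
    ultimately show ?thesis using True by (simp add: set_weight_def)
  next
    case False
    then obtain a b where ab: "a \<in> {1..n}" "b \<in> {1..n}" "((le, [a, b]) \<in> \<omega>) \<noteq> (a \<le> b)"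
      unfolding ordered_by_def id_def by blast
    then have H: "(le, [a, b]) \<in> H" using P(2,3) by (simp add: H_def herbrand_base_def)
    have fin': "finite \<omega>" "finite (H - \<omega>)" using fin \<omega> by (auto intro: finite_subset)
    have "(\<Prod>l\<in>\<omega>. W1 l) = 0 \<or> (\<Prod>l\<in>H - \<omega>. W0 l) = 0"
    proof (cases "(le, [a, b]) \<in> \<omega>")
      case True
      then have "W1 (le, [a, b]) = 0" using ab W(1)[of "(le, [a, b])"] P(2) by (simp add: ascending_def)
      then show ?thesis using fin'(1) True prod_zero by blast
    next
      case False
      then have "W0 (le, [a, b]) = 0" using ab W(2)[of "(le, [a, b])"] P(2) by (simp add: ascending_def)
      then show ?thesis using fin'(2) False H prod_zero by blast
    qed
    then show ?thesis using False by (auto simp: set_weight_def)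
  qed
qed

text \<open>Serves for the single value that the program has built in, that of the empty
  domain.\<close>

lemma WFOMC_in_constants:
  fixes w wbar :: "'p \<Rightarrow> real"
  shows "WFOMC P ar \<Phi> n w wbar \<in> constants (w ` P \<union> wbar ` P)"
proof -
  have P: "fst l \<in> P" if "l \<in> herbrand_base P ar n" for l
    using that by (auto simp: herbrand_base_def)
  show ?thesis
    unfolding WFOMC_def
    by (intro constants_sum constants_mult constants_prod constants_base) (use P in blast)+
qed

theorem theorem5:
  fixes P :: "'p set" and ar :: "'p \<Rightarrow> nat" and le :: 'p
    and \<psi> :: "'p fm" and w wbar :: "'p \<Rightarrow> real"
  assumes "finite P"
    and "le \<in> P" and "ar le = 2"
    and "C2_sentence P ar \<psi>"
    and "w le = 1" and "wbar le = 1"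
  shows "polytime_computable (w ` P \<union> wbar ` P)
           (\<lambda>n. WFOMC P ar (with_linear_order \<psi> le) n w wbar)"
proof -
  define K where "K = w ` P \<union> wbar ` P"
  obtain \<phi> where \<phi>: "\<And>n \<omega>. n > 0 \<Longrightarrow> models \<psi> n \<omega> \<longleftrightarrow> gmodels \<phi> n \<omega>"
    using ex_gmodels[OF assms(4)] by blast
  \<comment> \<open>The value 0 for predicates outside \<open>P\<close> keeps the weight of every
    atom in \<open>constants K\<close>.\<close>
  define W1 :: "'p ground_atom \<Rightarrow> real" where
    "W1 l = (if fst l = le then of_bool (ascending (snd l)) else if fst l \<in> P then w (fst l) else 0)" for l
  define W0 :: "'p ground_atom \<Rightarrow> real" where
    "W0 l = (if fst l = le then of_bool (\<not> ascending (snd l)) else if fst l \<in> P then wbar (fst l) else 0)" for l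
  interpret recursion P ar W1 W0 \<phi>
    by unfold_locales (auto simp: assms(1) W1_def W0_def ren_def ascending_map)
  define Z where "Z n = (\<Sum>\<omega>\<in>Pow (herbrand_base P ar n). if gmodels \<phi> n \<omega> then wt (herbrand_base P ar n) \<omega> else 0)" for n
  have K: "W1 l \<in> constants K \<and> W0 l \<in> constants K" for l
    by (auto simp: W1_def W0_def K_def intro!: constants_base)
  have "W1 l + W0 l = w (fst l) + wbar (fst l)" if "l \<in> big P ar n" for l n
  proof -
    have "length (snd l) = ar (fst l)" "fst l \<in> P" "3 \<le> card (set (snd l))"
      using that by (auto simp: big_def herbrand_base_def)
    moreover have "card (set (snd l)) \<le> length (snd l)" by (rule card_length)
    \<comment> \<open>\<open>le\<close> is binary, so its atoms never have three distinct arguments,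
      and the order weights stay off the big atoms.\<close>
    ultimately have "fst l \<noteq> le" using assms(3) by auto
    then show ?thesis using \<open>fst l \<in> P\<close> by (simp add: W1_def W0_def)
  qed
  then have "polytime_computable K Z" unfolding Z_def
    using K by (intro polytime_computable_herbrand_base[where c = "\<lambda>p. w p + wbar p"])
      (auto simp: K_def intro!: constants_add intro: constants_base)
  \<comment> \<open>The passage to \<open>gmodels\<close> is available for n > 0 only; the value for
    n = 0 is supplied as a constant.\<close>
  from polytime_computable_at_0[OF polytime_computable_mult[OF polytime_computable_fact this]
      WFOMC_in_constants[of P ar "with_linear_order \<psi> le" 0 w wbar, folded K_def]]
  have "polytime_computable K (\<lambda>n. if n = 0 then WFOMC P ar (with_linear_order \<psi> le) 0 w wbar
     else fact n * Z n)" .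
  moreover have "WFOMC P ar (with_linear_order \<psi> le) n w wbar =
     fact n * Z n"
    if "n > 0" for n
  proof -
    let ?H = "herbrand_base P ar n"
    let ?w = "pred_weight w wbar ?H"
    have "wt ?H \<omega> = (if ordered_by id le n \<omega> then ?w \<omega> else 0)" if "\<omega> \<subseteq> ?H" for \<omega>
      using that by (intro set_weight_ascending assms) (auto simp: W1_def W0_def)
    then have "Z n =
        (\<Sum>\<omega>\<in>Pow ?H. if gmodels \<phi> n \<omega> \<and> ordered_by id le n \<omega> then ?w \<omega> else 0)"
      unfolding Z_def by (intro sum.cong refl) auto
    also have "\<dots> = (\<Sum>\<omega> | \<omega> \<subseteq> ?H \<and> gmodels \<phi> n \<omega> \<and> ordered_by id le n \<omega>. ?w \<omega>)"
      using finite_herbrand_base[OF assms(1)] by (simp add: sum.If_cases Int_def)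
    finally show ?thesis
      using WFOMC_eq_fact[OF assms(1) \<phi>[OF that]] by simp
  qed
  then have "(\<lambda>n. if n = 0 then WFOMC P ar (with_linear_order \<psi> le) 0 w wbar
     else fact n * Z n) =
     (\<lambda>n. WFOMC P ar (with_linear_order \<psi> le) n w wbar)"
    by (intro ext) simp
  ultimately show ?thesis unfolding K_def by simp
qed

end
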